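(* For any integers $m\ge 2$ and $n\ge 2m+2$ there exists an elliptic symbol $Q$ of order $2m$ on $\mathbb{R}^n$ such that the fundamental solution $K_{L_Q}$ of the associated operator $L_Q$ is sign changing for $|x-y|\to 0$.
   Context: An elliptic symbol of order $2m$ on $\mathbb{R}^n$ is a real $2m$-homogeneous polynomial $Q(\xi)=\sum_{i_1,\dots,i_{2m}=1}^n A_{i_1,\dots,i_{2m}}\xi_{i_1}\cdots\xi_{i_{2m}}$ for which there is $\lambda>0$ with $Q(\xi)\ge\lambda|\xi|^{2m}$ for all $\xi\in\mathbb{R}^n$. The associated operator is $L_Q=(-1)^m Q\left(\frac{\partial}{\partial x_1},\dots,\frac{\partial}{\partial x_n}\right)$. For $L=L_Q$ and $n>2m$, $K_L$ denotes John's fundamental solution, i.e. for $x\ne y$ $$K_L(x,y)=-\frac{1}{4(2\pi)^{n-1}}(-\Delta_y)^{\frac{n+1-2m}{2}}\int_{|\xi|=1}\frac{|(x-y)\cdot\xi|}{Q(\xi)}\,d\mathcal{H}^{n-1}(\xi)\quad (n\text{ odd}),$$ $$K_L(x,y)=-\frac{1}{(2\pi)^{n}}(-\Delta_y)^{\frac{n-2m}{2}}\int_{|\xi|=1}\frac{\log|(x-y)\cdot\xi|}{Q(\xi)}\,d\mathcal{H}^{n-1}(\xi)\quad (n\text{ even}).$$ It satisfies $\int_{\mathbb{R}^n}K_L(x,y)L\psi(y)\,dy=\psi(x)$ for all $\psi\in C_0^\infty(\mathbb{R}^n)$. $\mathcal{H}^k$ is the $k$-dimensional Hausdorff measure. "$K_L$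 is sign changing for $|x-y|\to0$" means that for every $r>0$ there are points with $0<|x-y|<r$ where $K_L(x,y)>0$ and points with $0<|x-y|<r$ where $K_L(x,y)<0$. *)

theory Defs
  imports "HOL-Analysis.Analysis"
begin

text \<open>
  Hausdorff measure with the usual normalisation, under which the \<open>k\<close>-dimensional measure
  on \<open>k\<close>-dimensional Euclidean space is Lebesgue measure. Boundedness of the covering sets is
  required because \<^const>\<open>diameter\<close> is unspecified on unbounded sets; the empty set is
  treated separately only for the sake of \<open>k = 0\<close>, where \<open>0 ^ 0 = 1\<close>.
  As \<open>hausdorff_outer k\<close> is a metric outer measure, it is countably additive on Borel sets
  (Caratheodory's criterion), so \<^const>\<open>measure_of\<close> does not degenerate to the zero measure.
\<close>

definition hausdorff_premeasure :: "nat \<Rightarrow> 'a::metric_space set \<Rightarrow> ennreal" where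
  "hausdorff_premeasure k C =
     (if C = {} then 0 else ennreal (unit_ball_vol (real k) * (diameter C / 2) ^ k))"

definition hausdorff_content :: "nat \<Rightarrow> real \<Rightarrow> 'a::metric_space set \<Rightarrow> ennreal" where
  "hausdorff_content k \<delta> A =
     (INF C \<in> {C :: nat \<Rightarrow> 'a set. A \<subseteq> (\<Union>i. C i) \<and> (\<forall>i. bounded (C i) \<and> diameter (C i) \<le> \<delta>)}.
        \<Sum>i. hausdorff_premeasure k (C i))"

definition hausdorff_outer :: "nat \<Rightarrow> 'a::metric_space set \<Rightarrow> ennreal" where
  "hausdorff_outer k A = (SUP \<delta>\<in>{0<..}. hausdorff_content k \<delta> A)"

definition hausdorff_measure :: "nat \<Rightarrow> 'a::metric_space measure" where
  "hausdorff_measure k = measure_of UNIV (sets borel) (hausdorff_outer k)"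

definition partial_deriv :: "'n \<Rightarrow> (real^'n \<Rightarrow> real) \<Rightarrow> real^'n \<Rightarrow> real" where
  "partial_deriv i f y = deriv (\<lambda>t. f (y + t *\<^sub>R axis i 1)) 0"

definition laplacian :: "(real^'n::finite \<Rightarrow> real) \<Rightarrow> real^'n \<Rightarrow> real" where
  "laplacian f y = (\<Sum>i\<in>UNIV. partial_deriv i (partial_deriv i f) y)"

text \<open>Multi-indices \<open>(i\<^sub>1, \<dots>, i\<^sub>d)\<close> are lists of length \<open>d\<close> over the coordinate type.\<close>

definition homogeneous_poly :: "nat \<Rightarrow> ('n list \<Rightarrow> real) \<Rightarrow> real^'n::finite \<Rightarrow> real" where
  "homogeneous_poly d A \<xi> = (\<Sum>is | length is = d. A is * (\<Prod>i\<leftarrow>is. \<xi> $ i))"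

definition elliptic_symbol :: "nat \<Rightarrow> (real^'n::finite \<Rightarrow> real) \<Rightarrow> bool" where
  "elliptic_symbol m Q \<longleftrightarrow>
     (\<exists>A. Q = homogeneous_poly (2 * m) A) \<and>
     (\<exists>c>0. \<forall>\<xi>. Q \<xi> \<ge> c * norm \<xi> ^ (2 * m))"

text \<open>
  John's fundamental solution of the operator \<open>L\<^sub>Q = (-1)\<^sup>m Q(\<partial>/\<partial>x\<^sub>1, \<dots>, \<partial>/\<partial>x\<^sub>n)\<close>
  of order \<open>2m\<close>, given through its symbol \<open>Q\<close>. It is meant for \<open>2m < n\<close> and \<open>x \<noteq> y\<close>;
  then both exponents of \<open>-\<Delta>\<close> are natural numbers. The value \<open>ln 0 = 0\<close> only enters
  on a null set of the sphere.
\<close>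

definition john_kernel ::
    "nat \<Rightarrow> (real^'n::finite \<Rightarrow> real) \<Rightarrow> real^'n \<Rightarrow> real^'n \<Rightarrow> real" where
  "john_kernel m Q x y =
     (let n = CARD('n); \<sigma> = hausdorff_measure (n - 1) in
      if odd n then
        - 1 / (4 * (2 * pi) ^ (n - 1)) *
        ((\<lambda>f z. - laplacian f z) ^^ ((n + 1 - 2 * m) div 2))
          (\<lambda>z. LINT \<xi>:sphere 0 1|\<sigma>. \<bar>(x - z) \<bullet> \<xi>\<bar> / Q \<xi>) y
      else
        - 1 / (2 * pi) ^ n *
        ((\<lambda>f z. - laplacian f z) ^^ ((n - 2 * m) div 2))
          (\<lambda>z. LINT \<xi>:sphere 0 1|\<sigma>. ln \<bar>(x - z) \<bullet> \<xi>\<bar> / Q \<xi>) y)"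

definition sign_changing_near_diagonal :: "('a::metric_space \<Rightarrow> 'a \<Rightarrow> real) \<Rightarrow> bool" where
  "sign_changing_near_diagonal K \<longleftrightarrow>
     (\<forall>r>0. (\<exists>x y. 0 < dist x y \<and> dist x y < r \<and> K x y > 0) \<and>
            (\<exists>x y. 0 < dist x y \<and> dist x y < r \<and> K x y < 0))"

end

theory Submission
  imports Defs
begin

text \<open>Up to a negative constant, \<open>K\<^sub>L(0, z)\<close> is \<open>(-\<Delta>)\<^sup>k\<close> applied to the spherical average
  \<open>\<integral> \<phi>(z \<bullet> \<xi>) / Q(\<xi>) d\<sigma>(\<xi>)\<close> with \<open>\<phi>(t) = \<bar>t\<bar>\<close> or \<open>\<phi>(t) = ln \<bar>t\<bar>\<close>, so it is linear in \<open>1/Q\<close>.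
  Paired with a test function \<open>\<psi>\<close>, it becomes \<open>\<integral> D(\<xi>) / Q(\<xi>) d\<sigma>(\<xi>)\<close>, where
  \<open>D(\<xi>) = \<integral> \<phi>(z \<bullet> \<xi>) (-\<Delta>)\<^sup>k \<psi>(z) dz\<close>. When \<open>1/Q\<close> concentrates at \<open>\<plusminus>e\<close> the sign is that of \<open>D(e)\<close>.
  For a product \<open>\<psi>\<close> of a bump \<open>a\<close> along \<open>e\<close> and a bump across it, \<open>D(e)\<close> is a multiple of
  \<open>\<integral> \<phi>(t) a\<^bsup>(2k)\<^esup>(t) dt\<close>, since the derivatives across \<open>e\<close> integrate to zero. Rescaling \<open>a\<close> multiplies
  this by a power of the width with negative exponent as soon as \<open>2k\<close> is larger than the degree of \<open>\<phi>\<close> plus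
  one, whence it takes both signs on non-negative bumps. Thus \<open>K\<^sub>L\<close> takes both signs
  somewhere, and by homogeneity arbitrarily close to the diagonal.\<close>

section \<open>Hausdorff measures\<close>

text \<open>The natural candidate for Q, the model symbol
  \<open>|\<xi>'|^(2m) + \<epsilon> |\<xi>|^(2m)\<close> that is small only at the poles, fails: its
  reciprocal is at worst of size \<open>|\<xi>'|^(-2m)\<close>, which is integrable in the n - 1 >
  2m tangential dimensions, so no mass concentrates there. Q is therefore made small on a narrow
  cone around e. The cone meets the sphere in codimension one, where double vanishing already makes
  the integral of 1/Q blow up, and it is chosen inside the region where D keeps the sign it has at
  e. One Q must produce both signs, so two test functions are handled with the same cone. The
  profile is singular at \<open>z \<bullet> \<xi> = 0\<close>, so smoothness of the average cannot
  be read off the integrand. A rotation of the sphere from \<open>z/|z|\<close> to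
  \<open>y/|y|\<close> moves the dependence on y to 1/Q, which is smooth. The surface measure is a
  Hausdorff measure. It enters only through finiteness, rotation invariance and positivity on open
  sets; Fubini against Lebesgue measure and a pigeonhole argument stand in for polar coordinates.
  The bound n \<ge> 2m + 2 is what makes 2k at least the degree of the profile plus two in both
  parities.\<close>

lemma hausdorff_content_le:
  assumes "A \<subseteq> (\<Union>i. C i)" "\<And>i. bounded (C i)" "\<And>i. diameter (C i) \<le> \<delta>"
  shows "hausdorff_content k \<delta> A \<le> (\<Sum>i. hausdorff_premeasure k (C i))"
  unfolding hausdorff_content_def by (rule INF_lower) (use assms in auto)

lemma hausdorff_content_ge:
  assumes "\<And>C. A \<subseteq> (\<Union>i. C i) \<Longrightarrow> (\<And>i. bounded (C i)) \<Longrightarrow> (\<And>i. diameter (C i) \<le> \<delta>) \<Longrightarrow>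
     x \<le> (\<Sum>i. hausdorff_premeasure k (C i))"
  shows "x \<le> hausdorff_content k \<delta> A"
  unfolding hausdorff_content_def by (rule INF_greatest) (use assms in auto)

lemma hausdorff_content_mono:
  assumes "A \<subseteq> B"
  shows "hausdorff_content k \<delta> A \<le> hausdorff_content k \<delta> B"
  by (intro hausdorff_content_ge hausdorff_content_le) (use assms in auto)

lemma hausdorff_content_antimono:
  assumes "\<delta> \<le> \<delta>'"
  shows "hausdorff_content k \<delta>' A \<le> hausdorff_content k \<delta> A"
  by (intro hausdorff_content_ge hausdorff_content_le) (use assms order_trans in blast)+

lemma hausdorff_content_empty:
  "\<delta> > 0 \<Longrightarrow> hausdorff_content k \<delta> {} = 0"
  using hausdorff_content_le[of "{}" "\<lambda>_. {}" \<delta> k] by (simp add: hausdorff_premeasure_def)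

lemma hausdorff_content_countable_subadditive:
  "hausdorff_content k \<delta> (\<Union>i::nat. A i) \<le> (\<Sum>i. hausdorff_content k \<delta> (A i))"
proof (cases "(\<Sum>i. hausdorff_content k \<delta> (A i)) = \<infinity>")
  case False
  show ?thesis
  proof (rule ennreal_le_epsilon)
    fix e :: real assume "0 < e"
    define err where "err i = ennreal (e * (1/2) ^ Suc i)" for i :: nat
    have err_pos: "err i > 0" for i using \<open>0 < e\<close> by (simp add: err_def ennreal_less_zero_iff)
    have fin: "hausdorff_content k \<delta> (A i) \<noteq> \<infinity>" for i
      using False ennreal_suminf_lessD[of "\<lambda>i. hausdorff_content k \<delta> (A i)" \<infinity> i] by (simp add: less_top)
    have "\<exists>C. A i \<subseteq> (\<Union>j. C j) \<and> (\<forall>j. bounded (C j) \<and> diameter (C j) \<le> \<delta>) \<and>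
        (\<Sum>j. hausdorff_premeasure k (C j)) \<le> hausdorff_content k \<delta> (A i) + err i" for i
    proof -
      \<comment> \<open>Finiteness makes this strict, so that the infimum yields a cover with error
        at most \<open>err i\<close>; the errors add up to e.\<close>
      have "hausdorff_content k \<delta> (A i) < hausdorff_content k \<delta> (A i) + err i"
        using fin err_pos by (metis add.right_neutral ennreal_add_left_cancel_less infinity_ennreal_def)
      then show ?thesis
        unfolding hausdorff_content_def INF_less_iff by (auto intro: less_imp_le)
    qed
    then obtain C where C: "\<And>i. A i \<subseteq> (\<Union>j. C i j)" "\<And>i j. bounded (C i j)" "\<And>i j. diameter (C i j) \<le> \<delta>"
       "\<And>i. (\<Sum>j. hausdorff_premeasure k (C i j)) \<le> hausdorff_content k \<delta> (A i) + err i"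
      by metis
    have "hausdorff_content k \<delta> (\<Union>i. A i) \<le> (\<Sum>l. hausdorff_premeasure k (case_prod C (prod_decode l)))"
    proof (rule hausdorff_content_le)
      show "(\<Union>i. A i) \<subseteq> (\<Union>l. case_prod C (prod_decode l))"
      proof
        fix x assume "x \<in> (\<Union>i. A i)"
        then obtain i j where "x \<in> C i j" using C(1) by blast
        then show "x \<in> (\<Union>l. case_prod C (prod_decode l))"
          by (intro UN_I[of "prod_encode (i, j)"]) auto
      qed
    qed (auto split: prod.split simp: C)
    also have "\<dots> = (\<Sum>i. \<Sum>j. hausdorff_premeasure k (C i j))"
      by (rule suminf_ennreal_2dimen[where f="\<lambda>p. hausdorff_premeasure k (case_prod C p)"]) simp
    also have "\<dots> \<le> (\<Sum>i. hausdorff_content k \<delta> (A i) + err i)"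
      by (intro suminf_le C) auto
    also have "\<dots> = (\<Sum>i. hausdorff_content k \<delta> (A i)) + (\<Sum>i. err i)"
      by (rule suminf_add[symmetric]) auto
    also have "(\<Sum>i. err i) = ennreal e"
      unfolding err_def
      using \<open>0 < e\<close> sums_mult[OF power_half_series, of e] 
      by (subst suminf_ennreal2) (auto simp: sums_iff)
    finally show "hausdorff_content k \<delta> (\<Union>i. A i) \<le> (\<Sum>i. hausdorff_content k \<delta> (A i)) + ennreal e" .
  qed
qed (simp add: top_unique)

lemma hausdorff_content_le_outer: "\<delta> > 0 \<Longrightarrow> hausdorff_content k \<delta> A \<le> hausdorff_outer k A"
  unfolding hausdorff_outer_def by (rule SUP_upper) simp

lemma hausdorff_outer_mono: "A \<subseteq> B \<Longrightarrow> hausdorff_outer k A \<le> hausdorff_outer k B"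
  unfolding hausdorff_outer_def by (intro SUP_mono) (use hausdorff_content_mono in blast)

lemma hausdorff_outer_empty: "hausdorff_outer k {} = 0"
  unfolding hausdorff_outer_def by (simp add: hausdorff_content_empty)

lemma hausdorff_outer_countable_subadditive:
  "hausdorff_outer k (\<Union>i::nat. A i) \<le> (\<Sum>i. hausdorff_outer k (A i))"
  unfolding hausdorff_outer_def[of k "\<Union>i. A i"]
proof (rule SUP_least)
  fix \<delta> :: real assume "\<delta> \<in> {0<..}"
  then show "hausdorff_content k \<delta> (\<Union>i. A i) \<le> (\<Sum>i. hausdorff_outer k (A i))"
    by (intro order_trans[OF hausdorff_content_countable_subadditive] suminf_le)
       (auto intro: hausdorff_content_le_outer)
qed

lemma outer_measure_space_hausdorff_outer: "outer_measure_space UNIV (hausdorff_outer k)"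
  unfolding outer_measure_space_def positive_def increasing_def countably_subadditive_def
  using hausdorff_outer_countable_subadditive
  by (auto simp: hausdorff_outer_empty hausdorff_outer_mono)

lemma hausdorff_outer_Un_le: "hausdorff_outer k (A \<union> B) \<le> hausdorff_outer k A + hausdorff_outer k B"
proof -
  have "hausdorff_outer k (\<Union>i. binaryset A B i) \<le> (\<Sum>i. hausdorff_outer k (binaryset A B i))"
    by (rule hausdorff_outer_countable_subadditive)
  also have "\<dots> = hausdorff_outer k A + hausdorff_outer k B"
    by (intro suminf_binaryset_eq) (simp add: hausdorff_outer_empty)
  finally show ?thesis by (simp add: UN_binaryset_eq)
qed

text \<open>For P and Q read "C meets A" and "C meets B": a covering set smaller than the gap
  between A and B is charged to one of them only.\<close>

lemma hausdorff_premeasure_ge_0_split: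
  "hausdorff_premeasure k (if P then C else {}) + hausdorff_premeasure k (if Q then C else {})
     \<le> hausdorff_premeasure k C" if "\<not> (P \<and> Q)"
  using that by (auto simp: hausdorff_premeasure_def)

text \<open>Sets of diameter below d meet at most one of A and B, so a fine cover of the union
  splits into disjoint subfamilies covering A and B. This is the defining property of a metric outer
  measure.\<close>

lemma hausdorff_outer_separated_Un:
  assumes d: "d > 0" "\<And>a b. a \<in> A \<Longrightarrow> b \<in> B \<Longrightarrow> dist a b \<ge> d"
  shows "hausdorff_outer k (A \<union> B) = hausdorff_outer k A + hausdorff_outer k B"
proof (rule antisym[OF hausdorff_outer_Un_le])
  have *: "hausdorff_content k \<delta> A + hausdorff_content k \<delta> B \<le> hausdorff_content k \<delta> (A \<union> B)"
    if \<delta>: "\<delta> < d" "\<delta> > 0" for \<delta>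
  proof (rule hausdorff_content_ge)
    fix C :: "nat \<Rightarrow> 'a set"
    assume C: "A \<union> B \<subseteq> (\<Union>i. C i)" "\<And>i. bounded (C i)" "\<And>i. diameter (C i) \<le> \<delta>"
    define C1 where "C1 i = (if C i \<inter> A \<noteq> {} then C i else {})" for i
    define C2 where "C2 i = (if C i \<inter> B \<noteq> {} then C i else {})" for i
    have disj: "\<not> (C i \<inter> A \<noteq> {} \<and> C i \<inter> B \<noteq> {})" for i
    proof
      assume "C i \<inter> A \<noteq> {} \<and> C i \<inter> B \<noteq> {}"
      then obtain a b where ab: "a \<in> C i" "a \<in> A" "b \<in> C i" "b \<in> B" by blast
      then show False using diameter_bounded_bound[OF C(2) ab(1,3)] C(3)[of i] d(2)[OF ab(2,4)] \<delta> by linarith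
    qed
    have "hausdorff_content k \<delta> A \<le> (\<Sum>i. hausdorff_premeasure k (C1 i))"
      by (rule hausdorff_content_le) (use C \<delta> in \<open>auto simp: C1_def, blast\<close>)
    moreover have "hausdorff_content k \<delta> B \<le> (\<Sum>i. hausdorff_premeasure k (C2 i))"
      by (rule hausdorff_content_le) (use C \<delta> in \<open>auto simp: C2_def, blast\<close>)
    ultimately have "hausdorff_content k \<delta> A + hausdorff_content k \<delta> B 
        \<le> (\<Sum>i. hausdorff_premeasure k (C1 i)) + (\<Sum>i. hausdorff_premeasure k (C2 i))"
      by (rule add_mono)
    also have "\<dots> = (\<Sum>i. hausdorff_premeasure k (C1 i) + hausdorff_premeasure k (C2 i))"
      by (rule suminf_add) auto
    also have "\<dots> \<le> (\<Sum>i. hausdorff_premeasure k (C i))"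
      unfolding C1_def C2_def by (intro suminf_le hausdorff_premeasure_ge_0_split disj) auto
    finally show "hausdorff_content k \<delta> A + hausdorff_content k \<delta> B \<le> (\<Sum>i. hausdorff_premeasure k (C i))" .
  qed
  \<comment> \<open>Decreasing \<delta> only raises the contents, so both suprema are approached
    along a common \<delta>, which may also be taken below d.\<close>
  show "hausdorff_outer k A + hausdorff_outer k B \<le> hausdorff_outer k (A \<union> B)"
    unfolding hausdorff_outer_def[of k A] hausdorff_outer_def[of k B]
  proof (subst SUP_add_directed_ennreal[symmetric])
    show "(SUP i\<in>{0<..}. hausdorff_content k i A + hausdorff_content k i B) \<le> hausdorff_outer k (A \<union> B)"
    proof (rule SUP_least)
      fix \<delta> :: real assume "\<delta> \<in> {0<..}"
      then have m: "0 < min \<delta> (d/2)" "min \<delta> (d/2) < d" using d(1) by auto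
      have "hausdorff_content k \<delta> A + hausdorff_content k \<delta> B
        \<le> hausdorff_content k (min \<delta> (d/2)) A + hausdorff_content k (min \<delta> (d/2)) B"
        by (intro add_mono hausdorff_content_antimono) auto
      also have "\<dots> \<le> hausdorff_outer k (A \<union> B)"
        using *[OF m(2,1)] hausdorff_content_le_outer[OF m(1)] order_trans by blast
      finally show "hausdorff_content k \<delta> A + hausdorff_content k \<delta> B \<le> hausdorff_outer k (A \<union> B)" .
    qed
    show "\<exists>l\<in>{0<..}. hausdorff_content k i A + hausdorff_content k j B
             \<le> hausdorff_content k l A + hausdorff_content k l B" if "i \<in> {0<..}" "j \<in> {0<..}" for i j
      by (rule bexI[of _ "min i j"]) (use that in \<open>auto intro!: add_mono hausdorff_content_antimono\<close>)
  qed
qed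

text \<open>Caratheodory's criterion: the shells of the complement of a closed set \<open>C\<close> at distance
  between \<open>1/(i+2)\<close> and \<open>1/(i+1)\<close> from \<open>C\<close> are separated from each other when their indices differ
  by at least two, so their measures are summable.\<close>

lemma hausdorff_outer_shells:
  fixes R :: "nat \<Rightarrow> 'a::metric_space set"
  assumes sep: "\<And>i j. i + 2 \<le> j \<Longrightarrow> \<exists>d>0. \<forall>a\<in>R i. \<forall>b\<in>R j. dist a b \<ge> d"
    and sub: "\<And>i. R i \<subseteq> A" 
  shows "(\<Sum>i. hausdorff_outer k (R i)) \<le> 2 * hausdorff_outer k A"
proof -
  \<comment> \<open>Shells of one parity are mutually separated, so their measures add up exactly.
    The two parities account for the factor 2 in the conclusion.\<close>
  have fin_sep: "(\<Sum>i<N. hausdorff_outer k (R (2 * i + c))) = hausdorff_outer k (\<Union>i<N. R (2 * i + c))" for N c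
  proof (induction N)
    case (Suc N)
    have "\<exists>d>0. \<forall>a\<in>(\<Union>i<M. R (2*i+c)). \<forall>b\<in>R (2*N+c). dist a b \<ge> d" if "M \<le> N" for M
      using that
    proof (induction M)
      case 0 show ?case by (intro exI[of _ 1]) auto
    next
      case (Suc M)
      then obtain d1 where d1: "d1 > 0" "\<forall>a\<in>(\<Union>i<M. R (2*i+c)). \<forall>b\<in>R (2*N+c). dist a b \<ge> d1" by auto
      obtain d2 where d2: "d2 > 0" "\<forall>a\<in>R (2*M+c). \<forall>b\<in>R (2*N+c). dist a b \<ge> d2"
        using sep[of "2*M+c" "2*N+c"] Suc by auto
      show ?case
        using d1 d2 by (intro exI[of _ "min d1 d2"]) (auto simp: lessThan_Suc min_le_iff_disj)
    qed
    then obtain d where d: "d > 0" "\<forall>a\<in>(\<Union>i<N. R (2*i+c)). \<forall>b\<in>R (2*N+c). dist a b \<ge> d" by blast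
    have "hausdorff_outer k ((\<Union>i<N. R (2*i+c)) \<union> R (2*N+c)) = 
        hausdorff_outer k (\<Union>i<N. R (2*i+c)) + hausdorff_outer k (R (2*N+c))"
      by (rule hausdorff_outer_separated_Un[OF d(1)]) (use d(2) in blast)
    then show ?case using Suc.IH by (simp add: lessThan_Suc Un_commute add.commute)
  qed (simp add: hausdorff_outer_empty)
  have le: "(\<Sum>i<N. hausdorff_outer k (R (2 * i + c))) \<le> hausdorff_outer k A" for N c
    unfolding fin_sep by (rule hausdorff_outer_mono) (use sub in blast)
  show ?thesis
  proof (rule suminf_le_const)
    show "summable (\<lambda>i. hausdorff_outer k (R i))" by auto
    fix N
    have "(\<Sum>i<N. hausdorff_outer k (R i)) \<le> (\<Sum>i<2*N. hausdorff_outer k (R i))"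
      by (rule sum_mono2) auto
    also have "\<dots> = (\<Sum>i<N. hausdorff_outer k (R (2*i))) + (\<Sum>i<N. hausdorff_outer k (R (2*i+1)))"
      by (induction N) (auto simp: algebra_simps)
    also have "\<dots> \<le> 2 * hausdorff_outer k A"
      using add_mono[OF le[of 0 N] le[of 1 N]] by (simp add: mult_2)
    finally show "(\<Sum>i<N. hausdorff_outer k (R i)) \<le> 2 * hausdorff_outer k A" .
  qed
qed

lemma tendsto_suminf_tail_ennreal:
  fixes f :: "nat \<Rightarrow> ennreal"
  assumes "suminf f < \<infinity>"
  shows "(\<lambda>n. \<Sum>i. f (i + n)) \<longlonglongrightarrow> 0"
proof -
  have *: "(\<Sum>i. f (i + n)) = suminf f - sum f {..<n}" for n
  proof -
    have "suminf f = (\<Sum>i. f (i + n)) + sum f {..<n}" by (rule sums_unique[symmetric], rule sums_offset) (auto intro: summable_sums)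
    moreover have "sum f {..<n} < \<infinity>"
      by (rule le_less_trans[OF sum_le_suminf assms]) auto
    ultimately show ?thesis by (metis ennreal_add_diff_cancel_right infinity_ennreal_def less_irrefl)
  qed
  have "(\<lambda>n. suminf f - sum f {..<n}) \<longlonglongrightarrow> suminf f - suminf f"
    by (intro tendsto_diff_ennreal tendsto_const summable_LIMSEQ) (use assms in auto)
  then show ?thesis using assms by (simp add: * diff_eq_0_ennreal)
qed

text \<open>\<open>B n\<close>, the part of A at distance at least \<open>1/(n+1)\<close> from C, is
  separated from \<open>A \<inter> C\<close>, so the two measures add up to at most that of A. The
  rest of \<open>A - C\<close> lies in the shells of index at least n, and their total measure is
  the tail of a convergent series.\<close>

lemma closed_hausdorff_caratheodory:
  fixes C :: "'a::metric_space set"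
  assumes "closed C"
  shows "hausdorff_outer k (A \<inter> C) + hausdorff_outer k (A - C) \<le> hausdorff_outer k A"
proof (cases "hausdorff_outer k A = \<infinity> \<or> C = {}")
  case False
  then have fin: "hausdorff_outer k A < \<infinity>" and ne: "C \<noteq> {}" by (auto simp: less_top)
  define B where "B i = {x\<in>A. infdist x C \<ge> 1 / real (Suc i)}" for i
  define R where "R i = {x\<in>A. 1 / real (i + 2) \<le> infdist x C \<and> infdist x C < 1 / real (Suc i)}" for i
  have lip: "infdist a C - infdist b C \<le> dist a b" for a b
    using infdist_triangle[of a C b] by simp
  have "(\<Sum>i. hausdorff_outer k (R i)) \<le> 2 * hausdorff_outer k A"
  proof (rule hausdorff_outer_shells)
    fix i j :: nat assume ij: "i + 2 \<le> j"
    define d where "d = 1 / real (i + 2) - 1 / real (Suc j)"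
    have "d > 0" unfolding d_def using ij by (simp add: frac_less2)
    moreover have "dist a b \<ge> d" if "a \<in> R i" "b \<in> R j" for a b
      using that lip[of a b] by (simp add: R_def d_def)
    ultimately show "\<exists>d>0. \<forall>a\<in>R i. \<forall>b\<in>R j. dist a b \<ge> d" by blast
  qed (auto simp: R_def)
  also have "\<dots> < \<infinity>" using fin by (simp add: ennreal_mult_less_top)
  finally have Rfin: "(\<Sum>i. hausdorff_outer k (R i)) < \<infinity>" .
  have cover: "A - C \<subseteq> B n \<union> (\<Union>i. R (i + n))" for n
  proof
    fix x assume x: "x \<in> A - C"
    have pos: "infdist x C > 0"
      using x assms ne by (simp add: infdist_pos_not_in_closed)
    show "x \<in> B n \<union> (\<Union>i. R (i + n))"
    proof (cases "x \<in> B n")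
      case nB: False
      obtain m where m: "1 / real (Suc m) < infdist x C" using pos reals_Archimedean inverse_eq_divide by metis
      \<comment> \<open>The first index at which x is far enough from C. As x is outside
        \<open>B n\<close>, it exceeds n, and x lies in the shell of index l - 1.\<close>
      define l where "l = (LEAST m. 1 / real (Suc m) \<le> infdist x C)"
      have l1: "1 / real (Suc l) \<le> infdist x C" unfolding l_def by (rule LeastI[of _ m]) (use m in simp)
      have l2: "\<not> 1 / real (Suc j) \<le> infdist x C" if "j < l" for j using that not_less_Least unfolding l_def by blast
      have "l > n"
      proof (rule ccontr)
        assume "\<not> l > n"
        then have "1 / real (Suc n) \<le> 1 / real (Suc l)" by (simp add: frac_le)
        then have "x \<in> B n" using l1 x by (simp add: B_def)
        then show False using nB by simp
      qed
      then obtain i where i: "l = Suc (i + n)" by (metis add.commute less_imp_Suc_add)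
      have "x \<in> R (i + n)" using l1 l2[of "i + n"] x i by (simp add: R_def)
      then show ?thesis by blast
    qed simp
  qed
  have "hausdorff_outer k (A \<inter> C) + hausdorff_outer k (A - C) 
      \<le> hausdorff_outer k A + (\<Sum>i. hausdorff_outer k (R (i + n)))" for n
  proof -
    have "hausdorff_outer k (A - C) \<le> hausdorff_outer k (B n) + hausdorff_outer k (\<Union>i. R (i + n))"
      using hausdorff_outer_mono[OF cover] hausdorff_outer_Un_le order_trans by blast
    also have "\<dots> \<le> hausdorff_outer k (B n) + (\<Sum>i. hausdorff_outer k (R (i + n)))"
      by (intro add_left_mono hausdorff_outer_countable_subadditive)
    finally have 1: "hausdorff_outer k (A - C) \<le> hausdorff_outer k (B n) + (\<Sum>i. hausdorff_outer k (R (i + n)))" .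
    have "hausdorff_outer k ((A \<inter> C) \<union> B n) = hausdorff_outer k (A \<inter> C) + hausdorff_outer k (B n)"
    proof (rule hausdorff_outer_separated_Un)
      show "1 / real (Suc n) > 0" by simp
      fix a b assume "a \<in> A \<inter> C" "b \<in> B n"
      then show "1 / real (Suc n) \<le> dist a b"
        using infdist_le[of a C b] by (simp add: B_def dist_commute)
    qed
    moreover have "hausdorff_outer k ((A \<inter> C) \<union> B n) \<le> hausdorff_outer k A"
      by (rule hausdorff_outer_mono) (auto simp: B_def)
    ultimately have 2: "hausdorff_outer k (A \<inter> C) + hausdorff_outer k (B n) \<le> hausdorff_outer k A" by simp
    have "hausdorff_outer k (A \<inter> C) + hausdorff_outer k (A - C)
       \<le> (hausdorff_outer k (A \<inter> C) + hausdorff_outer k (B n)) + (\<Sum>i. hausdorff_outer k (R (i + n)))"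
      using add_left_mono[OF 1, of "hausdorff_outer k (A \<inter> C)"] by (simp add: add.assoc)
    also have "\<dots> \<le> hausdorff_outer k A + (\<Sum>i. hausdorff_outer k (R (i + n)))"
      by (rule add_right_mono[OF 2])
    finally show ?thesis .
  qed
  moreover have "(\<lambda>n. hausdorff_outer k A + (\<Sum>i. hausdorff_outer k (R (i + n)))) \<longlonglongrightarrow> hausdorff_outer k A + 0"
    by (intro tendsto_add tendsto_const tendsto_suminf_tail_ennreal Rfin)
  ultimately show ?thesis
    using LIMSEQ_le_const[of _ "hausdorff_outer k A + 0"] by fastforce
qed (auto simp: hausdorff_outer_empty)

text \<open>Closed sets generate the Borel sets and satisfy Caratheodory's criterion, and the sets
  satisfying it form a sigma-algebra on which the outer measure is a measure.\<close>

lemma borel_subset_lambda_system_hausdorff: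
  "sets borel \<subseteq> lambda_system UNIV UNIV (hausdorff_outer k :: 'a::metric_space set \<Rightarrow> ennreal)"
proof -
  interpret sigma_algebra "UNIV :: 'a set" UNIV 
    by (metis Pow_UNIV sigma_algebra_Pow)
  have ms: "measure_space UNIV (lambda_system UNIV UNIV (hausdorff_outer k)) (hausdorff_outer k :: 'a set \<Rightarrow> ennreal)"
    by (rule caratheodory_lemma) (rule outer_measure_space_hausdorff_outer)
  then have sa: "sigma_algebra (UNIV :: 'a set) (lambda_system UNIV UNIV (hausdorff_outer k))"
    by (simp add: measure_space_def)
  have "C \<in> lambda_system UNIV UNIV (hausdorff_outer k)" if "closed C" for C :: "'a set"
  proof -
    have "hausdorff_outer k (A \<inter> C) + hausdorff_outer k (A - C) = hausdorff_outer k A" for A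
      using closed_hausdorff_caratheodory[OF that, of k A] hausdorff_outer_Un_le[of k "A \<inter> C" "A - C"]
      by (simp add: Int_Diff_Un antisym)
    then show ?thesis by (simp add: lambda_system_eq)
  qed
  then show ?thesis
    unfolding borel_eq_closed using sigma_algebra.sigma_sets_subset[OF sa, of "Collect closed"] by auto
qed

lemma sets_hausdorff_measure [simp, measurable_cong]: "sets (hausdorff_measure k) = sets borel"
  unfolding hausdorff_measure_def by (metis sets_measure_of sets.sigma_sets_eq space_borel subset_Pow_Union top_greatest Pow_UNIV)

lemma space_hausdorff_measure [simp]: "space (hausdorff_measure k) = UNIV"
  unfolding hausdorff_measure_def by (simp add: space_measure_of_conv)

lemma emeasure_hausdorff_measure:
  fixes A :: "'a::metric_space set"
  assumes "A \<in> sets borel"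
  shows "emeasure (hausdorff_measure k) A = hausdorff_outer k A"
proof -
  interpret sigma_algebra "UNIV :: 'a set" UNIV 
    by (metis Pow_UNIV sigma_algebra_Pow)
  have "measure_space UNIV (lambda_system UNIV UNIV (hausdorff_outer k)) (hausdorff_outer k :: 'a set \<Rightarrow> ennreal)"
    by (rule caratheodory_lemma) (rule outer_measure_space_hausdorff_outer)
  then have "measure_space UNIV (sets borel) (hausdorff_outer k :: 'a set \<Rightarrow> ennreal)"
    by (rule measure_down) (use borel_subset_lambda_system_hausdorff sets.sigma_algebra_axioms[of borel] in auto)
  then show ?thesis
    using assms unfolding hausdorff_measure_def
    by (intro emeasure_measure_of[OF refl]) (auto simp: measure_space_def sets_measure_of_conv sets.sigma_sets_eq[of borel, simplified])
qed

section \<open>Invariance of Hausdorff measure under isometries\<close>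

lemma diameter_isometry_image:
  assumes "\<And>x y. dist (T x) (T y) = dist x y"
  shows "diameter (T ` S) = diameter S"
proof -
  have "T ` S \<times> T ` S = (\<lambda>(x, y). (T x, T y)) ` (S \<times> S)" by auto
  then have "(\<lambda>(x, y). dist x y) ` (T ` S \<times> T ` S) = (\<lambda>(x, y). dist x y) ` (S \<times> S)"
    using assms by (simp add: image_image case_prod_beta)
  then show ?thesis by (simp add: diameter_def)
qed

text \<open>T carries covers of A to covers of its image with unchanged diameters. Applied to an
  orthogonal map and to its inverse, the inequality becomes an equality.\<close>

lemma hausdorff_outer_isometry_image_le:
  fixes T :: "'a::metric_space \<Rightarrow> 'b::metric_space"
  assumes T: "\<And>x y. dist (T x) (T y) = dist x y"
  shows "hausdorff_outer k (T ` A) \<le> hausdorff_outer k A"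
proof -
  have "hausdorff_content k \<delta> (T ` A) \<le> hausdorff_content k \<delta> A" for \<delta>
  proof (rule hausdorff_content_ge)
    fix C :: "nat \<Rightarrow> 'a set" assume C: "A \<subseteq> (\<Union>i. C i)" "\<And>i. bounded (C i)" "\<And>i. diameter (C i) \<le> \<delta>"
    have bdd: "bounded (T ` C i)" for i
      using C(2)[of i] by (auto simp: bounded_two_points T)
    have "hausdorff_content k \<delta> (T ` A) \<le> (\<Sum>i. hausdorff_premeasure k (T ` C i))"
    proof (rule hausdorff_content_le)
      show "T ` A \<subseteq> (\<Union>i. T ` C i)" using C(1) by blast
    qed (use C bdd in \<open>auto simp: diameter_isometry_image[OF T]\<close>)
    then show "hausdorff_content k \<delta> (T ` A) \<le> (\<Sum>i. hausdorff_premeasure k (C i))"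
      by (simp add: hausdorff_premeasure_def diameter_isometry_image[OF T] cong: if_cong)
  qed
  then show ?thesis unfolding hausdorff_outer_def by (intro SUP_mono) blast
qed

lemma distr_hausdorff_measure_orthogonal:
  fixes T :: "'a::euclidean_space \<Rightarrow> 'a"
  assumes T: "orthogonal_transformation T"
  shows "distr (hausdorff_measure k) borel T = hausdorff_measure k"
proof (rule measure_eqI)
  have Tm[measurable]: "T \<in> borel \<rightarrow>\<^sub>M borel"
    using T by (intro borel_measurable_continuous_onI linear_continuous_on linear_linear[THEN iffD2] orthogonal_transformation_linear)
  have iso: "dist (T x) (T y) = dist x y" for x y
    using T by (simp add: orthogonal_transformation_isometry)
  have iso': "dist (inv T x) (inv T y) = dist x y" for x y
    using orthogonal_transformation_inv[OF T] by (simp add: orthogonal_transformation_isometry)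
  fix A assume "A \<in> sets (distr (hausdorff_measure k) borel T)"
  then have [measurable]: "A \<in> sets borel" by simp
  have A': "T -` A \<in> sets borel" using measurable_sets[OF Tm] by simp
  have eq: "T -` A = inv T ` A"
    using orthogonal_transformation_bij[OF T] by (simp add: bij_vimage_eq_inv_image)
  have eq2: "A = T ` (T -` A)"
    using orthogonal_transformation_surj[OF T] by (simp add: surj_image_vimage_eq)
  have "emeasure (distr (hausdorff_measure k) borel T) A = hausdorff_outer k (T -` A)"
    using A' by (subst emeasure_distr) (auto simp: emeasure_hausdorff_measure)
  also have "\<dots> = hausdorff_outer k A"
  proof (rule antisym)
    show "hausdorff_outer k (T -` A) \<le> hausdorff_outer k A"
      unfolding eq by (rule hausdorff_outer_isometry_image_le[OF iso'])
    show "hausdorff_outer k A \<le> hausdorff_outer k (T -` A)"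
      by (subst eq2) (rule hausdorff_outer_isometry_image_le[OF iso])
  qed
  finally show "emeasure (distr (hausdorff_measure k) borel T) A = emeasure (hausdorff_measure k) A"
    by (simp add: emeasure_hausdorff_measure)
qed simp

section \<open>The measure on the unit sphere\<close>

definition radial_cone :: "'a::real_normed_vector set \<Rightarrow> 'a set" where
  "radial_cone C = {r *\<^sub>R x | r x. 1 \<le> r \<and> r \<le> 2 \<and> x \<in> C}"

lemma outer_measure_of_le: "A \<subseteq> B \<Longrightarrow> B \<in> sets M \<Longrightarrow> outer_measure_of M A \<le> emeasure M B"
  unfolding outer_measure_of_def by (rule INF_lower) simp

lemma outer_measure_of_UN_le:
  assumes "\<And>i::nat. A i \<subseteq> space M"
  shows "outer_measure_of M (\<Union>i. A i) \<le> (\<Sum>i. outer_measure_of M (A i))"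
proof -
  have "\<forall>i. \<exists>E\<in>sets M. A i \<subseteq> E \<and> outer_measure_of M (A i) = emeasure M E"
    by (intro allI outer_measure_of_attain assms)
  then obtain E where E: "\<And>i. E i \<in> sets M" "\<And>i. A i \<subseteq> E i" "\<And>i. outer_measure_of M (A i) = emeasure M (E i)"
    by metis
  have "outer_measure_of M (\<Union>i. A i) \<le> emeasure M (\<Union>i. E i)"
    by (rule outer_measure_of_le) (use E in auto)
  also have "\<dots> \<le> (\<Sum>i. emeasure M (E i))"
    by (rule emeasure_subadditive_countably) (use E in auto)
  finally show ?thesis by (simp add: E)
qed

text \<open>The cone over a set of diameter d is covered by about 1/d balls of radius 3d centred on
  a ray through one of its points. Their total volume is of order \<open>d ^ (n - 1)\<close>, the
  power that occurs in the premeasure. Outer measure appears because covering sets are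
  arbitrary.\<close>

lemma outer_measure_radial_cone_le:
  fixes C :: "'a::euclidean_space set"
  assumes C: "C \<subseteq> sphere 0 1" "diameter C \<le> 1" and n: "DIM('a) \<ge> 2"
  shows "outer_measure_of lborel (radial_cone C)
     \<le> ennreal (3 ^ (DIM('a) + 1) * unit_ball_vol DIM('a) * diameter C ^ (DIM('a) - 1))"
proof (cases "C = {}")
  case False
  then obtain \<xi> where \<xi>: "\<xi> \<in> C" by blast
  have nrm: "norm \<xi> = 1" using \<xi> C by auto
  have bdd: "bounded C" using C(1) bounded_sphere bounded_subset by blast
  have diam: "norm (x - \<xi>) \<le> diameter C" if "x \<in> C" for x
    using diameter_bounded_bound[OF bdd that \<xi>] by (simp add: dist_norm)
  have d0: "diameter C \<ge> 0" by (rule diameter_ge_0[OF bdd])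
  \<comment> \<open>The diameter may be 0, so the estimate is made for every slightly larger d and
    the limit is taken afterwards.\<close>
  have *: "outer_measure_of lborel (radial_cone C) \<le> ennreal (3 ^ (DIM('a) + 1) * unit_ball_vol DIM('a) * d ^ (DIM('a) - 1))"
    if d: "d > diameter C" "d \<le> 2" for d
  proof -
    have dpos: "d > 0" using d0 d by linarith
    define N where "N = nat \<lfloor>1 / d\<rfloor>"
    have N: "real N \<le> 1 / d" using dpos by (simp add: N_def)
    have "radial_cone C \<subseteq> (\<Union>j\<in>{..N}. cball ((1 + real j * d) *\<^sub>R \<xi>) (3 * d))"
    proof
      fix y assume "y \<in> radial_cone C"
      then obtain r x where rx: "y = r *\<^sub>R x" "1 \<le> r" "r \<le> 2" "x \<in> C" by (auto simp: radial_cone_def)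
      define j where "j = nat \<lfloor>(r - 1) / d\<rfloor>"
      have rd: "(r - 1) / d \<ge> 0" "(r - 1) / d \<le> 1 / d" using rx dpos by (auto simp: divide_right_mono)
      have j: "real j \<le> (r - 1) / d" "(r - 1) / d < real j + 1" using rd by (auto simp: j_def)
      have jN: "j \<le> N" unfolding j_def N_def using rd by (intro nat_mono floor_mono) auto
      have j': "real j * d \<le> r - 1" "r - 1 < real j * d + d" 
        using j dpos by (simp_all add: field_simps)
      have "norm ((1 + real j * d) *\<^sub>R \<xi> - y) \<le> 3 * d"
      proof -
        have "(1 + real j * d) *\<^sub>R \<xi> - y = (1 + real j * d - r) *\<^sub>R \<xi> + r *\<^sub>R (\<xi> - x)"
          by (simp add: rx algebra_simps)
        then have "norm ((1 + real j * d) *\<^sub>R \<xi> - y) \<le> \<bar>1 + real j * d - r\<bar> + r * norm (\<xi> - x)"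
          using norm_triangle_ineq[of "(1 + real j * d - r) *\<^sub>R \<xi>" "r *\<^sub>R (\<xi> - x)"] rx(2) nrm by simp
        \<comment> \<open>The mesh d of the centres leaves an error d along the ray. Across the ray
          points of C deviate by at most d, stretched by the factor r \<le> 2.\<close>
        also have "\<dots> \<le> d + 2 * d"
        proof (rule add_mono)
          show "\<bar>1 + real j * d - r\<bar> \<le> d" using j' by linarith
          show "r * norm (\<xi> - x) \<le> 2 * d"
            using diam[OF rx(4)] d rx by (intro mult_mono) (auto simp: norm_minus_commute)
        qed
        finally show ?thesis by simp
      qed
      then show "y \<in> (\<Union>j\<in>{..N}. cball ((1 + real j * d) *\<^sub>R \<xi>) (3 * d))"
        using jN by (intro UN_I[of j]) (auto simp: dist_norm)
    qed
    then have "outer_measure_of lborel (radial_cone C) \<le> emeasure lborel (\<Union>j\<in>{..N}. cball ((1 + real j * d) *\<^sub>R \<xi>) (3 * d))"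
      by (rule outer_measure_of_le) auto
    also have "\<dots> \<le> (\<Sum>j\<in>{..N}. emeasure lborel (cball ((1 + real j * d) *\<^sub>R \<xi>) (3 * d)))"
      by (rule emeasure_subadditive_finite) auto
    also have "\<dots> = (\<Sum>j\<in>{..N}. ennreal (unit_ball_vol DIM('a) * (3 * d) ^ DIM('a)))"
      using dpos by (simp add: emeasure_cball)
    also have "\<dots> = ennreal (real (Suc N) * (unit_ball_vol DIM('a) * (3 * d) ^ DIM('a)))"
      using dpos by (simp add: ennreal_mult' ennreal_of_nat_eq_real_of_nat)
    also have "\<dots> \<le> ennreal ((3 / d) * (unit_ball_vol DIM('a) * (3 * d) ^ DIM('a)))"
    proof (intro ennreal_leI mult_right_mono)
      have "real (Suc N) \<le> 1 / d + 1" using N by simp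
      also have "\<dots> \<le> 1 / d + 2 / d" using dpos d by (intro add_left_mono) (simp add: field_simps)
      finally show "real (Suc N) \<le> 3 / d" by (simp add: add_divide_distrib[symmetric])
    qed (use dpos in auto)
    also have "(3 / d) * (unit_ball_vol DIM('a) * (3 * d) ^ DIM('a)) = 3 ^ (DIM('a) + 1) * unit_ball_vol DIM('a) * d ^ (DIM('a) - 1)"
    proof -
      obtain l where l: "DIM('a) = Suc l" using n by (cases "DIM('a)") auto
      show ?thesis unfolding l power_mult_distrib using dpos by simp
    qed
    finally show ?thesis .
  qed
  show ?thesis
  proof (rule LIMSEQ_le_const)
    show "(\<lambda>l. ennreal (3 ^ (DIM('a) + 1) * unit_ball_vol DIM('a) * (diameter C + inverse (real (Suc l))) ^ (DIM('a) - 1)))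
      \<longlonglongrightarrow> ennreal (3 ^ (DIM('a) + 1) * unit_ball_vol DIM('a) * (diameter C) ^ (DIM('a) - 1))"
      using LIMSEQ_inverse_real_of_nat_add[of "diameter C"]
      by (intro tendsto_ennrealI tendsto_mult tendsto_const tendsto_power)
    show "\<exists>N. \<forall>l\<ge>N. outer_measure_of lborel (radial_cone C)
      \<le> ennreal (3 ^ (DIM('a) + 1) * unit_ball_vol DIM('a) * (diameter C + inverse (real (Suc l))) ^ (DIM('a) - 1))"
    proof (intro exI allI impI *)
      fix l :: nat
      have "inverse (real (Suc l)) \<le> 1" by (simp add: inverse_le_1_iff)
      then show "diameter C + inverse (real (Suc l)) \<le> 2" using C(2) by linarith
    qed simp
  qed
qed (simp add: radial_cone_def)

text \<open>The volume of the cone over Z is at most K times the premeasure sum of any cover of Z by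
  sets of diameter at most 1. Hence a Z of Hausdorff measure zero would have a cone of volume
  zero.\<close>

lemma hausdorff_outer_sphere_ge:
  fixes Z :: "'a::euclidean_space set"
  assumes Z: "Z \<subseteq> sphere 0 1" and n: "DIM('a) \<ge> 2" and pos: "outer_measure_of lborel (radial_cone Z) > 0"
  shows "hausdorff_outer (DIM('a) - 1) Z > 0"
proof (rule ccontr)
  let ?n = "DIM('a)"
  \<comment> \<open>The constant of \<open>outer_measure_radial_cone_le\<close> divided by the
    normalisation \<open>unit_ball_vol (n - 1) / 2 ^ (n - 1)\<close> of the premeasure.\<close>
  define K where "K = 3 ^ (?n + 1) * unit_ball_vol ?n * 2 ^ (?n - 1) / unit_ball_vol (real (?n - 1))"
  have K: "K > 0" by (simp add: K_def)
  have "outer_measure_of lborel (radial_cone Z) / ennreal K \<le> hausdorff_content (?n - 1) 1 Z"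
  proof (rule hausdorff_content_ge)
    fix C :: "nat \<Rightarrow> 'a set"
    assume C: "Z \<subseteq> (\<Union>i. C i)" "\<And>i. bounded (C i)" "\<And>i. diameter (C i) \<le> 1"
    have "outer_measure_of lborel (radial_cone Z) \<le> outer_measure_of lborel (\<Union>i. radial_cone (C i \<inter> sphere 0 1))"
      by (rule outer_measure_of_mono) (use C(1) Z in \<open>fastforce simp: radial_cone_def\<close>)
    also have "\<dots> \<le> (\<Sum>i. outer_measure_of lborel (radial_cone (C i \<inter> sphere 0 1)))"
      by (rule outer_measure_of_UN_le) simp
    also have "\<dots> \<le> (\<Sum>i. ennreal K * hausdorff_premeasure (?n - 1) (C i))"
    proof (intro suminf_le)
      fix i
      have le: "diameter (C i \<inter> sphere 0 1) \<le> diameter (C i)"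
        by (rule diameter_subset) (use C in auto)
      show "outer_measure_of lborel (radial_cone (C i \<inter> sphere 0 1)) \<le> ennreal K * hausdorff_premeasure (?n - 1) (C i)"
      proof (cases "C i = {}")
        case False
        have "outer_measure_of lborel (radial_cone (C i \<inter> sphere 0 1)) 
          \<le> ennreal (3 ^ (?n + 1) * unit_ball_vol ?n * diameter (C i \<inter> sphere 0 1) ^ (?n - 1))"
          by (rule outer_measure_radial_cone_le) (use le C(3)[of i] n in auto)
        also have "\<dots> \<le> ennreal (3 ^ (?n + 1) * unit_ball_vol ?n * diameter (C i) ^ (?n - 1))"
          using C(2)[of i] le by (intro ennreal_leI mult_left_mono power_mono diameter_ge_0) (auto intro: bounded_Int)
        also have "3 ^ (?n + 1) * unit_ball_vol ?n * diameter (C i) ^ (?n - 1) = 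
             K * (unit_ball_vol (real (?n - 1)) * (diameter (C i) / 2) ^ (?n - 1))"
          using unit_ball_vol_pos[of "real (?n - 1)"] by (simp add: K_def power_divide del: unit_ball_vol_pos)
        finally show ?thesis
          using False K by (simp add: hausdorff_premeasure_def ennreal_mult')
      qed (simp add: radial_cone_def)
    qed auto
    also have "\<dots> = ennreal K * (\<Sum>i. hausdorff_premeasure (?n - 1) (C i))"
      by simp
    finally show "outer_measure_of lborel (radial_cone Z) / ennreal K \<le> (\<Sum>i. hausdorff_premeasure (?n - 1) (C i))"
      using K by (intro divide_le_posI_ennreal) (auto simp: mult.commute)
  qed
  also have "\<dots> \<le> hausdorff_outer (?n - 1) Z" by (rule hausdorff_content_le_outer) simp
  finally have le: "outer_measure_of lborel (radial_cone Z) / ennreal K \<le> hausdorff_outer (?n - 1) Z" .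
  assume "\<not> hausdorff_outer (?n - 1) Z > 0"
  then have "outer_measure_of lborel (radial_cone Z) / ennreal K = 0" using le by simp
  then show False using pos by (simp add: ennreal_divide_eq_0_iff)
qed

section \<open>Finiteness of the measure of the sphere by packing\<close>

lemma power_diff_le:
  fixes a b :: real
  assumes "0 \<le> b" "b \<le> a" "a \<le> 2"
  shows "a ^ n - b ^ n \<le> (a - b) * real n * 2 ^ n"
proof (induction n)
  case (Suc n)
  have "a ^ Suc n - b ^ Suc n = a * (a ^ n - b ^ n) + b ^ n * (a - b)" by (simp add: algebra_simps)
  also have "\<dots> \<le> 2 * ((a - b) * real n * 2 ^ n) + 2 ^ n * (a - b)"
    using assms Suc by (intro add_mono mult_mono power_mono) (auto intro: power_mono)
  also have "\<dots> \<le> (a - b) * real (Suc n) * 2 ^ Suc n"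
    using assms by (simp add: algebra_simps mult_left_mono)
  finally show ?case .
qed simp

text \<open>The balls of radius e/2 about the points are disjoint and lie in a shell of thickness e
  around the sphere. The shell has volume of order e, each ball of order \<open>e ^ n\<close>, which
  leaves at most order \<open>e ^ (1 - n)\<close> points.\<close>

lemma card_separated_sphere_le:
  fixes F :: "'a::euclidean_space set"
  assumes F: "finite F" "F \<subseteq> sphere 0 1" and e: "0 < e" "e \<le> 1"
    and sep: "\<And>x y. x \<in> F \<Longrightarrow> y \<in> F \<Longrightarrow> x \<noteq> y \<Longrightarrow> dist x y \<ge> e"
  shows "real (card F) * e ^ (DIM('a) - 1) \<le> DIM('a) * 4 ^ DIM('a)"
proof -
  let ?n = "DIM('a)"
  define A where "A = ball (0::'a) (1 + e / 2) - ball 0 (1 - e / 2)"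
  have disj: "disjoint_family_on (\<lambda>x. ball x (e / 2)) F"
    unfolding disjoint_family_on_def
  proof safe
    fix x y z assume "x \<in> F" "y \<in> F" "x \<noteq> y" "z \<in> ball x (e / 2)" "z \<in> ball y (e / 2)"
    then show "z \<in> {}" using sep[of x y] dist_triangle2[of x y z] by (simp add: dist_commute)
  qed
  have sub: "(\<Union>x\<in>F. ball x (e / 2)) \<subseteq> A"
  proof
    fix z assume "z \<in> (\<Union>x\<in>F. ball x (e / 2))"
    then obtain x where x: "x \<in> F" "norm (x - z) < e / 2" by (auto simp: dist_norm)
    then have "norm x = 1" using F by auto
    then show "z \<in> A" using x(2) norm_triangle_ineq2[of x z] norm_triangle_ineq2[of z x] 
      by (auto simp: A_def norm_minus_commute)
  qed
  have "ennreal (real (card F) * (unit_ball_vol ?n * (e / 2) ^ ?n)) = (\<Sum>x\<in>F. emeasure lborel (ball x (e / 2)))"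
    using e by (simp add: emeasure_ball ennreal_mult' ennreal_of_nat_eq_real_of_nat)
  also have "\<dots> = emeasure lborel (\<Union>x\<in>F. ball x (e / 2))"
    by (rule sum_emeasure) (use disj F in auto)
  also have "\<dots> \<le> emeasure lborel A"
    by (rule emeasure_mono[OF sub]) (auto simp: A_def)
  also have "\<dots> = emeasure lborel (ball (0::'a) (1 + e / 2)) - emeasure lborel (ball (0::'a) (1 - e / 2))"
    unfolding A_def using e by (intro emeasure_Diff) (auto simp: emeasure_ball)
  also have "\<dots> = ennreal (unit_ball_vol ?n * (1 + e / 2) ^ ?n - unit_ball_vol ?n * (1 - e / 2) ^ ?n)"
    using e by (simp add: emeasure_ball ennreal_minus)
  finally have "real (card F) * (unit_ball_vol ?n * (e / 2) ^ ?n) 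
      \<le> unit_ball_vol ?n * (1 + e / 2) ^ ?n - unit_ball_vol ?n * (1 - e / 2) ^ ?n"
    using e by (subst (asm) ennreal_le_iff) (auto intro!: mult_left_mono power_mono)
  then have "unit_ball_vol ?n * (real (card F) * (e / 2) ^ ?n) \<le> unit_ball_vol ?n * ((1 + e / 2) ^ ?n - (1 - e / 2) ^ ?n)"
    by (simp add: algebra_simps)
  then have "real (card F) * (e / 2) ^ ?n \<le> (1 + e / 2) ^ ?n - (1 - e / 2) ^ ?n"
    using unit_ball_vol_pos[of "real ?n"] by (subst (asm) mult_le_cancel_left_pos) auto
  also have "\<dots> \<le> ((1 + e / 2) - (1 - e / 2)) * real ?n * 2 ^ ?n"
    using e by (intro power_diff_le) auto
  finally have *: "real (card F) * (e / 2) ^ ?n \<le> e * real ?n * 2 ^ ?n" by simp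
  obtain l where l: "?n = Suc l" using DIM_positive[where 'a='a] by (cases "DIM('a)") auto
  have "e * (real (card F) * e ^ l) = 2 ^ ?n * (real (card F) * (e / 2) ^ ?n)"
    by (simp add: l power_divide)
  also have "\<dots> \<le> 2 ^ ?n * (e * real ?n * 2 ^ ?n)" using * by (intro mult_left_mono) auto
  also have "\<dots> = e * (real ?n * 4 ^ ?n)"
    using power_mult_distrib[of "2::real" 2 ?n] by simp
  finally show ?thesis using e by (simp only: l mult_le_cancel_left_pos diff_Suc_1 of_nat_mult of_nat_power of_nat_numeral)
qed

text \<open>A largest e-separated subset of the sphere is also an e-net, so as few balls as the
  packing bound allows cover the sphere. Their premeasures sum to a bound that is independent of
  \<delta>.\<close>

lemma hausdorff_outer_sphere_le:
  "hausdorff_outer (DIM('a) - 1) (sphere (0::'a::euclidean_space) 1)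
     \<le> ennreal (unit_ball_vol (real (DIM('a) - 1)) * (DIM('a) * 4 ^ DIM('a)))"
  unfolding hausdorff_outer_def
proof (rule SUP_least)
  let ?n = "DIM('a)" and ?S = "sphere (0::'a) 1"
  fix \<delta> :: real assume "\<delta> \<in> {0<..}"
  \<comment> \<open>Balls of radius e have diameter at most 2e \<le> \<delta>, and e \<le> 1 is the
    range of the packing bound.\<close>
  define e where "e = min \<delta> 1 / 2"
  have e: "0 < e" "e \<le> 1" "2 * e \<le> \<delta>" using \<open>\<delta> \<in> {0<..}\<close> by (auto simp: e_def)
  define P where "P F \<longleftrightarrow> finite F \<and> F \<subseteq> ?S \<and> (\<forall>x\<in>F. \<forall>y\<in>F. x \<noteq> y \<longrightarrow> dist x y \<ge> e)" for F
  have "card F \<le> nat \<lceil>DIM('a) * 4 ^ DIM('a) / e ^ (?n - 1)\<rceil>" if "P F" for F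
  proof -
    have "real (card F) * e ^ (DIM('a) - 1) \<le> DIM('a) * 4 ^ DIM('a)"
      by (rule card_separated_sphere_le) (use that e in \<open>auto simp: P_def\<close>)
    then have "real (card F) \<le> DIM('a) * 4 ^ DIM('a) / e ^ (?n - 1)" using e by (simp add: field_simps)
    then show ?thesis by linarith
  qed
  moreover have "P {}" by (simp add: P_def)
  ultimately have "\<exists>F. P F \<and> (\<forall>G. P G \<longrightarrow> card G \<le> card F)"
    by (intro ex_has_greatest_nat[of P "{}" card "Suc (nat \<lceil>DIM('a) * 4 ^ DIM('a) / e ^ (?n - 1)\<rceil>)"])
       (auto simp: less_Suc_eq_le)
  then obtain F where F: "P F" "\<And>G. P G \<Longrightarrow> card G \<le> card F" by blast
  have cover: "?S \<subseteq> (\<Union>x\<in>F. cball x e)"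
  proof
    fix x assume x: "x \<in> ?S"
    show "x \<in> (\<Union>x\<in>F. cball x e)"
    proof (rule ccontr)
      assume "x \<notin> (\<Union>x\<in>F. cball x e)"
      then have far: "dist y x > e" if "y \<in> F" for y using that by auto
      then have "x \<notin> F" using e by (metis dist_self less_asym)
      have "P (insert x F)"
        unfolding P_def
      proof (intro conjI ballI impI)
        fix y z assume "y \<in> insert x F" "z \<in> insert x F" "y \<noteq> z"
        then show "e \<le> dist y z"
          using F(1) far[of y] far[of z] unfolding P_def by (auto simp: dist_commute[of x])
      qed (use F(1) x in \<open>auto simp: P_def\<close>)
      then have "card (insert x F) \<le> card F" by (rule F)
      then show False using \<open>x \<notin> F\<close> F(1) by (simp add: P_def)
    qed
  qed
  obtain h where h: "bij_betw h {0..<card F} F" using F(1) ex_bij_betw_nat_finite[of F] unfolding P_def by auto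
  define C where "C i = (if i < card F then cball (h i) e else {})" for i
  have "hausdorff_content (?n - 1) \<delta> ?S \<le> (\<Sum>i. hausdorff_premeasure (?n - 1) (C i))"
  proof (rule hausdorff_content_le)
    show "?S \<subseteq> (\<Union>i. C i)"
    proof
      fix x assume "x \<in> ?S"
      then obtain y where y: "y \<in> F" "x \<in> cball y e" using cover by blast
      then obtain i where "i < card F" "h i = y"
        using h unfolding bij_betw_def by (metis atLeastLessThan_iff imageE)
      then show "x \<in> (\<Union>i. C i)" using y by (intro UN_I[of i]) (auto simp: C_def)
    qed
  qed (use e in \<open>auto simp: C_def\<close>)
  also have "\<dots> = (\<Sum>i<card F. hausdorff_premeasure (?n - 1) (C i))"
    by (rule suminf_finite) (auto simp: C_def hausdorff_premeasure_def)
  also have "\<dots> = (\<Sum>i<card F. ennreal (unit_ball_vol (real (?n - 1)) * e ^ (?n - 1)))"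
    using e by (intro sum.cong refl) (auto simp: C_def hausdorff_premeasure_def)
  also have "\<dots> = ennreal (unit_ball_vol (real (?n - 1)) * (real (card F) * e ^ (?n - 1)))"
    using e by (simp add: ennreal_mult' ennreal_of_nat_eq_real_of_nat mult_ac)
  also have "\<dots> \<le> ennreal (unit_ball_vol (real (?n - 1)) * (DIM('a) * 4 ^ DIM('a)))"
    using F(1) e by (intro ennreal_leI mult_left_mono card_separated_sphere_le) (auto simp: P_def)
  finally show "hausdorff_content (?n - 1) \<delta> ?S \<le> ennreal (unit_ball_vol (real (?n - 1)) * (DIM('a) * 4 ^ DIM('a)))" .
qed

text \<open>A measure on the whole space carried by the sphere: it can be paired with
  \<open>lborel\<close> in Fubini's theorem, and statements about unit vectors become statements
  holding almost everywhere.\<close>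

definition sphere_measure :: "'a::euclidean_space measure" where
  "sphere_measure = density (hausdorff_measure (DIM('a) - 1)) (indicator (sphere 0 1))"

lemma sets_sphere_measure [simp, measurable_cong]: "sets sphere_measure = sets borel"
  by (simp add: sphere_measure_def)

lemma space_sphere_measure [simp]: "space sphere_measure = UNIV"
  by (simp add: sphere_measure_def)

lemma sphere_borel [measurable]: "sphere (0::'a::euclidean_space) 1 \<in> sets borel"
  by (simp add: borel_closed)

lemma emeasure_sphere_measure:
  assumes [measurable]: "A \<in> sets borel"
  shows "emeasure sphere_measure A = hausdorff_outer (DIM('a) - 1) (sphere (0::'a::euclidean_space) 1 \<inter> A)"
proof -
  have "emeasure sphere_measure A = (\<integral>\<^sup>+x. indicator (sphere (0::'a) 1 \<inter> A) x \<partial>hausdorff_measure (DIM('a) - 1))"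
    unfolding sphere_measure_def indicator_inter_arith by (rule emeasure_density) auto
  also have "\<dots> = hausdorff_outer (DIM('a) - 1) (sphere (0::'a) 1 \<inter> A)"
    by (subst nn_integral_indicator) (auto simp: emeasure_hausdorff_measure)
  finally show ?thesis .
qed

lemma finite_measure_sphere_measure: "finite_measure (sphere_measure :: 'a::euclidean_space measure)"
proof
  have "emeasure sphere_measure (UNIV::'a set) \<le> ennreal (unit_ball_vol (real (DIM('a) - 1)) * (DIM('a) * 4 ^ DIM('a)))"
    using hausdorff_outer_sphere_le[where 'a='a] by (simp add: emeasure_sphere_measure)
  also have "\<dots> < \<infinity>" by simp
  finally show "emeasure sphere_measure (space (sphere_measure :: 'a measure)) \<noteq> \<infinity>" by (simp add: less_top)
qed

lemma AE_sphere_measure: "AE \<xi> in (sphere_measure :: 'a::euclidean_space measure). norm \<xi> = 1"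
proof -
  have "AE \<xi> in hausdorff_measure (DIM('a) - 1). (0::ennreal) < indicator (sphere (0::'a) 1) \<xi> \<longrightarrow> norm \<xi> = 1"
    by (rule AE_I2) (simp add: indicator_def)
  then show ?thesis unfolding sphere_measure_def by (subst AE_density) simp_all
qed

lemma distr_sphere_measure_orthogonal:
  fixes T :: "'a::euclidean_space \<Rightarrow> 'a"
  assumes T: "orthogonal_transformation T"
  shows "distr sphere_measure borel T = sphere_measure"
proof -
  have Tm[measurable]: "T \<in> borel \<rightarrow>\<^sub>M borel"
    using T by (intro borel_measurable_continuous_onI linear_continuous_on linear_linear[THEN iffD2] orthogonal_transformation_linear)
  have "sphere_measure = density (distr (hausdorff_measure (DIM('a) - 1)) borel T) (indicator (sphere 0 1))"
    by (simp add: sphere_measure_def distr_hausdorff_measure_orthogonal[OF T])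
  also have "\<dots> = distr (density (hausdorff_measure (DIM('a) - 1)) (\<lambda>x. indicator (sphere 0 1) (T x))) borel T"
    by (rule density_distr) auto
  also have "(\<lambda>x. indicator (sphere 0 1) (T x)) = (indicator (sphere 0 1) :: 'a \<Rightarrow> ennreal)"
    using orthogonal_transformation_norm[OF T] by (auto simp: indicator_def fun_eq_iff)
  finally have "sphere_measure = distr sphere_measure borel T" unfolding sphere_measure_def .
  then show ?thesis by (rule sym)
qed

text \<open>The cone over the part of the sphere in U contains the open set V, which is non-empty as
  it contains \<open>(3/2) x\<close>, so this cone has positive volume.\<close>

lemma sphere_measure_open_pos:
  fixes U :: "'a::euclidean_space set"
  assumes U: "open U" "x \<in> U" "norm x = 1" and n: "DIM('a) \<ge> 2"
  shows "emeasure sphere_measure U > 0"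
proof -
  let ?Z = "sphere 0 1 \<inter> U"
  define V where "V = {y. 1 < norm y \<and> norm y < 2} \<inter> {y. y \<noteq> 0 \<and> y /\<^sub>R norm y \<in> U}"
  have "open {y::'a. y \<noteq> 0 \<and> y /\<^sub>R norm y \<in> U}"
  proof -
    have "continuous_on (- {0::'a}) (\<lambda>y. y /\<^sub>R norm y)" by (intro continuous_intros) auto
    then have "open ((\<lambda>y. y /\<^sub>R norm y) -` U \<inter> - {0::'a})" 
      using U(1) by (subst (asm) continuous_on_open_vimage) auto
    also have "(\<lambda>y. y /\<^sub>R norm y) -` U \<inter> - {0::'a} = {y::'a. y \<noteq> 0 \<and> y /\<^sub>R norm y \<in> U}" by auto
    finally show ?thesis .
  qed
  moreover have "open {y::'a. 1 < norm y \<and> norm y < 2}"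
    by (intro open_Collect_conj open_Collect_less continuous_intros)
  ultimately have "open V" unfolding V_def by (intro open_Int)
  moreover have "(3/2) *\<^sub>R x \<in> V" using U by (auto simp: V_def)
  ultimately obtain r where r: "r > 0" "ball ((3/2) *\<^sub>R x) r \<subseteq> V" using open_contains_ball by blast
  have "0 < emeasure lborel (ball ((3/2) *\<^sub>R x) r)" using r by (simp add: emeasure_ball)
  also have "\<dots> \<le> emeasure lborel V" using r(2) \<open>open V\<close> by (intro emeasure_mono) auto
  also have "emeasure lborel V = outer_measure_of lborel V" using \<open>open V\<close> by simp
  also have "\<dots> \<le> outer_measure_of lborel (radial_cone ?Z)"
  proof (rule outer_measure_of_mono, rule subsetI)
    fix y assume y: "y \<in> V"
    then have "y = norm y *\<^sub>R (y /\<^sub>R norm y)" by (auto simp: V_def)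
    moreover have "norm (y /\<^sub>R norm y) = 1" using y by (auto simp: V_def)
    ultimately show "y \<in> radial_cone ?Z"
      unfolding radial_cone_def using y by (intro CollectI exI[of _ "norm y"] exI[of _ "y /\<^sub>R norm y"]) (auto simp: V_def)
  qed
  finally show ?thesis
    using hausdorff_outer_sphere_ge[of ?Z] n U(1) by (simp add: emeasure_sphere_measure)
qed

section \<open>Functions that are smooth off the origin\<close>

text \<open>\<open>Ck_off0 k u\<close>: the function \<open>u\<close> is of class \<open>C\<^sup>k\<close> on the punctured space.\<close>

fun Ck_off0 :: "nat \<Rightarrow> (real^'n::finite \<Rightarrow> real) \<Rightarrow> bool" where
  "Ck_off0 0 u \<longleftrightarrow> continuous_on (- {0}) u"
| "Ck_off0 (Suc k) u \<longleftrightarrow> (\<exists>u'. (\<forall>i. Ck_off0 k (u' i)) \<and>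
     (\<forall>z. z \<noteq> 0 \<longrightarrow> (u has_derivative (\<lambda>h. \<Sum>i\<in>UNIV. h $ i * u' i z)) (at z)))"

lemma Ck_off0_SucI:
  assumes "\<And>i. Ck_off0 k (u' i)"
    and "\<And>z. z \<noteq> 0 \<Longrightarrow> (u has_derivative (\<lambda>h. \<Sum>i\<in>UNIV. h $ i * u' i z)) (at z)"
  shows "Ck_off0 (Suc k) u"
  using assms by auto

lemma Ck_off0_Suc_imp: "Ck_off0 (Suc k) u \<Longrightarrow> Ck_off0 k u"
proof (induction k arbitrary: u)
  case 0
  then show ?case
    by (auto intro!: continuous_at_imp_continuous_on dest: has_derivative_continuous)
next
  case (Suc k)
  then show ?case by (meson Ck_off0.simps(2))
qed

lemma Ck_off0_mono: "Ck_off0 l u \<Longrightarrow> k \<le> l \<Longrightarrow> Ck_off0 k u"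
  by (induction l) (auto simp: le_Suc_eq simp del: Ck_off0.simps dest: Ck_off0_Suc_imp)

lemma Ck_off0_continuous_on: "Ck_off0 k u \<Longrightarrow> continuous_on (- {0}) u"
  using Ck_off0_mono[of k u 0] by simp

lemma Ck_off0_cong:
  assumes "Ck_off0 k u" "\<And>z. z \<noteq> 0 \<Longrightarrow> u z = v z"
  shows "Ck_off0 k v"
proof (cases k)
  case 0
  then show ?thesis using assms by (auto cong: continuous_on_cong_simp)
next
  case (Suc l)
  then obtain u' where u': "\<And>i. Ck_off0 l (u' i)"
    "\<And>z. z \<noteq> 0 \<Longrightarrow> (u has_derivative (\<lambda>h. \<Sum>i\<in>UNIV. h $ i * u' i z)) (at z)"
    using assms by auto
  have "(v has_derivative (\<lambda>h. \<Sum>i\<in>UNIV. h $ i * u' i z)) (at z)" if "z \<noteq> 0" for z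
    by (rule has_derivative_transform_within_open[OF u'(2)[OF that], of "- {0}"]) (use assms that in auto)
  then show ?thesis unfolding Suc by (intro Ck_off0_SucI[of _ u'] u')
qed

lemma Ck_off0_const: "Ck_off0 k (\<lambda>_. c)"
  by (induction k arbitrary: c) (auto intro!: exI[of _ "\<lambda>_ _. 0"])

lemma Ck_off0_component: "Ck_off0 k (\<lambda>z::real^'a::finite. z $ i)"
proof (cases k)
  case (Suc l)
  show ?thesis unfolding Suc
  proof (rule Ck_off0_SucI)
    show "Ck_off0 l (\<lambda>_. if j = i then 1 else 0)" for j by (rule Ck_off0_const)
    have "(\<lambda>h::real^'a. \<Sum>j\<in>UNIV. h $ j * (if j = i then 1 else 0)) = (\<lambda>h. h $ i)"
      by (simp add: fun_eq_iff if_distrib[where f="\<lambda>x. _ * x"] cong: if_cong)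
    then show "((\<lambda>z. z $ i) has_derivative (\<lambda>h. \<Sum>j\<in>UNIV. h $ j * (if j = i then 1 else 0))) (at z)" for z :: "real^'a"
      by (simp only: bounded_linear_imp_has_derivative bounded_linear_vec_nth)
  qed
qed (auto intro!: continuous_intros)

lemma Ck_off0_add:
  assumes "Ck_off0 k u" "Ck_off0 k v"
  shows "Ck_off0 k (\<lambda>z. u z + v z)"
  using assms
proof (induction k arbitrary: u v)
  case (Suc k)
  then obtain u' v' where u': "\<And>i. Ck_off0 k (u' i)" "\<And>i. Ck_off0 k (v' i)"
    "\<And>z. z \<noteq> 0 \<Longrightarrow> (u has_derivative (\<lambda>h. \<Sum>i\<in>UNIV. h $ i * u' i z)) (at z)"
    "\<And>z. z \<noteq> 0 \<Longrightarrow> (v has_derivative (\<lambda>h. \<Sum>i\<in>UNIV. h $ i * v' i z)) (at z)"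
    by auto
  show ?case
  proof (rule Ck_off0_SucI)
    show "Ck_off0 k (\<lambda>z. u' i z + v' i z)" for i by (intro Suc.IH u')
    show "((\<lambda>z. u z + v z) has_derivative (\<lambda>h. \<Sum>i\<in>UNIV. h $ i * (u' i z + v' i z))) (at z)" if "z \<noteq> 0" for z
      using has_derivative_add[OF u'(3,4)[OF that]] by (simp add: algebra_simps sum.distrib)
  qed
qed (auto intro: continuous_on_add)

lemma Ck_off0_mult:
  assumes "Ck_off0 k u" "Ck_off0 k v"
  shows "Ck_off0 k (\<lambda>z. u z * v z)"
  using assms
proof (induction k arbitrary: u v)
  case (Suc k)
  then obtain u' v' where u': "\<And>i. Ck_off0 k (u' i)" "\<And>i. Ck_off0 k (v' i)"
    "\<And>z. z \<noteq> 0 \<Longrightarrow> (u has_derivative (\<lambda>h. \<Sum>i\<in>UNIV. h $ i * u' i z)) (at z)"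
    "\<And>z. z \<noteq> 0 \<Longrightarrow> (v has_derivative (\<lambda>h. \<Sum>i\<in>UNIV. h $ i * v' i z)) (at z)"
    by auto
  have uv: "Ck_off0 k u" "Ck_off0 k v" using Suc.prems by (auto simp del: Ck_off0.simps intro: Ck_off0_Suc_imp)
  show ?case
  proof (rule Ck_off0_SucI)
    show "Ck_off0 k (\<lambda>z. u z * v' i z + u' i z * v z)" for i by (intro Suc.IH u' uv Ck_off0_add)
    show "((\<lambda>z. u z * v z) has_derivative (\<lambda>h. \<Sum>i\<in>UNIV. h $ i * (u z * v' i z + u' i z * v z))) (at z)" if "z \<noteq> 0" for z
      using has_derivative_mult[OF u'(3,4)[OF that]]
      by (simp add: algebra_simps sum.distrib sum_distrib_left)
  qed
qed (auto intro: continuous_on_mult)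

lemma Ck_off0_cmult: "Ck_off0 k u \<Longrightarrow> Ck_off0 k (\<lambda>z. c * u z)"
  by (intro Ck_off0_mult Ck_off0_const)

lemma Ck_off0_uminus: "Ck_off0 k u \<Longrightarrow> Ck_off0 k (\<lambda>z. - u z)"
  using Ck_off0_cmult[of k u "-1"] by simp

lemma Ck_off0_diff: "Ck_off0 k u \<Longrightarrow> Ck_off0 k v \<Longrightarrow> Ck_off0 k (\<lambda>z. u z - v z)"
  using Ck_off0_add[of k u "\<lambda>z. - v z"] Ck_off0_uminus by auto

lemma Ck_off0_sum: "(\<And>a. a \<in> A \<Longrightarrow> Ck_off0 k (u a)) \<Longrightarrow> Ck_off0 k (\<lambda>z. \<Sum>a\<in>A. u a z)"
  by (induction A rule: infinite_finite_induct) (auto intro: Ck_off0_const Ck_off0_add)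

lemma Ck_off0_prod: "(\<And>a. a \<in> A \<Longrightarrow> Ck_off0 k (u a)) \<Longrightarrow> Ck_off0 k (\<lambda>z. \<Prod>a\<in>A. u a z)"
  by (induction A rule: infinite_finite_induct) (auto intro: Ck_off0_const Ck_off0_mult)

lemma Ck_off0_power: "Ck_off0 k u \<Longrightarrow> Ck_off0 k (\<lambda>z. u z ^ l)"
  by (induction l) (auto intro: Ck_off0_const Ck_off0_mult)

lemma Ck_off0_inverse:
  assumes "Ck_off0 k u" "\<And>z. z \<noteq> 0 \<Longrightarrow> u z \<noteq> 0"
  shows "Ck_off0 k (\<lambda>z. inverse (u z))"
  using assms
proof (induction k)
  case (Suc k)
  then obtain u' where u': "\<And>i. Ck_off0 k (u' i)"
    "\<And>z. z \<noteq> 0 \<Longrightarrow> (u has_derivative (\<lambda>h. \<Sum>i\<in>UNIV. h $ i * u' i z)) (at z)"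
    by auto
  have inv: "Ck_off0 k (\<lambda>z. inverse (u z))" using Suc by (auto simp del: Ck_off0.simps intro: Ck_off0_Suc_imp)
  show ?case
  proof (rule Ck_off0_SucI)
    show "Ck_off0 k (\<lambda>z. - (inverse (u z) * u' i z * inverse (u z)))" for i
      by (intro Ck_off0_uminus Ck_off0_mult u' inv)
    show "((\<lambda>z. inverse (u z)) has_derivative
        (\<lambda>h. \<Sum>i\<in>UNIV. h $ i * - (inverse (u z) * u' i z * inverse (u z)))) (at z)" if "z \<noteq> 0" for z
      using Deriv.has_derivative_inverse[OF Suc.prems(2)[OF that] u'(2)[OF that]]
      by (simp add: sum_distrib_left sum_distrib_right sum_negf mult_ac)
  qed
qed (auto intro!: continuous_on_inverse)

lemma Ck_off0_inner_self: "Ck_off0 k (\<lambda>z. z \<bullet> z)"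
  unfolding inner_vec_def by (intro Ck_off0_sum) (auto intro: Ck_off0_mult Ck_off0_component)

text \<open>Off the origin the witnesses u' in the inductive definition are forced to be the partial
  derivatives. This links the class to \<open>partial_deriv\<close>, in which the kernel is
  written.\<close>

lemma Ck_off0_partial:
  assumes "Ck_off0 (Suc k) u"
  shows Ck_off0_partial_deriv: "Ck_off0 k (partial_deriv i u)"
    and has_derivative_partial_deriv:
      "z \<noteq> 0 \<Longrightarrow> (u has_derivative (\<lambda>h. \<Sum>i\<in>UNIV. h $ i * partial_deriv i u z)) (at z)"
proof -
  obtain u' where u': "\<And>i. Ck_off0 k (u' i)"
    "\<And>z. z \<noteq> 0 \<Longrightarrow> (u has_derivative (\<lambda>h. \<Sum>i\<in>UNIV. h $ i * u' i z)) (at z)"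
    using assms by auto
  have *: "partial_deriv i u z = u' i z" if "z \<noteq> 0" for i z
  proof -
    have "((\<lambda>t. u (z + t *\<^sub>R axis i 1)) has_derivative 
       (\<lambda>t. \<Sum>j\<in>UNIV. (t *\<^sub>R axis i 1) $ j * u' j (z + 0 *\<^sub>R axis i 1))) (at 0)"
      by (rule has_derivative_compose[of "\<lambda>t. z + t *\<^sub>R axis i 1" "\<lambda>t. t *\<^sub>R axis i 1"])
         (use that in \<open>auto intro!: derivative_eq_intros u'(2)\<close>)
    moreover have "(\<lambda>t. \<Sum>j\<in>UNIV. (t *\<^sub>R axis i 1) $ j * u' j (z + 0 *\<^sub>R axis i 1)) = (*) (u' i z)"
      by (auto simp: axis_def fun_eq_iff if_distrib[where f="\<lambda>x. _ * x"] mult.assoc if_distrib[where f="\<lambda>x. x * _"] cong: if_cong)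
    ultimately show ?thesis
      unfolding partial_deriv_def by (intro DERIV_imp_deriv) (simp add: has_field_derivative_def)
  qed
  show "Ck_off0 k (partial_deriv i u)"
    by (rule Ck_off0_cong[OF u'(1)[of i]]) (simp add: *)
  show "(u has_derivative (\<lambda>h. \<Sum>i\<in>UNIV. h $ i * partial_deriv i u z)) (at z)" if "z \<noteq> 0"
    using u'(2)[OF that] by (simp add: *[OF that])
qed

lemma partial_deriv_eqI:
  assumes "(u has_derivative D) (at z)"
  shows "partial_deriv i u z = D (axis i 1)"
proof -
  have lin: "D (t *\<^sub>R x) = t * D x" for t x using has_derivative_linear[OF assms] by (simp add: linear_scale)
  have "((\<lambda>t. u (z + t *\<^sub>R axis i 1)) has_derivative (\<lambda>t. D (t *\<^sub>R axis i 1))) (at 0)"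
    by (rule has_derivative_compose[of "\<lambda>t. z + t *\<^sub>R axis i 1" "\<lambda>t. t *\<^sub>R axis i 1"])
       (use assms in \<open>auto intro!: derivative_eq_intros\<close>)
  then show ?thesis
    unfolding partial_deriv_def by (intro DERIV_imp_deriv) (simp add: has_field_derivative_def lin mult.commute[of _ "D _"])
qed

text \<open>A short segment around z \<noteq> 0 avoids the origin, where the functions considered
  here carry arbitrary values.\<close>

lemma partial_deriv_cong:
  assumes "\<And>z. z \<noteq> 0 \<Longrightarrow> u z = v z" "z \<noteq> 0"
  shows "partial_deriv i u z = partial_deriv i v z"
  unfolding partial_deriv_def
proof (rule deriv_cong_ev)
  have "((\<lambda>t::real. z + t *\<^sub>R axis i 1) \<longlongrightarrow> z + 0 *\<^sub>R axis i 1) (nhds 0)"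
    by (intro tendsto_intros filterlim_ident)
  then have "eventually (\<lambda>t::real. z + t *\<^sub>R axis i 1 \<noteq> 0) (nhds 0)"
    using assms(2) tendsto_imp_eventually_ne by fastforce
  then show "\<forall>\<^sub>F t in nhds 0. u (z + t *\<^sub>R axis i 1) = v (z + t *\<^sub>R axis i 1)"
    by eventually_elim (rule assms)
qed simp

lemma laplacian_cong:
  assumes "\<And>z. z \<noteq> 0 \<Longrightarrow> u z = v z" "z \<noteq> 0"
  shows "laplacian u z = laplacian v z"
  unfolding laplacian_def using assms by (intro sum.cong refl partial_deriv_cong) auto

lemma partial_deriv_add:
  assumes "Ck_off0 (Suc k) u" "Ck_off0 (Suc l) v" "z \<noteq> 0"
  shows "partial_deriv i (\<lambda>z. u z + v z) z = partial_deriv i u z + partial_deriv i v z"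
proof -
  have "((\<lambda>z. u z + v z) has_derivative (\<lambda>h. (\<Sum>i\<in>UNIV. h $ i * partial_deriv i u z) + (\<Sum>i\<in>UNIV. h $ i * partial_deriv i v z))) (at z)"
    by (intro has_derivative_add has_derivative_partial_deriv[OF assms(1,3)] has_derivative_partial_deriv[OF assms(2,3)])
  from partial_deriv_eqI[OF this] show ?thesis by (simp add: axis_def if_distrib[where f="\<lambda>x. x * _"] cong: if_cong)
qed

lemma partial_deriv_mult:
  assumes "Ck_off0 (Suc k) u" "Ck_off0 (Suc l) v" "z \<noteq> 0"
  shows "partial_deriv i (\<lambda>z. u z * v z) z = u z * partial_deriv i v z + partial_deriv i u z * v z"
proof -
  have "((\<lambda>z. u z * v z) has_derivative (\<lambda>h. u z * (\<Sum>i\<in>UNIV. h $ i * partial_deriv i v z) + (\<Sum>i\<in>UNIV. h $ i * partial_deriv i u z) * v z)) (at z)"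
    by (intro has_derivative_mult has_derivative_partial_deriv[OF assms(1,3)] has_derivative_partial_deriv[OF assms(2,3)])
  from partial_deriv_eqI[OF this] show ?thesis by (simp add: axis_def if_distrib[where f="\<lambda>x. x * _"] cong: if_cong)
qed

lemma partial_deriv_const: "partial_deriv i (\<lambda>_. c) z = 0"
  unfolding partial_deriv_def by simp

lemma partial_deriv_cmult:
  assumes "Ck_off0 (Suc k) u" "z \<noteq> 0"
  shows "partial_deriv i (\<lambda>z. c * u z) z = c * partial_deriv i u z"
  using partial_deriv_mult[OF Ck_off0_const[of "Suc k" c] assms, of i] by (simp add: partial_deriv_const)

lemma Ck_off0_laplacian:
  assumes "Ck_off0 (Suc (Suc k)) u"
  shows "Ck_off0 k (laplacian u)"
  unfolding laplacian_def[abs_def] using assms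
  by (intro Ck_off0_sum Ck_off0_partial_deriv)

section \<open>Powers of the negative Laplacian off the origin\<close>

definition neg_laplacian_iter :: "nat \<Rightarrow> (real^'n::finite \<Rightarrow> real) \<Rightarrow> real^'n \<Rightarrow> real" where
  "neg_laplacian_iter k = ((\<lambda>f z. - laplacian f z) ^^ k)"

lemma neg_laplacian_iter_0 [simp]: "neg_laplacian_iter 0 u = u"
  by (simp add: neg_laplacian_iter_def)

lemma neg_laplacian_iter_Suc: "neg_laplacian_iter (Suc k) u z = - laplacian (neg_laplacian_iter k u) z"
  by (simp add: neg_laplacian_iter_def)

lemma neg_laplacian_iter_Suc': "neg_laplacian_iter (Suc k) u = neg_laplacian_iter k (\<lambda>z. - laplacian u z)"
  by (simp add: neg_laplacian_iter_def funpow_Suc_right del: funpow.simps)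

lemma neg_laplacian_iter_cong:
  assumes "\<And>z. z \<noteq> 0 \<Longrightarrow> u z = v z" "z \<noteq> 0"
  shows "neg_laplacian_iter k u z = neg_laplacian_iter k v z"
  using assms(2)
proof (induction k arbitrary: z)
  case (Suc k)
  then show ?case using laplacian_cong[of "neg_laplacian_iter k u" "neg_laplacian_iter k v"]
    by (simp add: neg_laplacian_iter_Suc)
qed (simp add: assms)

lemma Ck_off0_neg_laplacian_iter:
  assumes "Ck_off0 (2 * k + l) u"
  shows "Ck_off0 l (neg_laplacian_iter k u)"
  using assms
proof (induction k arbitrary: u)
  case (Suc k)
  then have "Ck_off0 (2 * k + l) (\<lambda>z. - laplacian u z)"
    by (intro Ck_off0_uminus Ck_off0_laplacian) (simp del: Ck_off0.simps)
  then show ?case unfolding neg_laplacian_iter_Suc' by (rule Suc.IH)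
qed simp

lemma laplacian_add:
  assumes "Ck_off0 (Suc (Suc k)) u" "Ck_off0 (Suc (Suc l)) v" "z \<noteq> 0"
  shows "laplacian (\<lambda>z. u z + v z) z = laplacian u z + laplacian v z"
proof -
  have "partial_deriv i (partial_deriv i (\<lambda>z. u z + v z)) z = partial_deriv i (partial_deriv i u) z + partial_deriv i (partial_deriv i v) z" for i
  proof -
    have "partial_deriv i (partial_deriv i (\<lambda>z. u z + v z)) z = partial_deriv i (\<lambda>z. partial_deriv i u z + partial_deriv i v z) z"
      by (rule partial_deriv_cong[OF _ assms(3)]) (rule partial_deriv_add[OF assms(1,2)])
    also have "\<dots> = partial_deriv i (partial_deriv i u) z + partial_deriv i (partial_deriv i v) z"
      by (rule partial_deriv_add[OF Ck_off0_partial_deriv[OF assms(1)] Ck_off0_partial_deriv[OF assms(2)] assms(3)])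
    finally show ?thesis .
  qed
  then show ?thesis by (simp add: laplacian_def sum.distrib)
qed

lemma neg_laplacian_iter_add:
  assumes "Ck_off0 (2 * k) u" "Ck_off0 (2 * k) v" "z \<noteq> 0"
  shows "neg_laplacian_iter k (\<lambda>z. u z + v z) z = neg_laplacian_iter k u z + neg_laplacian_iter k v z"
  using assms
proof (induction k arbitrary: z)
  case (Suc k)
  have le: "Ck_off0 (2 * k) u" "Ck_off0 (2 * k) v" 
    using Suc.prems Ck_off0_mono[of "2 * Suc k" _ "2 * k"] by (simp_all del: Ck_off0.simps)
  have "neg_laplacian_iter (Suc k) (\<lambda>z. u z + v z) z = - laplacian (\<lambda>z. neg_laplacian_iter k u z + neg_laplacian_iter k v z) z"
    unfolding neg_laplacian_iter_Suc
    by (subst laplacian_cong[OF _ Suc.prems(3)]) (rule Suc.IH[OF le], assumption, rule refl)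
  also have "\<dots> = neg_laplacian_iter (Suc k) u z + neg_laplacian_iter (Suc k) v z"
    using Suc.prems
    by (subst laplacian_add[of 0 _ 0]) (auto simp: neg_laplacian_iter_Suc intro!: Ck_off0_neg_laplacian_iter simp del: Ck_off0.simps)
  finally show ?case .
qed simp

text \<open>The exponent is at least 2, so both one-sided derivatives at 0 vanish. Bumps will be
  powers of positive parts of polynomials, with the exponent deciding their order of
  smoothness.\<close>

lemma has_real_derivative_pos_part_power:
  "((\<lambda>x::real. (max 0 x) ^ (k + 2)) has_real_derivative real (k + 2) * (max 0 x) ^ (k + 1)) (at x)"
proof -
  consider "x > 0" | "x < 0" | "x = 0" by linarith
  then show ?thesis
  proof cases
    case 1
    have "((\<lambda>x::real. x ^ (k + 2)) has_real_derivative real (k + 2) * x ^ (k + 1)) (at x)"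
      using DERIV_pow[of "k + 2" x] by simp
    then have "((\<lambda>x::real. (max 0 x) ^ (k + 2)) has_real_derivative real (k + 2) * x ^ (k + 1)) (at x)"
      by (rule has_field_derivative_transform_within_open[of _ _ _ "{0<..}"]) (use 1 in auto)
    then show ?thesis using 1 by simp
  next
    case 2
    have "((\<lambda>x::real. 0) has_real_derivative 0) (at x)" by simp
    then have "((\<lambda>x::real. (max 0 x) ^ (k + 2)) has_real_derivative 0) (at x)"
      by (rule has_field_derivative_transform_within_open[of _ _ _ "{..<0}"]) (use 2 in auto)
    then show ?thesis using 2 by simp
  next
    case 3
    have "((\<lambda>h::real. (max 0 h) ^ (k + 2) / h) \<longlongrightarrow> 0) (at 0)"
    proof (rule Lim_null_comparison)
      show "\<forall>\<^sub>F h in at 0. norm ((max 0 h) ^ (k + 2) / h) \<le> \<bar>h\<bar> ^ (k + 1)"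
        by (rule always_eventually) (auto simp: max_def abs_mult power_abs mult_nonpos_nonneg)
      show "((\<lambda>h::real. \<bar>h\<bar> ^ (k + 1)) \<longlongrightarrow> 0) (at 0)"
        by (auto intro!: tendsto_eq_intros)
    qed
    then show ?thesis using 3 by (simp add: DERIV_def)
  qed
qed

section \<open>Slabs and rotations\<close>

text \<open>Averaging over translations of the ball in the direction \<open>\<xi>\<close> replaces \<open>h (z \<bullet> \<xi>)\<close> by a
  one-dimensional integral, which avoids choosing coordinates adapted to \<open>\<xi>\<close>.\<close>

lemma nn_integral_ball_inner_le:
  fixes \<xi> :: "'a::euclidean_space" and h :: "real \<Rightarrow> ennreal"
  assumes [measurable]: "h \<in> borel_measurable borel" and \<xi>: "norm \<xi> = 1" and R: "R \<ge> 0"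
  shows "(\<integral>\<^sup>+z. h (z \<bullet> \<xi>) * indicator (cball 0 R) z \<partial>lborel)
    \<le> emeasure lborel (cball (0::'a) (R + 1)) * (\<integral>\<^sup>+s. h s * indicator {-(R + 2)..R + 2} s \<partial>lborel)"
    (is "?L \<le> ?V * ?H")
proof -
  have [measurable]: "cball (0::'a) r \<in> sets borel" for r by (simp add: borel_closed)
  \<comment> \<open>Translation by \<open>t \<xi>\<close> shifts \<open>z \<bullet> \<xi>\<close> by
    t and moves points by at most 1. Hence the ball of radius R + 1, and then the interval of
    half-length R + 2.\<close>
  have shift: "?L \<le> (\<integral>\<^sup>+z. h (z \<bullet> \<xi> - t) * indicator (cball 0 (R + 1)) z \<partial>lborel)" if t: "t \<in> {0..1}" for t
  proof -
    have "?L = (\<integral>\<^sup>+z. h (z \<bullet> \<xi>) * indicator (cball 0 R) z \<partial>distr lborel borel ((+) (- t *\<^sub>R \<xi>)))"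
      by (simp only: lborel_distr_plus)
    also have "\<dots> = (\<integral>\<^sup>+z. h ((- t *\<^sub>R \<xi> + z) \<bullet> \<xi>) * indicator (cball 0 R) (- t *\<^sub>R \<xi> + z) \<partial>lborel)"
      by (subst nn_integral_distr) auto
    also have "\<dots> \<le> (\<integral>\<^sup>+z. h (z \<bullet> \<xi> - t) * indicator (cball 0 (R + 1)) z \<partial>lborel)"
    proof (rule nn_integral_mono)
      fix z :: 'a
      have "\<xi> \<bullet> \<xi> = 1" using \<xi> by (simp add: dot_square_norm)
      then have "(- t *\<^sub>R \<xi> + z) \<bullet> \<xi> = z \<bullet> \<xi> - t" by (simp add: inner_simps)
      moreover have "norm z \<le> R + 1" if "norm (- t *\<^sub>R \<xi> + z) \<le> R"
        using norm_triangle_ineq[of "- t *\<^sub>R \<xi> + z" "t *\<^sub>R \<xi>"] that \<xi> t by simp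
      ultimately show "h ((- t *\<^sub>R \<xi> + z) \<bullet> \<xi>) * indicator (cball 0 R) (- t *\<^sub>R \<xi> + z) 
          \<le> h (z \<bullet> \<xi> - t) * indicator (cball 0 (R + 1)) z"
        by (auto simp: indicator_def)
    qed
    finally show ?thesis .
  qed
  have "?L = (\<integral>\<^sup>+t. ?L * indicator {0..1::real} t \<partial>lborel)"
    by (subst nn_integral_cmult_indicator) auto
  also have "\<dots> \<le> (\<integral>\<^sup>+t. (\<integral>\<^sup>+z. h (z \<bullet> \<xi> - t) * indicator (cball 0 (R + 1)) z \<partial>lborel) * indicator {0..1::real} t \<partial>lborel)"
    by (rule nn_integral_mono) (use shift in \<open>auto simp: indicator_def\<close>)
  also have "\<dots> = (\<integral>\<^sup>+t. (\<integral>\<^sup>+z. h (z \<bullet> \<xi> - t) * indicator (cball 0 (R + 1)) z * indicator {0..1::real} t \<partial>lborel) \<partial>lborel)"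
    by (intro nn_integral_cong nn_integral_multc[symmetric]) measurable
  also have "\<dots> = (\<integral>\<^sup>+z. (\<integral>\<^sup>+t. h (z \<bullet> \<xi> - t) * indicator (cball 0 (R + 1)) z * indicator {0..1::real} t \<partial>lborel) \<partial>lborel)"
    by (rule lborel_pair.Fubini') measurable
  also have "\<dots> \<le> (\<integral>\<^sup>+z. ?H * indicator (cball (0::'a) (R + 1)) z \<partial>lborel)"
  proof (rule nn_integral_mono)
    fix z :: 'a
    show "(\<integral>\<^sup>+t. h (z \<bullet> \<xi> - t) * indicator (cball 0 (R + 1)) z * indicator {0..1::real} t \<partial>lborel)
        \<le> ?H * indicator (cball 0 (R + 1)) z"
    proof (cases "z \<in> cball 0 (R + 1)")
      case True
      have a: "\<bar>z \<bullet> \<xi>\<bar> \<le> R + 1" using Cauchy_Schwarz_ineq2[of z \<xi>] True \<xi> by simp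
      have "(\<integral>\<^sup>+t. h (z \<bullet> \<xi> - t) * indicator (cball 0 (R + 1)) z * indicator {0..1::real} t \<partial>lborel)
         = (\<integral>\<^sup>+t. h (z \<bullet> \<xi> + (-1) * t) * indicator {0..1::real} (z \<bullet> \<xi> - (z \<bullet> \<xi> + (-1) * t)) \<partial>lborel)"
        using True by simp
      also have "\<dots> = (\<integral>\<^sup>+s. h s * indicator {0..1::real} (z \<bullet> \<xi> - s) \<partial>lborel)"
        using nn_integral_real_affine[of "\<lambda>s. h s * indicator {0..1::real} (z \<bullet> \<xi> - s)" "-1" "z \<bullet> \<xi>"] by simp
      also have "\<dots> \<le> ?H"
        by (rule nn_integral_mono) (use a R in \<open>auto simp: indicator_def\<close>)
      finally show ?thesis using True by simp
    qed simp
  qed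
  also have "\<dots> = ?H * ?V" by (rule nn_integral_cmult_indicator) simp
  finally show ?thesis by (simp add: mult.commute)
qed

text \<open>For unit vectors this is the reflection along a followed by the reflection along a + b:
  it rotates the plane of a and b so that a goes to b, and fixes the orthogonal complement. The
  formula is explicit and differentiable in b near a.\<close>

definition plane_rotation :: "'a::real_inner \<Rightarrow> 'a \<Rightarrow> 'a \<Rightarrow> 'a" where
  "plane_rotation a b x = x - (((a + b) \<bullet> x) / (1 + a \<bullet> b)) *\<^sub>R (a + b) + (2 * (a \<bullet> x)) *\<^sub>R b"

lemma plane_rotation_same: "norm a = 1 \<Longrightarrow> plane_rotation a a x = x"
proof -
  assume a: "norm a = 1"
  have "(2 * (a \<bullet> x)) *\<^sub>R a = (a \<bullet> x) *\<^sub>R a + (a \<bullet> x) *\<^sub>R a" by (simp flip: scaleR_left.add)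
  then show ?thesis using a by (simp add: plane_rotation_def dot_square_norm inner_add_left scaleR_add_right)
qed

lemma plane_rotation_maps:
  assumes "norm a = 1" "norm b = 1" "a \<bullet> b > 0"
  shows "plane_rotation a b a = b"
proof -
  have "((a + b) \<bullet> a) / (1 + a \<bullet> b) = 1"
    using assms by (simp add: inner_add_left dot_square_norm inner_commute[of b a])
  then show ?thesis using assms by (simp add: plane_rotation_def dot_square_norm scaleR_2)
qed

lemma orthogonal_plane_rotation:
  fixes a b :: "'a::real_inner"
  assumes a: "norm a = 1" and b: "norm b = 1" and ab: "a \<bullet> b > 0"
  shows "orthogonal_transformation (plane_rotation a b)"
  unfolding orthogonal_transformation
proof (intro conjI allI)
  show "linear (plane_rotation a b)"
    by (rule linearI) (auto simp: plane_rotation_def inner_simps algebra_simps add_divide_distrib)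
  fix x
  define D where "D = 1 + a \<bullet> b"
  define u v where "u = a \<bullet> x" and "v = b \<bullet> x"
  define \<alpha> where "\<alpha> = (u + v) / D"
  have D: "D > 0" using ab by (simp add: D_def)
  have \<alpha>: "\<alpha> * D = u + v" using D by (simp add: \<alpha>_def)
  have aa: "a \<bullet> a = 1" "b \<bullet> b = 1" using a b by (simp_all add: dot_square_norm)
  have f: "a \<bullet> x = u" "x \<bullet> a = u" "b \<bullet> x = v" "x \<bullet> b = v" "a \<bullet> b = D - 1" "b \<bullet> a = D - 1" "a \<bullet> a = 1" "b \<bullet> b = 1"
    using aa by (simp_all add: u_def v_def D_def inner_commute)
  have pr: "plane_rotation a b x = x - \<alpha> *\<^sub>R (a + b) + (2 * u) *\<^sub>R b"
    by (simp add: plane_rotation_def \<alpha>_def u_def v_def D_def inner_add_left)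
  have "plane_rotation a b x \<bullet> plane_rotation a b x = 
     x \<bullet> x + \<alpha> * (\<alpha> * D) * 2 + 4 * u ^ 2 - 2 * \<alpha> * (u + v) + 4 * u * v - 4 * u * (\<alpha> * D)"
    unfolding pr by (simp add: inner_simps f power2_eq_square algebra_simps)
  also have "\<dots> = x \<bullet> x" unfolding \<alpha> by (simp add: algebra_simps power2_eq_square)
  finally show "norm (plane_rotation a b x) = norm x" by (simp add: norm_eq_sqrt_inner)
qed

text \<open>A bound uniform over the unit sphere. It supplies the Lipschitz constant under which
  limits and derivatives with respect to b pass under the integral.\<close>

lemma norm_plane_rotation_diff_le:
  fixes a b :: "'a::real_inner"
  assumes a: "norm a = 1" and b: "norm b = 1" and ab: "a \<bullet> b > 0" and x: "norm x = 1"
  shows "norm (plane_rotation a b x - x) \<le> 2 * norm (b - a)"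
proof -
  define D where "D = 1 + a \<bullet> b"
  define u v where "u = a \<bullet> x" and "v = b \<bullet> x"
  define \<alpha> where "\<alpha> = (u + v) / D"
  have D: "D \<ge> 1" using ab by (simp add: D_def)
  have \<alpha>: "\<alpha> * D = u + v" using D by (simp add: \<alpha>_def)
  have aa: "a \<bullet> a = 1" "b \<bullet> b = 1" using a b by (simp_all add: dot_square_norm)
  have f: "a \<bullet> x = u" "x \<bullet> a = u" "b \<bullet> x = v" "x \<bullet> b = v" "a \<bullet> b = D - 1" "b \<bullet> a = D - 1" "a \<bullet> a = 1" "b \<bullet> b = 1"
    using aa by (simp_all add: u_def v_def D_def inner_commute)
  have pr: "plane_rotation a b x = x - \<alpha> *\<^sub>R (a + b) + (2 * u) *\<^sub>R b"
    by (simp add: plane_rotation_def \<alpha>_def u_def v_def D_def inner_add_left)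
  have dd: "norm (b - a) ^ 2 = 2 * (1 - a \<bullet> b)"
    using aa by (simp add: power2_norm_eq_inner inner_simps inner_commute[of b a])
  have "norm (plane_rotation a b x - x) ^ 2 = (\<alpha> * D) * \<alpha> * 2 + 4 * u ^ 2 - 4 * u * (\<alpha> * D)"
    unfolding pr power2_norm_eq_inner by (simp add: inner_simps f power2_eq_square algebra_simps)
  \<comment> \<open>In this form both terms are controlled by |b - a|: \<open>u - v\<close> is the
    inner product of a - b with x, and \<open>2 (1 - a \<bullet> b)\<close> is |b - a|
    squared.\<close>
  also have "\<dots> = 2 * ((u - v) ^ 2 + 2 * (u * v) * (1 - a \<bullet> b)) / D"
    using D unfolding \<alpha> by (simp add: \<alpha>_def field_simps power2_eq_square) (simp add: D_def algebra_simps)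
  also have "\<dots> \<le> 2 * (norm (b - a) ^ 2 + norm (b - a) ^ 2) / 1"
  proof (rule frac_le)
    have "\<bar>u - v\<bar> = \<bar>(b - a) \<bullet> x\<bar>" by (simp add: u_def v_def inner_simps)
    also have "\<dots> \<le> norm (b - a)" using Cauchy_Schwarz_ineq2[of "b - a" x] x by simp
    finally have 1: "(u - v) ^ 2 \<le> norm (b - a) ^ 2" by (simp add: power2_le_iff_abs_le)
    have "\<bar>u\<bar> \<le> 1" "\<bar>v\<bar> \<le> 1" using Cauchy_Schwarz_ineq2[of a x] Cauchy_Schwarz_ineq2[of b x] a b x by (simp_all add: u_def v_def)
    then have "\<bar>u * v\<bar> \<le> 1" by (simp add: abs_mult mult_le_one)
    moreover have "1 - a \<bullet> b \<ge> 0" using dd by (metis zero_le_power2 zero_le_mult_iff not_numeral_le_zero)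
    ultimately have "2 * (u * v) * (1 - a \<bullet> b) \<le> 2 * 1 * (1 - a \<bullet> b)" by (intro mult_right_mono mult_left_mono) auto
    then show "2 * ((u - v)\<^sup>2 + 2 * (u * v) * (1 - a \<bullet> b)) \<le> 2 * ((norm (b - a))\<^sup>2 + (norm (b - a))\<^sup>2)"
      using 1 unfolding dd by (intro mult_left_mono add_mono) auto
  qed (use D in auto)
  also have "\<dots> = (2 * norm (b - a)) ^ 2" by (simp add: power2_eq_square)
  finally show ?thesis by (rule power2_le_imp_le) simp
qed

lemma norm_normalize_diff_le:
  fixes y z :: "'a::real_normed_vector"
  assumes "y \<noteq> 0" "z \<noteq> 0"
  shows "norm (y /\<^sub>R norm y - z /\<^sub>R norm z) \<le> 2 * norm (y - z) / norm z"
proof -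
  have "y /\<^sub>R norm y - z /\<^sub>R norm z = ((norm z - norm y) / (norm y * norm z)) *\<^sub>R y + (y - z) /\<^sub>R norm z"
  proof -
    have "(norm z - norm y) / (norm y * norm z) = inverse (norm y) - inverse (norm z)"
      using assms by (simp add: field_simps)
    then show ?thesis by (simp add: scaleR_diff_left scaleR_diff_right)
  qed
  also have "norm \<dots> \<le> \<bar>norm z - norm y\<bar> / norm z + norm (y - z) / norm z"
  proof (intro order_trans[OF norm_triangle_ineq] add_mono)
    show "norm (((norm z - norm y) / (norm y * norm z)) *\<^sub>R y) \<le> \<bar>norm z - norm y\<bar> / norm z"
      using assms by (simp add: abs_mult)
    show "norm ((y - z) /\<^sub>R norm z) \<le> norm (y - z) / norm z"
      by (simp add: divide_inverse mult.commute)
  qed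
  also have "\<dots> \<le> norm (y - z) / norm z + norm (y - z) / norm z"
    using norm_triangle_ineq3[of z y] by (intro add_mono divide_right_mono) (auto simp: norm_minus_commute)
  finally show ?thesis by simp
qed

text \<open>At y = z the rotation is the identity, so the derivative is an infinitesimal rotation in
  the plane of z and h applied to x. In particular it is orthogonal to x, that is, tangent to the
  sphere.\<close>

lemma has_derivative_plane_rotation:
  fixes z x :: "'a::real_inner"
  assumes z: "z \<noteq> 0"
  shows "((\<lambda>y. plane_rotation (z /\<^sub>R norm z) (y /\<^sub>R norm y) x) has_derivative
      (\<lambda>h. ((z \<bullet> x) *\<^sub>R h - (h \<bullet> x) *\<^sub>R z) /\<^sub>R (norm z)\<^sup>2)) (at z)"
proof -
  define a where "a = z /\<^sub>R norm z"
  have na: "norm a = 1" using z by (simp add: a_def)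
  have aa: "a \<bullet> a = 1" using na by (simp add: dot_square_norm)
  have d1: "((\<lambda>y. y /\<^sub>R norm y) has_derivative (\<lambda>h. (h - (a \<bullet> h) *\<^sub>R a) /\<^sub>R norm z)) (at z)"
  proof -
    have d0: "(norm has_derivative (\<lambda>h. h \<bullet> a)) (at z)"
      using has_derivative_norm[OF z] by (simp add: sgn_div_norm a_def)
    have "((\<lambda>y. inverse (norm y) *\<^sub>R y) has_derivative
       (\<lambda>h. inverse (norm z) *\<^sub>R h + (- (inverse (norm z) * (h \<bullet> a) * inverse (norm z))) *\<^sub>R z)) (at z)"
      using z by (intro has_derivative_scaleR Deriv.has_derivative_inverse d0 has_derivative_ident) simp
    moreover have "(- (inverse (norm z) * (h \<bullet> a) * inverse (norm z))) *\<^sub>R z = - (inverse (norm z) * (a \<bullet> h)) *\<^sub>R a" for h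
      by (simp add: a_def inner_commute mult_ac)
    ultimately show ?thesis by (simp add: scaleR_diff_right)
  qed
  have d2: "((\<lambda>b. plane_rotation a b x) has_derivative (\<lambda>\<beta>. - (\<beta> \<bullet> x) *\<^sub>R a + ((a \<bullet> x) * (a \<bullet> \<beta>)) *\<^sub>R a + (a \<bullet> x) *\<^sub>R \<beta>)) (at (z /\<^sub>R norm z))"
  proof -
    have n: "((\<lambda>b. (a + b) \<bullet> x) has_derivative (\<lambda>\<beta>. \<beta> \<bullet> x)) (at a)"
      by (auto intro!: derivative_eq_intros)
    have d: "((\<lambda>b. 1 + a \<bullet> b) has_derivative (\<lambda>\<beta>. a \<bullet> \<beta>)) (at a)"
      by (auto intro!: derivative_eq_intros)
    have q: "((\<lambda>b. ((a + b) \<bullet> x) / (1 + a \<bullet> b)) has_derivative (\<lambda>\<beta>. (\<beta> \<bullet> x - (a \<bullet> x) * (a \<bullet> \<beta>)) / 2)) (at a)"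
      using has_derivative_divide[OF n d] aa by (simp add: inner_simps field_simps)
    have "((\<lambda>b. x - (((a + b) \<bullet> x) / (1 + a \<bullet> b)) *\<^sub>R (a + b) + (2 * (a \<bullet> x)) *\<^sub>R b) has_derivative
       (\<lambda>\<beta>. 0 - ((((a + a) \<bullet> x) / (1 + a \<bullet> a)) *\<^sub>R (0 + \<beta>) + ((\<beta> \<bullet> x - (a \<bullet> x) * (a \<bullet> \<beta>)) / 2) *\<^sub>R (a + a)) + (2 * (a \<bullet> x)) *\<^sub>R \<beta>)) (at a)"
      by (intro has_derivative_add has_derivative_diff has_derivative_scaleR[OF q] has_derivative_const has_derivative_ident has_derivative_scaleR_right)
    moreover have "0 - ((((a + a) \<bullet> x) / (1 + a \<bullet> a)) *\<^sub>R (0 + \<beta>) + ((\<beta> \<bullet> x - (a \<bullet> x) * (a \<bullet> \<beta>)) / 2) *\<^sub>R (a + a)) + (2 * (a \<bullet> x)) *\<^sub>R \<beta>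
      = - (\<beta> \<bullet> x) *\<^sub>R a + ((a \<bullet> x) * (a \<bullet> \<beta>)) *\<^sub>R a + (a \<bullet> x) *\<^sub>R \<beta>" for \<beta>
    proof -
      have 1: "(c / 2) *\<^sub>R (a + a) = c *\<^sub>R a" for c by (simp add: scaleR_add_right flip: scaleR_left.add)
      have 2: "(2 * c) *\<^sub>R \<beta> = c *\<^sub>R \<beta> + c *\<^sub>R \<beta>" for c by (simp flip: scaleR_left.add)
      have 3: "((a + a) \<bullet> x) / (1 + a \<bullet> a) = a \<bullet> x" using aa by (simp add: inner_simps)
      show ?thesis unfolding 1 2 3 by (simp add: scaleR_diff_left)
    qed
    ultimately show ?thesis unfolding plane_rotation_def a_def[symmetric] by simp
  qed
  have "((\<lambda>y. plane_rotation a (y /\<^sub>R norm y) x) has_derivative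
     (\<lambda>h. - (((h - (a \<bullet> h) *\<^sub>R a) /\<^sub>R norm z) \<bullet> x) *\<^sub>R a + ((a \<bullet> x) * (a \<bullet> ((h - (a \<bullet> h) *\<^sub>R a) /\<^sub>R norm z))) *\<^sub>R a 
       + (a \<bullet> x) *\<^sub>R ((h - (a \<bullet> h) *\<^sub>R a) /\<^sub>R norm z))) (at z)"
    by (rule has_derivative_compose[OF d1 d2])
  moreover have "- (((h - (a \<bullet> h) *\<^sub>R a) /\<^sub>R norm z) \<bullet> x) *\<^sub>R a + ((a \<bullet> x) * (a \<bullet> ((h - (a \<bullet> h) *\<^sub>R a) /\<^sub>R norm z))) *\<^sub>R a 
       + (a \<bullet> x) *\<^sub>R ((h - (a \<bullet> h) *\<^sub>R a) /\<^sub>R norm z) = ((z \<bullet> x) *\<^sub>R h - (h \<bullet> x) *\<^sub>R z) /\<^sub>R (norm z)\<^sup>2" for h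
  proof -
    have n0: "norm z \<noteq> 0" using z by simp
    have 0: "a \<bullet> ((h - (a \<bullet> h) *\<^sub>R a) /\<^sub>R norm z) = 0" using aa by (simp add: inner_simps)
    have "((z \<bullet> x) *\<^sub>R h - (h \<bullet> x) *\<^sub>R z) /\<^sub>R (norm z)\<^sup>2 = ((a \<bullet> x) *\<^sub>R h - (h \<bullet> x) *\<^sub>R a) /\<^sub>R norm z"
      using n0 by (simp add: a_def scaleR_diff_right power2_eq_square mult_ac)
    then show ?thesis unfolding 0 by (simp add: inner_simps algebra_simps)
  qed
  ultimately show ?thesis unfolding a_def[symmetric] by simp
qed

section \<open>The transform with a homogeneous or logarithmic profile\<close>

interpretation sphere_measure: finite_measure "sphere_measure :: 'a::euclidean_space measure"
  by (rule finite_measure_sphere_measure)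

lemma borel_measurable_orthogonal:
  fixes T :: "'a::euclidean_space \<Rightarrow> 'a"
  shows "orthogonal_transformation T \<Longrightarrow> T \<in> borel \<rightarrow>\<^sub>M borel"
  by (intro borel_measurable_continuous_onI linear_continuous_on linear_linear[THEN iffD2] orthogonal_transformation_linear)

lemma integral_sphere_measure_orthogonal:
  fixes T :: "'a::euclidean_space \<Rightarrow> 'a" and F :: "'a \<Rightarrow> real"
  assumes T: "orthogonal_transformation T" and [measurable]: "F \<in> borel_measurable borel"
  shows "(\<integral>\<xi>. F (T \<xi>) \<partial>sphere_measure) = (\<integral>\<xi>. F \<xi> \<partial>sphere_measure)"
proof -
  note borel_measurable_orthogonal[OF T, measurable]
  have "(\<integral>\<xi>. F \<xi> \<partial>sphere_measure) = (\<integral>\<xi>. F \<xi> \<partial>distr sphere_measure borel T)"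
    by (simp only: distr_sphere_measure_orthogonal[OF T])
  also have "\<dots> = (\<integral>\<xi>. F (T \<xi>) \<partial>sphere_measure)" by (subst integral_distr) auto
  finally show ?thesis ..
qed

text \<open>Fubini on ball times sphere: for every unit vector \<xi> the integral over the unit ball
  has the same finite bound, so the integral over the sphere is finite for almost every z in the
  ball. One z is enough, since rotations and scalings reach every other. The interval is that of
  \<open>nn_integral_ball_inner_le\<close> for R = 1.\<close>

lemma exists_nn_integral_inner_finite:
  fixes h :: "real \<Rightarrow> ennreal"
  assumes h[measurable]: "h \<in> borel_measurable borel"
    and fin: "(\<integral>\<^sup>+s. h s * indicator {-3..3} s \<partial>lborel) < \<infinity>"
  shows "\<exists>z::'a::euclidean_space. z \<noteq> 0 \<and> (\<integral>\<^sup>+\<xi>. h (z \<bullet> \<xi>) \<partial>sphere_measure) < \<infinity>"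
proof -
  interpret P: pair_sigma_finite "lborel :: 'a measure" "sphere_measure :: 'a measure" ..
  have [measurable]: "cball (0::'a) r \<in> sets borel" for r by (simp add: borel_closed)
  let ?K = "emeasure lborel (cball (0::'a) 2) * (\<integral>\<^sup>+s. h s * indicator {-3..3} s \<partial>lborel)"
  have K: "?K < \<infinity>" using fin by (simp add: ennreal_mult_less_top emeasure_cball)
  have "(\<integral>\<^sup>+z. (\<integral>\<^sup>+\<xi>. h (z \<bullet> \<xi>) \<partial>sphere_measure) * indicator (cball 0 1) z \<partial>(lborel :: 'a measure))
     = (\<integral>\<^sup>+z. (\<integral>\<^sup>+\<xi>. h (z \<bullet> \<xi>) * indicator (cball 0 1) z \<partial>sphere_measure) \<partial>(lborel :: 'a measure))"
    by (intro nn_integral_cong nn_integral_multc[symmetric]) measurable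
  also have "\<dots> = (\<integral>\<^sup>+\<xi>. (\<integral>\<^sup>+z. h (z \<bullet> \<xi>) * indicator (cball 0 1) z \<partial>(lborel :: 'a measure)) \<partial>sphere_measure)"
    by (rule P.Fubini'[symmetric]) measurable
  also have "\<dots> \<le> (\<integral>\<^sup>+\<xi>. ?K \<partial>(sphere_measure :: 'a measure))"
  proof (rule nn_integral_mono_AE)
    show "AE \<xi>::'a in sphere_measure. (\<integral>\<^sup>+z. h (z \<bullet> \<xi>) * indicator (cball 0 1) z \<partial>(lborel :: 'a measure)) \<le> ?K"
      using AE_sphere_measure
      by eventually_elim (use nn_integral_ball_inner_le[OF h, where R=1] in simp)
  qed
  also have "\<dots> = ?K * emeasure sphere_measure (UNIV :: 'a set)" by simp
  also have "\<dots> < \<infinity>" 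
  proof -
    have "a * b < \<infinity>" if "a < \<infinity>" "b \<noteq> \<infinity>" for a b :: ennreal
      using that by (auto simp: ennreal_mult_less_top less_top)
    from this[OF K] show ?thesis by simp
  qed
  finally have "AE z in (lborel :: 'a measure). (\<integral>\<^sup>+\<xi>. h (z \<bullet> \<xi>) \<partial>sphere_measure) * indicator (cball 0 1) z \<noteq> \<infinity>"
    by (intro nn_integral_PInf_AE) (auto simp: less_top)
  moreover have "AE z in (lborel :: 'a measure). z \<noteq> 0" by (rule AE_lborel_singleton)
  ultimately have ae: "AE z in (lborel :: 'a measure). z \<noteq> 0 \<and> (z \<in> cball 0 1 \<longrightarrow> (\<integral>\<^sup>+\<xi>. h (z \<bullet> \<xi>) \<partial>sphere_measure) < \<infinity>)"
    by eventually_elim (auto simp: indicator_def less_top)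
  show ?thesis
  proof (rule ccontr)
    assume no: "\<not> ?thesis"
    from ae have "AE z in (lborel :: 'a measure). z \<notin> cball 0 1" by eventually_elim (use no in blast)
    then have "emeasure lborel (cball (0::'a) 1) = 0" by (subst (asm) AE_iff_measurable[of "cball 0 1"]) auto
    then show False using unit_ball_vol_pos[of "real DIM('a)"] by (simp add: emeasure_cball del: unit_ball_vol_pos)
  qed
qed

lemma exists_rotation_scaling:
  fixes z z0 :: "real^'n::finite"
  assumes "z \<noteq> 0" "z0 \<noteq> 0"
  shows "\<exists>T. orthogonal_transformation T \<and> (\<forall>\<eta>. z \<bullet> T \<eta> = (norm z / norm z0) * (z0 \<bullet> \<eta>))"
proof -
  have "norm (z /\<^sub>R norm z) = norm (z0 /\<^sub>R norm z0)" using assms by simp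
  then obtain T where T: "orthogonal_transformation T" "T (z0 /\<^sub>R norm z0) = z /\<^sub>R norm z"
    using orthogonal_transformation_exists by metis
  have "z = norm z *\<^sub>R T (z0 /\<^sub>R norm z0)" using assms T by simp
  then have "z \<bullet> T \<eta> = norm z * (T (z0 /\<^sub>R norm z0) \<bullet> T \<eta>)" for \<eta> by (metis inner_scaleR_left)
  then have "z \<bullet> T \<eta> = (norm z / norm z0) * (z0 \<bullet> \<eta>)" for \<eta> 
    using T(1) by (simp add: orthogonal_transformation_def divide_inverse)
  then show ?thesis using T by blast
qed

text \<open>Great spheres are null sets. The function that is infinite at 0 and zero elsewhere has
  integral 0 on the line, so its composition with some direction is integrable over the sphere; a
  rotation transfers this to the given direction.\<close>

lemma AE_sphere_measure_inner_neq_0: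
  fixes z :: "real^'n::finite"
  assumes "z \<noteq> 0"
  shows "AE \<xi> in sphere_measure. z \<bullet> \<xi> \<noteq> 0"
proof -
  let ?h = "\<lambda>s::real. \<infinity> * indicator {0} s :: ennreal"
  have "(\<integral>\<^sup>+s. ?h s * indicator {-3..3::real} s \<partial>lborel) = (\<integral>\<^sup>+s. \<infinity> * indicator {0::real} s \<partial>lborel)"
    by (intro nn_integral_cong) (auto simp: indicator_def)
  also have "\<dots> = 0" by (subst nn_integral_cmult_indicator) auto
  finally have "(\<integral>\<^sup>+s. ?h s * indicator {-3..3::real} s \<partial>lborel) < \<infinity>" by simp
  then obtain z0 :: "real^'n" where z0: "z0 \<noteq> 0" "(\<integral>\<^sup>+\<xi>. ?h (z0 \<bullet> \<xi>) \<partial>sphere_measure) < \<infinity>"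
    using exists_nn_integral_inner_finite[of ?h, where 'a="real^'n"] by (auto simp del: infinity_ennreal_def)
  have "AE \<xi> in sphere_measure. ?h (z0 \<bullet> \<xi>) \<noteq> \<infinity>"
    using z0(2) by (intro nn_integral_PInf_AE) (auto simp: less_top)
  then have ae: "AE \<xi> in sphere_measure. z0 \<bullet> \<xi> \<noteq> 0" by eventually_elim (auto simp: indicator_def)
  obtain T where T: "orthogonal_transformation T" "\<And>\<eta>. z \<bullet> T \<eta> = (norm z / norm z0) * (z0 \<bullet> \<eta>)"
    using exists_rotation_scaling[OF assms z0(1)] by blast
  note borel_measurable_orthogonal[OF T(1), measurable]
  have "AE \<xi> in distr sphere_measure borel T. z \<bullet> \<xi> \<noteq> 0"
    by (subst AE_distr_iff) (use ae assms z0(1) in \<open>auto simp: T(2)\<close>)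
  then show ?thesis by (simp only: distr_sphere_measure_orthogonal[OF T(1)])
qed

text \<open>A profile with \<open>\<phi> (c s) = c\<^sup>p \<phi> s + q ln c\<close>; it is \<open>\<bar>s\<bar>\<close> for \<open>(p, q) = (1, 0)\<close> and
  \<open>ln \<bar>s\<bar>\<close> for \<open>(p, q) = (0, 1)\<close>.\<close>

locale kernel_profile =
  fixes \<phi> :: "real \<Rightarrow> real" and p :: nat and q :: real
  assumes profile_measurable [measurable]: "\<phi> \<in> borel_measurable borel"
    and profile_even: "\<And>s. \<phi> (- s) = \<phi> s"
    and profile_scale: "\<And>c s. c > 0 \<Longrightarrow> s \<noteq> 0 \<Longrightarrow> \<phi> (c * s) = c ^ p * \<phi> s + q * ln c"
    and profile_locally_integrable: "\<And>R. (\<integral>\<^sup>+s. ennreal \<bar>\<phi> s\<bar> * indicator {-R..R} s \<partial>lborel) < \<infinity>"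
begin

lemma integrable_profile_inner:
  fixes z :: "real^'n::finite"
  assumes "z \<noteq> 0"
  shows "integrable sphere_measure (\<lambda>\<xi>. \<phi> (z \<bullet> \<xi>))"
proof -
  obtain z0 :: "real^'n" where z0: "z0 \<noteq> 0" "(\<integral>\<^sup>+\<xi>. ennreal \<bar>\<phi> (z0 \<bullet> \<xi>)\<bar> \<partial>sphere_measure) < \<infinity>"
    using exists_nn_integral_inner_finite[of "\<lambda>s. ennreal \<bar>\<phi> s\<bar>", where 'a="real^'n"] profile_locally_integrable[of 3] by auto
  have int0: "integrable sphere_measure (\<lambda>\<xi>. \<phi> (z0 \<bullet> \<xi>))"
    using z0(2) by (intro integrableI_bounded) auto
  obtain T where T: "orthogonal_transformation T" "\<And>\<eta>. z \<bullet> T \<eta> = (norm z / norm z0) * (z0 \<bullet> \<eta>)"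
    using exists_rotation_scaling[OF assms z0(1)] by blast
  note borel_measurable_orthogonal[OF T(1), measurable]
  define c where "c = norm z / norm z0"
  have c: "c > 0" using assms z0 by (simp add: c_def)
  note T2 = T(2)[folded c_def]
  have "integrable sphere_measure (\<lambda>\<xi>. c ^ p * \<phi> (z0 \<bullet> \<xi>) + q * ln c)"
    using int0 by (intro Bochner_Integration.integrable_add integrable_mult_right) auto
  \<comment> \<open>The scaling law is assumed for s \<noteq> 0 only, as it fails for the logarithm
    with \<open>ln 0 = 0\<close>; the exceptional \<xi> form a null set.\<close>
  then have "integrable sphere_measure (\<lambda>\<xi>. \<phi> (z \<bullet> T \<xi>))"
    by (rule integrable_cong_AE_imp)
       (use AE_sphere_measure_inner_neq_0[OF z0(1)] in \<open>auto elim!: eventually_mono simp: T2 profile_scale[OF c]\<close>)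
  then have "integrable (distr sphere_measure borel T) (\<lambda>\<xi>. \<phi> (z \<bullet> \<xi>))"
    by (subst integrable_distr_eq) auto
  then show ?thesis by (simp only: distr_sphere_measure_orthogonal[OF T(1)])
qed

text \<open>For g = 1/Q this is the integral in John's formula with x = 0, the sign of z being
  absorbed by the evenness of \<phi>.\<close>

definition transform :: "(real^'n::finite \<Rightarrow> real) \<Rightarrow> real^'n \<Rightarrow> real" where
  "transform g z = (\<integral>\<xi>. \<phi> (z \<bullet> \<xi>) * g \<xi> \<partial>sphere_measure)"

end

lemma Ck_off0_borel_measurable: "Ck_off0 k g \<Longrightarrow> g \<in> borel_measurable borel"
  by (rule borel_measurable_continuous_countable_exceptions[of "{0}"]) (auto dest: Ck_off0_continuous_on)

lemma Ck_off0_bounded_sphere: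
  assumes "Ck_off0 k g"
  obtains M where "M \<ge> 0" "\<And>\<xi>. norm \<xi> = 1 \<Longrightarrow> \<bar>g \<xi>\<bar> \<le> M"
proof -
  have "continuous_on (sphere 0 1) g"
    by (rule continuous_on_subset[OF Ck_off0_continuous_on[OF assms]]) auto
  then have "compact (g ` sphere 0 1)" by (intro compact_continuous_image) auto
  then obtain M where "M > 0" "\<forall>y\<in>g ` sphere 0 1. norm y \<le> M" using compact_imp_bounded bounded_pos by metis
  then show ?thesis using that[of M] by auto
qed

lemma integrable_mult_bounded_sphere:
  fixes w F :: "'a::euclidean_space \<Rightarrow> real"
  assumes w: "integrable sphere_measure w" and F: "F \<in> borel_measurable borel" "\<And>\<xi>. norm \<xi> = 1 \<Longrightarrow> \<bar>F \<xi>\<bar> \<le> M"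
  shows "integrable sphere_measure (\<lambda>\<xi>. w \<xi> * F \<xi>)"
proof (rule Bochner_Integration.integrable_bound)
  show "integrable sphere_measure (\<lambda>\<xi>. M * w \<xi>)" using w by simp
  show "AE \<xi> in sphere_measure. norm (w \<xi> * F \<xi>) \<le> norm (M * w \<xi>)"
    using AE_sphere_measure
  proof eventually_elim
    case (elim \<xi>)
    then have "\<bar>F \<xi>\<bar> \<le> \<bar>M\<bar>" using F(2)[of \<xi>] by linarith
    then show ?case by (simp add: abs_mult mult.commute[of "\<bar>w \<xi>\<bar>"] mult_right_mono)
  qed
qed (use w F in simp)

text \<open>Substituting \<open>Rt \<xi>\<close> for \<xi> turns \<open>y \<bullet> \<xi>\<close>
  into a positive multiple of \<open>z \<bullet> \<xi>\<close>. The singular set of the profile then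
  stays fixed while y varies, and y occurs only in the smooth g and in explicit functions of
  |y|.\<close>

lemma (in kernel_profile) transform_rotate:
  fixes z y :: "real^'n::finite"
  assumes g: "Ck_off0 k g" and zy: "z \<bullet> y > 0"
  defines "Rt \<equiv> plane_rotation (z /\<^sub>R norm z) (y /\<^sub>R norm y)"
  shows "transform g y = (norm y / norm z) ^ p * (\<integral>\<xi>. \<phi> (z \<bullet> \<xi>) * g (Rt \<xi>) \<partial>sphere_measure)
     + q * ln (norm y / norm z) * (\<integral>\<xi>. g \<xi> \<partial>sphere_measure)"
proof -
  have nz: "z \<noteq> 0" "y \<noteq> 0" using zy by auto
  let ?a = "z /\<^sub>R norm z" and ?b = "y /\<^sub>R norm y"
  have ab: "norm ?a = 1" "norm ?b = 1" "?a \<bullet> ?b > 0" using nz zy by auto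
  have O: "orthogonal_transformation Rt" unfolding Rt_def by (rule orthogonal_plane_rotation[OF ab])
  have Oa: "Rt ?a = ?b" unfolding Rt_def by (rule plane_rotation_maps[OF ab])
  note borel_measurable_orthogonal[OF O, measurable] Ck_off0_borel_measurable[OF g, measurable]
  define c where "c = norm y / norm z"
  have c: "c > 0" using nz by (simp add: c_def)
  have yO: "y \<bullet> Rt \<xi> = c * (z \<bullet> \<xi>)" for \<xi>
  proof -
    have "y = norm y *\<^sub>R Rt ?a" using nz Oa by simp
    then have "y \<bullet> Rt \<xi> = norm y * (Rt ?a \<bullet> Rt \<xi>)" by (metis inner_scaleR_left)
    then show ?thesis using O by (simp add: orthogonal_transformation_def divide_inverse c_def)
  qed
  obtain M where M: "\<And>\<xi>. norm \<xi> = 1 \<Longrightarrow> \<bar>g \<xi>\<bar> \<le> M" using Ck_off0_bounded_sphere[OF g] by metis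
  then have M': "\<And>\<xi>. norm \<xi> = 1 \<Longrightarrow> \<bar>g (Rt \<xi>)\<bar> \<le> M" using O by (simp add: orthogonal_transformation_norm)
  have int1: "integrable sphere_measure (\<lambda>\<xi>. \<phi> (z \<bullet> \<xi>) * g (Rt \<xi>))"
    by (rule integrable_mult_bounded_sphere[OF integrable_profile_inner[OF nz(1)] _ M']) measurable
  have int2: "integrable sphere_measure (\<lambda>\<xi>. g (Rt \<xi>))"
    using integrable_mult_bounded_sphere[of "\<lambda>_. 1" "\<lambda>\<xi>. g (Rt \<xi>)" M] M' by simp
  have "transform g y = (\<integral>\<xi>. \<phi> (y \<bullet> Rt \<xi>) * g (Rt \<xi>) \<partial>sphere_measure)"
    unfolding transform_def by (rule integral_sphere_measure_orthogonal[OF O, symmetric]) measurable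
  also have "\<dots> = (\<integral>\<xi>. c ^ p * (\<phi> (z \<bullet> \<xi>) * g (Rt \<xi>)) + q * ln c * g (Rt \<xi>) \<partial>sphere_measure)"
    using AE_sphere_measure_inner_neq_0[OF nz(1)]
    by (intro integral_cong_AE) (auto elim!: eventually_mono simp: yO profile_scale[OF c] algebra_simps)
  also have "\<dots> = c ^ p * (\<integral>\<xi>. \<phi> (z \<bullet> \<xi>) * g (Rt \<xi>) \<partial>sphere_measure) + q * ln c * (\<integral>\<xi>. g (Rt \<xi>) \<partial>sphere_measure)"
    using int1 int2 by simp
  also have "(\<integral>\<xi>. g (Rt \<xi>) \<partial>sphere_measure) = (\<integral>\<xi>. g \<xi> \<partial>sphere_measure)"
    by (rule integral_sphere_measure_orthogonal[OF O]) measurable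
  finally show ?thesis unfolding c_def .
qed

text \<open>Differentiation under the integral at one point z: the remainder quotients are dominated
  by 2 L |w|. The integrands are linear in h for almost every \<eta> only, so linearity of the
  integrated derivative is derived almost everywhere.\<close>

lemma has_derivative_integral_dominated:
  fixes w :: "'b \<Rightarrow> real" and F :: "'a::euclidean_space \<Rightarrow> 'b \<Rightarrow> real"
  assumes w: "integrable M w" and r: "r > 0"
    and F: "\<And>y. y \<in> ball z r \<Longrightarrow> F y \<in> borel_measurable M"
    and F': "\<And>h. (\<lambda>\<eta>. F' \<eta> h) \<in> borel_measurable M"
    and der: "AE \<eta> in M. ((\<lambda>y. F y \<eta>) has_derivative F' \<eta>) (at z)"
    and lip: "AE \<eta> in M. \<forall>y\<in>ball z r. \<bar>F y \<eta> - F z \<eta>\<bar> \<le> L * norm (y - z)"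
    and lip': "AE \<eta> in M. \<forall>h. \<bar>F' \<eta> h\<bar> \<le> L * norm h"
    and bd: "AE \<eta> in M. \<bar>F z \<eta>\<bar> \<le> B"
  shows "((\<lambda>y. \<integral>\<eta>. w \<eta> * F y \<eta> \<partial>M) has_derivative (\<lambda>h. \<integral>\<eta>. w \<eta> * F' \<eta> h \<partial>M)) (at z)"
proof -
  note [measurable] = F' borel_measurable_integrable[OF w]
  have dom: "integrable M (\<lambda>\<eta>. w \<eta> * G \<eta>)" if [measurable]: "G \<in> borel_measurable M" and "AE \<eta> in M. \<bar>G \<eta>\<bar> \<le> C" for G C
  proof (rule Bochner_Integration.integrable_bound)
    show "integrable M (\<lambda>\<eta>. w \<eta> * C)" using w by simp
    show "AE \<eta> in M. norm (w \<eta> * G \<eta>) \<le> norm (w \<eta> * C)"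
      using that(2) by eventually_elim (auto simp: abs_mult intro!: mult_left_mono)
  qed measurable
  have iF': "integrable M (\<lambda>\<eta>. w \<eta> * F' \<eta> h)" for h
    by (rule dom[of _ "L * norm h"]) (use lip' in auto)
  have iFz: "integrable M (\<lambda>\<eta>. w \<eta> * F z \<eta>)"
    by (rule dom[OF F bd]) (use r in auto)
  have iF: "integrable M (\<lambda>\<eta>. w \<eta> * F y \<eta>)" if y: "y \<in> ball z r" for y
  proof (rule dom[OF F[OF y]])
    show "AE \<eta> in M. \<bar>F y \<eta>\<bar> \<le> L * norm (y - z) + B"
      using lip bd
    proof eventually_elim
      case (elim \<eta>)
      then have "\<bar>F y \<eta> - F z \<eta>\<bar> \<le> L * norm (y - z)" using y by blast
      then show ?case using elim(2) by linarith
    qed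
  qed
  let ?D = "\<lambda>h. \<integral>\<eta>. w \<eta> * F' \<eta> h \<partial>M"
  have lin: "AE \<eta> in M. linear (F' \<eta>)"
    using der by eventually_elim (rule has_derivative_linear)
  have blin: "bounded_linear ?D"
  proof (rule bounded_linear_intro)
    fix x y
    have "?D (x + y) = (\<integral>\<eta>. w \<eta> * F' \<eta> x + w \<eta> * F' \<eta> y \<partial>M)"
      by (rule integral_cong_AE) (use lin in \<open>auto elim!: eventually_mono simp: linear_add algebra_simps\<close>)
    then show "?D (x + y) = ?D x + ?D y" using iF' by simp
    fix c
    have "?D (c *\<^sub>R x) = (\<integral>\<eta>. c * (w \<eta> * F' \<eta> x) \<partial>M)"
      by (rule integral_cong_AE) (use lin in \<open>auto elim!: eventually_mono simp: linear_scale algebra_simps\<close>)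
    then show "?D (c *\<^sub>R x) = c *\<^sub>R ?D x" by simp
    have "\<bar>?D x\<bar> \<le> (\<integral>\<eta>. \<bar>w \<eta> * F' \<eta> x\<bar> \<partial>M)" by (rule integral_abs_bound)
    also have "\<dots> \<le> (\<integral>\<eta>. \<bar>w \<eta>\<bar> * (L * norm x) \<partial>M)"
    proof (rule integral_mono_AE)
      show "AE \<eta> in M. \<bar>w \<eta> * F' \<eta> x\<bar> \<le> \<bar>w \<eta>\<bar> * (L * norm x)"
        using lip' by eventually_elim (simp add: abs_mult mult_left_mono)
    qed (use iF'[of x] w in \<open>auto intro: integrable_abs\<close>)
    also have "\<dots> = norm x * (L * (\<integral>\<eta>. \<bar>w \<eta>\<bar> \<partial>M))" by simp
    finally show "norm (?D x) \<le> norm x * (L * (\<integral>\<eta>. \<bar>w \<eta>\<bar> \<partial>M))" by simp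
  qed
  have "((\<lambda>y. norm ((\<integral>\<eta>. w \<eta> * F y \<eta> \<partial>M) - (\<integral>\<eta>. w \<eta> * F z \<eta> \<partial>M) - ?D (y - z)) / norm (y - z)) \<longlongrightarrow> 0) (at z)"
    unfolding tendsto_at_iff_sequentially comp_def
  proof (intro allI impI)
    fix X assume X: "\<forall>i. X i \<in> UNIV - {z}" "X \<longlonglongrightarrow> z"
    have "\<forall>\<^sub>F i in sequentially. X i \<in> ball z r"
      by (rule topological_tendstoD[OF X(2)]) (use r in auto)
    then obtain N where N: "\<And>i. i \<ge> N \<Longrightarrow> X i \<in> ball z r"
      unfolding eventually_sequentially by blast
    \<comment> \<open>Dominated convergence works along sequences. Dropping N terms keeps all points
      in the ball where the Lipschitz bound holds; \<open>LIMSEQ_offset\<close> restores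
      them.\<close>
    define Y where "Y i = X (i + N)" for i
    have Y: "Y i \<in> ball z r" "Y i \<noteq> z" "Y \<longlonglongrightarrow> z" for i
      using N[of "i + N"] X LIMSEQ_ignore_initial_segment[OF X(2), of N] by (auto simp: Y_def[abs_def])
    define Q where "Q i \<eta> = (F (Y i) \<eta> - F z \<eta> - F' \<eta> (Y i - z)) / norm (Y i - z)" for i \<eta>
    have [measurable]: "Q i \<in> borel_measurable M" for i
      unfolding Q_def[abs_def] 
      by (intro borel_measurable_divide borel_measurable_diff F F' Y borel_measurable_const) (use r in simp)
    have "(\<lambda>i. \<integral>\<eta>. w \<eta> * Q i \<eta> \<partial>M) \<longlonglongrightarrow> (\<integral>\<eta>. 0 \<partial>M)"
    proof (rule integral_dominated_convergence[where w="\<lambda>\<eta>. \<bar>w \<eta>\<bar> * (2 * L)"])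
      show "AE \<eta> in M. (\<lambda>i. w \<eta> * Q i \<eta>) \<longlonglongrightarrow> 0"
        using der
      proof eventually_elim
        case (elim \<eta>)
        have "((\<lambda>y. (F y \<eta> - F z \<eta> - F' \<eta> (y - z)) /\<^sub>R norm (y - z)) \<longlongrightarrow> 0) (at z)"
          using elim unfolding has_derivative_at_within by simp
        from this[unfolded tendsto_at_iff_sequentially comp_def, rule_format, of Y]
        have "(\<lambda>i. Q i \<eta>) \<longlonglongrightarrow> 0" using Y by (simp add: Q_def divide_inverse mult.commute)
        then show ?case by (rule tendsto_mult_right_zero)
      qed
      show "AE \<eta> in M. norm (w \<eta> * Q i \<eta>) \<le> \<bar>w \<eta>\<bar> * (2 * L)" for i
        using lip lip'
      proof eventually_elim
        case (elim \<eta>)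
        have "\<bar>F (Y i) \<eta> - F z \<eta> - F' \<eta> (Y i - z)\<bar> \<le> 2 * L * norm (Y i - z)"
          using bspec[OF elim(1) Y(1)[of i]] spec[OF elim(2), of "Y i - z"] by linarith
        then have "\<bar>Q i \<eta>\<bar> \<le> 2 * L"
          using Y(2)[of i] by (simp add: Q_def pos_divide_le_eq)
        then show ?case by (simp add: abs_mult mult_left_mono)
      qed
    qed (use w in auto)
    moreover have "(\<integral>\<eta>. w \<eta> * Q i \<eta> \<partial>M) = ((\<integral>\<eta>. w \<eta> * F (Y i) \<eta> \<partial>M) - (\<integral>\<eta>. w \<eta> * F z \<eta> \<partial>M) - ?D (Y i - z)) / norm (Y i - z)" for i
    proof -
      have "(\<integral>\<eta>. w \<eta> * Q i \<eta> \<partial>M) = (\<integral>\<eta>. (w \<eta> * F (Y i) \<eta> - w \<eta> * F z \<eta> - w \<eta> * F' \<eta> (Y i - z)) / norm (Y i - z) \<partial>M)"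
        by (simp add: Q_def algebra_simps)
      then show ?thesis using iF[OF Y(1)] iFz iF' by simp
    qed
    ultimately have "(\<lambda>i. norm (((\<integral>\<eta>. w \<eta> * F (Y i) \<eta> \<partial>M) - (\<integral>\<eta>. w \<eta> * F z \<eta> \<partial>M) - ?D (Y i - z)) / norm (Y i - z))) \<longlonglongrightarrow> 0"
      using tendsto_norm_zero[of "\<lambda>i. \<integral>\<eta>. w \<eta> * Q i \<eta> \<partial>M"] by simp
    then have "(\<lambda>i. norm ((\<integral>\<eta>. w \<eta> * F (X (i + N)) \<eta> \<partial>M) - (\<integral>\<eta>. w \<eta> * F z \<eta> \<partial>M) - ?D (X (i + N) - z)) / norm (X (i + N) - z)) \<longlonglongrightarrow> 0"
      by (simp add: Y_def)
    then show "(\<lambda>i. norm ((\<integral>\<eta>. w \<eta> * F (X i) \<eta> \<partial>M) - (\<integral>\<eta>. w \<eta> * F z \<eta> \<partial>M) - ?D (X i - z)) / norm (X i - z)) \<longlonglongrightarrow> 0"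
      by (rule LIMSEQ_offset)
  qed
  then show ?thesis using blin by (simp add: has_derivative_iff_norm)
qed

text \<open>A segment of length at most 1/2 starting on the unit sphere stays in the compact annulus
  between the radii 1/2 and 2, where the partial derivatives are bounded.\<close>

lemma Ck_off0_lipschitz_sphere:
  fixes g :: "real^'n::finite \<Rightarrow> real"
  assumes g: "Ck_off0 (Suc k) g"
  shows "\<exists>M\<ge>0. (\<forall>x y. norm x = 1 \<longrightarrow> norm (y - x) \<le> 1/2 \<longrightarrow> \<bar>g y - g x\<bar> \<le> M * norm (y - x)) \<and>
    (\<forall>x h. norm x = 1 \<longrightarrow> \<bar>\<Sum>i\<in>UNIV. h $ i * partial_deriv i g x\<bar> \<le> M * norm h)"
proof -
  let ?A = "cball 0 2 - ball (0::real^'n) (1/2)"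
  have cA: "compact ?A" by (intro compact_diff) auto
  have "\<exists>B\<ge>0. \<forall>x\<in>?A. \<bar>partial_deriv i g x\<bar> \<le> B" for i
  proof -
    have "continuous_on ?A (partial_deriv i g)"
      by (rule continuous_on_subset[OF Ck_off0_continuous_on[OF Ck_off0_partial_deriv[OF g]]]) auto
    then have "bounded (partial_deriv i g ` ?A)" by (intro compact_imp_bounded compact_continuous_image cA)
    then obtain B where "B > 0" "\<forall>y\<in>partial_deriv i g ` ?A. norm y \<le> B" using bounded_pos by metis
    then show ?thesis by (intro exI[of _ B]) auto
  qed
  then obtain B where B: "\<And>i. B i \<ge> 0" "\<And>i x. x \<in> ?A \<Longrightarrow> \<bar>partial_deriv i g x\<bar> \<le> B i" by metis
  define M where "M = (\<Sum>i\<in>UNIV. B i)"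
  have M: "\<bar>\<Sum>i\<in>UNIV. h $ i * partial_deriv i g x\<bar> \<le> M * norm h" if "x \<in> ?A" for x h
  proof -
    have "\<bar>\<Sum>i\<in>UNIV. h $ i * partial_deriv i g x\<bar> \<le> (\<Sum>i\<in>UNIV. norm h * B i)"
      by (intro order_trans[OF sum_abs] sum_mono) (auto simp: abs_mult intro!: mult_mono component_le_norm_cart B(2) that)
    also have "\<dots> = M * norm h" by (simp add: M_def sum_distrib_left mult.commute)
    finally show ?thesis .
  qed
  have "\<bar>g y - g x\<bar> \<le> M * norm (y - x)" if xy: "norm x = 1" "norm (y - x) \<le> 1/2" for x y
  proof -
    have seg: "closed_segment x y \<subseteq> ?A"
    proof
      fix u assume "u \<in> closed_segment x y"
      then have "norm (u - x) \<le> norm (y - x)" using segment_bound(1) by blast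
      then have "norm (u - x) \<le> 1/2" using xy by linarith
      then show "u \<in> ?A"
        using norm_triangle_ineq2[of x u] norm_triangle_ineq2[of u x] xy by (auto simp: norm_minus_commute)
    qed
    have "norm (g y - g x) \<le> M * norm (y - x)"
    proof (rule differentiable_bound)
      fix u assume u: "u \<in> closed_segment x y"
      then have "u \<in> ?A" using seg by blast
      then have "u \<noteq> 0" by auto
      show "(g has_derivative (\<lambda>h. \<Sum>i\<in>UNIV. h $ i * partial_deriv i g u)) (at u within closed_segment x y)"
        by (rule has_derivative_at_withinI[OF has_derivative_partial_deriv[OF g \<open>u \<noteq> 0\<close>]])
      show "onorm (\<lambda>h. \<Sum>i\<in>UNIV. h $ i * partial_deriv i g u) \<le> M"
        by (rule onorm_bound) (use M \<open>u \<in> ?A\<close> B in \<open>auto simp: M_def sum_nonneg\<close>)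
    qed auto
    then show ?thesis by simp
  qed
  moreover have "x \<in> ?A" if "norm x = 1" for x using that by auto
  ultimately show ?thesis
    by (intro exI[of _ M] conjI) (auto simp: M_def sum_nonneg B(1) M[unfolded M_def])
qed

lemma ball_inner_pos:
  fixes z :: "'a::real_inner"
  assumes "y \<in> ball z (norm z)"
  shows "z \<bullet> y > 0"
proof -
  have z: "z \<noteq> 0" using assms by auto
  have "z \<bullet> (z - y) \<le> norm z * norm (z - y)" by (rule norm_cauchy_schwarz)
  also have "\<dots> < norm z * norm z" using assms z by (intro mult_strict_left_mono) (auto simp: dist_norm)
  also have "\<dots> = z \<bullet> z" by (simp add: power2_norm_eq_inner[symmetric] power2_eq_square)
  finally show ?thesis by (simp add: inner_diff_right)
qed

lemma rotation_near:
  fixes z y \<xi> :: "'a::real_inner"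
  assumes "y \<in> ball z (norm z)" "norm \<xi> = 1"
  defines "Rt \<equiv> plane_rotation (z /\<^sub>R norm z) (y /\<^sub>R norm y)"
  shows "norm (Rt \<xi>) = 1" "norm (Rt \<xi> - \<xi>) \<le> 4 * norm (y - z) / norm z"
proof -
  have zy: "z \<bullet> y > 0" by (rule ball_inner_pos[OF assms(1)])
  then have nz: "z \<noteq> 0" "y \<noteq> 0" by auto
  have ab: "norm (z /\<^sub>R norm z) = 1" "norm (y /\<^sub>R norm y) = 1" "(z /\<^sub>R norm z) \<bullet> (y /\<^sub>R norm y) > 0"
    using nz zy by auto
  show "norm (Rt \<xi>) = 1"
    unfolding Rt_def using orthogonal_transformation_norm[OF orthogonal_plane_rotation[OF ab]] assms(2) by simp
  have "norm (Rt \<xi> - \<xi>) \<le> 2 * norm (y /\<^sub>R norm y - z /\<^sub>R norm z)"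
    unfolding Rt_def by (rule norm_plane_rotation_diff_le[OF ab assms(2)])
  also have "\<dots> \<le> 2 * (2 * norm (y - z) / norm z)"
    using norm_normalize_diff_le[OF nz(2,1)] by simp
  finally show "norm (Rt \<xi> - \<xi>) \<le> 4 * norm (y - z) / norm z" by simp
qed

context kernel_profile
begin

lemma integrable_transform:
  fixes g :: "real^'n::finite \<Rightarrow> real"
  assumes g: "Ck_off0 k g" and z: "z \<noteq> 0"
  shows "integrable sphere_measure (\<lambda>\<xi>. \<phi> (z \<bullet> \<xi>) * g \<xi>)"
proof -
  obtain M where M: "\<And>\<xi>. norm \<xi> = 1 \<Longrightarrow> \<bar>g \<xi>\<bar> \<le> M" using Ck_off0_bounded_sphere[OF g] by metis
  show ?thesis
    by (rule integrable_mult_bounded_sphere[OF integrable_profile_inner[OF z] Ck_off0_borel_measurable[OF g] M])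
qed

text \<open>In the rotated form the singular factor \<open>\<phi> (z \<bullet> \<xi>)\<close> no
  longer moves, so together with the bound of g on the sphere it serves as the dominating
  function.\<close>

lemma isCont_transform:
  fixes g :: "real^'n::finite \<Rightarrow> real"
  assumes g: "Ck_off0 k g" and z: "z \<noteq> 0"
  shows "isCont (transform g) z"
  unfolding continuous_at_sequentially
proof (intro allI impI)
  fix X assume X: "X \<longlonglongrightarrow> z"
  note [measurable] = Ck_off0_borel_measurable[OF g]
  have "\<forall>\<^sub>F i in sequentially. X i \<in> ball z (norm z)"
    by (rule topological_tendstoD[OF X]) (use z in auto)
  then obtain N where N: "\<And>i. i \<ge> N \<Longrightarrow> X i \<in> ball z (norm z)"
    unfolding eventually_sequentially by blast
  define Y where "Y i = X (i + N)" for i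
  have Y: "Y i \<in> ball z (norm z)" for i using N by (simp add: Y_def)
  have Yl: "Y \<longlonglongrightarrow> z" unfolding Y_def by (rule LIMSEQ_ignore_initial_segment[OF X])
  let ?R = "\<lambda>y. plane_rotation (z /\<^sub>R norm z) (y /\<^sub>R norm y)"
  obtain M where M: "M \<ge> 0" "\<And>\<xi>. norm \<xi> = 1 \<Longrightarrow> \<bar>g \<xi>\<bar> \<le> M" using Ck_off0_bounded_sphere[OF g] by metis
  have [measurable]: "?R (Y i) \<in> borel_measurable borel" for i
  proof -
    have "0 < z \<bullet> Y i" by (rule ball_inner_pos[OF Y])
    moreover from this have "Y i \<noteq> 0" by auto
    ultimately show ?thesis
      using z by (intro borel_measurable_orthogonal orthogonal_plane_rotation) auto
  qed
  have lim: "(\<lambda>i. \<integral>\<xi>. \<phi> (z \<bullet> \<xi>) * g (?R (Y i) \<xi>) \<partial>sphere_measure) \<longlonglongrightarrow> transform g z"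
    unfolding transform_def
  proof (rule integral_dominated_convergence[where w="\<lambda>\<xi>. \<bar>\<phi> (z \<bullet> \<xi>)\<bar> * M"])
    show "integrable sphere_measure (\<lambda>\<xi>. \<bar>\<phi> (z \<bullet> \<xi>)\<bar> * M)"
      using integrable_profile_inner[OF z] by simp
    show "AE \<xi> in sphere_measure. (\<lambda>i. \<phi> (z \<bullet> \<xi>) * g (?R (Y i) \<xi>)) \<longlonglongrightarrow> \<phi> (z \<bullet> \<xi>) * g \<xi>"
      using AE_sphere_measure
    proof eventually_elim
      case (elim \<xi>)
      have "(\<lambda>i. ?R (Y i) \<xi> - \<xi>) \<longlonglongrightarrow> 0"
      proof (rule Lim_null_comparison)
        show "\<forall>\<^sub>F i in sequentially. norm (?R (Y i) \<xi> - \<xi>) \<le> 4 * norm (Y i - z) / norm z"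
          using rotation_near(2)[OF Y elim] by simp
        have "(\<lambda>i. 4 * norm (Y i - z) / norm z) \<longlonglongrightarrow> 4 * norm (z - z) / norm z"
          by (intro tendsto_intros Yl) (use z in simp)
        then show "(\<lambda>i. 4 * norm (Y i - z) / norm z) \<longlonglongrightarrow> 0" by simp
      qed
      then have R: "(\<lambda>i. ?R (Y i) \<xi>) \<longlonglongrightarrow> \<xi>" by (simp add: LIM_zero_iff)
      have "\<xi> \<noteq> 0" using elim by auto
      then have "isCont g \<xi>"
        using Ck_off0_continuous_on[OF g] continuous_on_eq_continuous_at[of "- {0}" g] by auto
      then have "(\<lambda>i. g (?R (Y i) \<xi>)) \<longlonglongrightarrow> g \<xi>" by (rule isCont_tendsto_compose[OF _ R])
      then show ?case by (intro tendsto_mult tendsto_const)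
    qed
    show "AE \<xi> in sphere_measure. norm (\<phi> (z \<bullet> \<xi>) * g (?R (Y i) \<xi>)) \<le> \<bar>\<phi> (z \<bullet> \<xi>)\<bar> * M" for i
      using AE_sphere_measure
      by eventually_elim (use M(2) rotation_near(1)[OF Y] in \<open>auto simp: abs_mult intro!: mult_left_mono\<close>)
  qed measurable
  have nY: "(\<lambda>i. norm (Y i) / norm z) \<longlonglongrightarrow> norm z / norm z" by (intro tendsto_intros Yl) (use z in simp)
  then have nY1: "(\<lambda>i. norm (Y i) / norm z) \<longlonglongrightarrow> 1" using z by simp
  have "(\<lambda>i. (norm (Y i) / norm z) ^ p * (\<integral>\<xi>. \<phi> (z \<bullet> \<xi>) * g (?R (Y i) \<xi>) \<partial>sphere_measure)
     + q * ln (norm (Y i) / norm z) * (\<integral>\<xi>. g \<xi> \<partial>sphere_measure)) \<longlonglongrightarrow> 1 ^ p * transform g z + q * ln 1 * (\<integral>\<xi>. g \<xi> \<partial>sphere_measure)"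
    by (intro tendsto_intros lim nY1) auto
  then have "(\<lambda>i. transform g (Y i)) \<longlonglongrightarrow> transform g z"
    by (simp add: transform_rotate[OF g ball_inner_pos[OF Y]])
  then show "(transform g \<circ> X) \<longlonglongrightarrow> transform g z"
    unfolding Y_def comp_def by (rule LIMSEQ_offset)
qed

text \<open>The terms with p and q are the radial part and come from the scaling law; the others
  come from the infinitesimal rotation acting on g. All are built from transforms of g and of
  \<open>\<xi>\<^sub>j \<partial>\<^sub>i g\<close> with coefficients smooth off the origin, so the
  formula can be applied to itself.\<close>

lemma has_derivative_transform:
  fixes g :: "real^'n::finite \<Rightarrow> real"
  assumes g: "Ck_off0 (Suc k) g" and z: "z \<noteq> 0"
  shows "(transform g has_derivative (\<lambda>h. \<Sum>i\<in>UNIV. h $ i *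
     (z $ i * inverse (z \<bullet> z) * (real p * transform g z + q * (\<integral>\<xi>. g \<xi> \<partial>sphere_measure))
      + inverse (z \<bullet> z) * (\<Sum>j\<in>UNIV. z $ j * (transform (\<lambda>\<xi>. \<xi> $ j * partial_deriv i g \<xi>) z
                                        - transform (\<lambda>\<xi>. \<xi> $ i * partial_deriv j g \<xi>) z))))) (at z)"
proof -
  note [measurable] = Ck_off0_borel_measurable[OF g]
  have [measurable]: "partial_deriv i g \<in> borel_measurable borel" for i
    by (rule Ck_off0_borel_measurable[OF Ck_off0_partial_deriv[OF g]])
  let ?R = "\<lambda>y. plane_rotation (z /\<^sub>R norm z) (y /\<^sub>R norm y)"
  let ?D = "\<lambda>\<xi> h. \<Sum>i\<in>UNIV. h $ i * partial_deriv i g \<xi>"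
  let ?V = "\<lambda>\<xi> h. ((z \<bullet> \<xi>) *\<^sub>R h - (h \<bullet> \<xi>) *\<^sub>R z) /\<^sub>R (norm z)\<^sup>2"
  let ?G = "\<lambda>y. \<integral>\<xi>. \<phi> (z \<bullet> \<xi>) * g (?R y \<xi>) \<partial>sphere_measure"
  obtain M where M: "M \<ge> 0" "\<And>x y. norm x = 1 \<Longrightarrow> norm (y - x) \<le> 1/2 \<Longrightarrow> \<bar>g y - g x\<bar> \<le> M * norm (y - x)"
    "\<And>x h. norm x = 1 \<Longrightarrow> \<bar>?D x h\<bar> \<le> M * norm h"
    using Ck_off0_lipschitz_sphere[OF g] by blast
  obtain B where B: "B \<ge> 0" "\<And>\<xi>. norm \<xi> = 1 \<Longrightarrow> \<bar>g \<xi>\<bar> \<le> B" using Ck_off0_bounded_sphere[OF g] by metis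
  have small: "y \<in> ball z (norm z)" if "y \<in> ball z (norm z / 8)" for y
    using that norm_ge_zero[of z] zero_le_dist[of z y] unfolding mem_ball by linarith
  have za: "norm (z /\<^sub>R norm z) = 1" using z by simp
  have Rz: "?R z \<xi> = \<xi>" for \<xi> by (rule plane_rotation_same[OF za])
  \<comment> \<open>On the ball of radius |z|/8 the rotation moves unit vectors by at most 4/8 =
    1/2, the range of the Lipschitz estimate for g.\<close>
  have derG: "(?G has_derivative (\<lambda>h. \<integral>\<xi>. \<phi> (z \<bullet> \<xi>) * ?D \<xi> (?V \<xi> h) \<partial>sphere_measure)) (at z)"
  proof (rule has_derivative_integral_dominated[where F="\<lambda>y \<xi>. g (?R y \<xi>)" and F'="\<lambda>\<xi> h. ?D \<xi> (?V \<xi> h)" and r="norm z / 8" and L="4 * M / norm z" and B=B])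
    show "integrable sphere_measure (\<lambda>\<xi>. \<phi> (z \<bullet> \<xi>))" by (rule integrable_profile_inner[OF z])
    show "norm z / 8 > 0" using z by simp
    show "(\<lambda>\<xi>. g (?R y \<xi>)) \<in> borel_measurable sphere_measure" if y: "y \<in> ball z (norm z / 8)" for y
    proof -
      have zy: "0 < z \<bullet> y" by (rule ball_inner_pos[OF small[OF y]])
      then have "y \<noteq> 0" by auto
      then have [measurable]: "?R y \<in> borel_measurable borel"
        using z zy by (intro borel_measurable_orthogonal orthogonal_plane_rotation) auto
      show ?thesis by measurable
    qed
    show "(\<lambda>\<xi>. ?D \<xi> (?V \<xi> h)) \<in> borel_measurable sphere_measure" for h
      by (simp only: vector_scaleR_component vector_minus_component) measurable
    show "AE \<xi> in sphere_measure. ((\<lambda>y. g (?R y \<xi>)) has_derivative (\<lambda>h. ?D \<xi> (?V \<xi> h))) (at z)"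
      using AE_sphere_measure
    proof eventually_elim
      case (elim \<xi>)
      have "((\<lambda>y. g (?R y \<xi>)) has_derivative (\<lambda>h. ?D (?R z \<xi>) (?V \<xi> h))) (at z)"
        by (rule has_derivative_compose[OF has_derivative_plane_rotation[OF z] has_derivative_partial_deriv[OF g]])
           (use elim Rz in auto)
      then show ?case unfolding Rz .
    qed
    show "AE \<xi> in sphere_measure. \<forall>y\<in>ball z (norm z / 8). \<bar>g (?R y \<xi>) - g (?R z \<xi>)\<bar> \<le> 4 * M / norm z * norm (y - z)"
      using AE_sphere_measure
    proof (eventually_elim, intro ballI)
      fix \<xi> y :: "real^'n" assume \<xi>: "norm \<xi> = 1" and y: "y \<in> ball z (norm z / 8)"
      have y': "y \<in> ball z (norm z)" by (rule small[OF y])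
      have le: "norm (?R y \<xi> - \<xi>) \<le> 4 * norm (y - z) / norm z" by (rule rotation_near(2)[OF y' \<xi>])
      also have "\<dots> \<le> 1/2" using y z by (simp add: field_simps dist_norm norm_minus_commute)
      finally have "\<bar>g (?R y \<xi>) - g \<xi>\<bar> \<le> M * norm (?R y \<xi> - \<xi>)" by (rule M(2)[OF \<xi>])
      also have "\<dots> \<le> M * (4 * norm (y - z) / norm z)" by (rule mult_left_mono[OF le M(1)])
      finally show "\<bar>g (?R y \<xi>) - g (?R z \<xi>)\<bar> \<le> 4 * M / norm z * norm (y - z)" by (simp add: Rz mult_ac)
    qed
    show "AE \<xi> in sphere_measure. \<forall>h. \<bar>?D \<xi> (?V \<xi> h)\<bar> \<le> 4 * M / norm z * norm h"
      using AE_sphere_measure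
    proof (eventually_elim, intro allI)
      fix \<xi> h :: "real^'n" assume \<xi>: "norm \<xi> = 1"
      have "norm ((z \<bullet> \<xi>) *\<^sub>R h - (h \<bullet> \<xi>) *\<^sub>R z) \<le> \<bar>z \<bullet> \<xi>\<bar> * norm h + \<bar>h \<bullet> \<xi>\<bar> * norm z"
        by (rule order_trans[OF norm_triangle_ineq4]) simp
      also have "\<dots> \<le> norm z * norm h + norm h * norm z"
        using Cauchy_Schwarz_ineq2[of z \<xi>] Cauchy_Schwarz_ineq2[of h \<xi>] \<xi> by (intro add_mono mult_right_mono) auto
      finally have "norm (?V \<xi> h) \<le> (2 * norm z * norm h) / (norm z)\<^sup>2"
        using z by (simp add: divide_inverse mult.commute mult_left_mono)
      also have "\<dots> = 2 / norm z * norm h" using z by (simp add: power2_eq_square)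
      finally have V: "norm (?V \<xi> h) \<le> 2 / norm z * norm h" .
      have "\<bar>?D \<xi> (?V \<xi> h)\<bar> \<le> M * norm (?V \<xi> h)" by (rule M(3)[OF \<xi>])
      also have "\<dots> \<le> M * (2 / norm z * norm h)" by (rule mult_left_mono[OF V M(1)])
      also have "\<dots> \<le> 4 * M / norm z * norm h" using M(1) z by (simp add: field_simps)
      finally show "\<bar>?D \<xi> (?V \<xi> h)\<bar> \<le> 4 * M / norm z * norm h" .
    qed
    show "AE \<xi> in sphere_measure. \<bar>g (?R z \<xi>)\<bar> \<le> B"
      using AE_sphere_measure by eventually_elim (simp add: Rz B(2))
  qed
  have dn: "((\<lambda>y. norm y / norm z) has_derivative (\<lambda>h. (h \<bullet> z) * inverse (z \<bullet> z))) (at z)"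
  proof -
    have "((\<lambda>y. norm y * inverse (norm z)) has_derivative (\<lambda>h. (h \<bullet> sgn z) * inverse (norm z))) (at z)"
      by (rule has_derivative_mult_left[OF has_derivative_norm[OF z]])
    moreover have "(h \<bullet> sgn z) * inverse (norm z) = (h \<bullet> z) * inverse (z \<bullet> z)" for h
      using z by (simp add: sgn_div_norm power2_norm_eq_inner[symmetric] power2_eq_square)
    ultimately show ?thesis by (simp add: divide_inverse)
  qed
  \<comment> \<open>At y = z the quotient of the norms is 1, where the p-th power has derivative p
    and the logarithm has value 0 and derivative 1.\<close>
  have "((\<lambda>y. (norm y / norm z) ^ p * ?G y + q * ln (norm y / norm z) * (\<integral>\<xi>. g \<xi> \<partial>sphere_measure)) has_derivative
     (\<lambda>h. real p * ((h \<bullet> z) * inverse (z \<bullet> z)) * transform g z + (\<integral>\<xi>. \<phi> (z \<bullet> \<xi>) * ?D \<xi> (?V \<xi> h) \<partial>sphere_measure)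
        + q * ((h \<bullet> z) * inverse (z \<bullet> z)) * (\<integral>\<xi>. g \<xi> \<partial>sphere_measure))) (at z)"
  proof -
    have u1: "norm z / norm z = 1" using z by simp
    have dln: "((\<lambda>y. ln (norm y / norm z)) has_derivative (\<lambda>h. inverse 1 * ((h \<bullet> z) * inverse (z \<bullet> z)))) (at z)"
      using has_derivative_compose[OF dn, of ln "(*) (inverse 1)"] DERIV_ln[of "1::real"] u1
      by (simp add: has_field_derivative_def)
    have dp: "((\<lambda>y. (norm y / norm z) ^ p) has_derivative (\<lambda>h. real p * ((h \<bullet> z) * inverse (z \<bullet> z)))) (at z)"
      using has_derivative_power[OF dn, of p] u1 by simp
    have "?G z = transform g z" unfolding Rz transform_def ..
    then show ?thesis
      using has_derivative_add[OF has_derivative_mult[OF dp derG] has_derivative_mult_left[OF has_derivative_mult_right[OF dln, of q], of "\<integral>\<xi>. g \<xi> \<partial>sphere_measure"]] u1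
      by (simp add: add.commute)
  qed
  then have der: "(transform g has_derivative
     (\<lambda>h. real p * ((h \<bullet> z) * inverse (z \<bullet> z)) * transform g z + (\<integral>\<xi>. \<phi> (z \<bullet> \<xi>) * ?D \<xi> (?V \<xi> h) \<partial>sphere_measure)
        + q * ((h \<bullet> z) * inverse (z \<bullet> z)) * (\<integral>\<xi>. g \<xi> \<partial>sphere_measure))) (at z)"
    by (rule has_derivative_transform_within_open[of _ _ _ UNIV "ball z (norm z)"])
       (use z in \<open>auto simp: transform_rotate[OF g ball_inner_pos]\<close>)
  have int: "integrable sphere_measure (\<lambda>\<xi>. \<phi> (z \<bullet> \<xi>) * (\<xi> $ j * partial_deriv i g \<xi>))" for i j
    by (rule integrable_transform[OF Ck_off0_mult[OF Ck_off0_component Ck_off0_partial_deriv[OF g]] z])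
  have "(\<integral>\<xi>. \<phi> (z \<bullet> \<xi>) * ?D \<xi> (?V \<xi> h) \<partial>sphere_measure) = 
     (\<Sum>i\<in>UNIV. h $ i * (inverse (z \<bullet> z) * (\<Sum>j\<in>UNIV. z $ j * (transform (\<lambda>\<xi>. \<xi> $ j * partial_deriv i g \<xi>) z
                                        - transform (\<lambda>\<xi>. \<xi> $ i * partial_deriv j g \<xi>) z))))" for h
  proof -
    have "\<phi> (z \<bullet> \<xi>) * ?D \<xi> (?V \<xi> h) = (\<Sum>i\<in>UNIV. h $ i * (inverse (z \<bullet> z) * (\<Sum>j\<in>UNIV. z $ j * 
       (\<phi> (z \<bullet> \<xi>) * (\<xi> $ j * partial_deriv i g \<xi>) - \<phi> (z \<bullet> \<xi>) * (\<xi> $ i * partial_deriv j g \<xi>)))))" (is "?l = ?r") for \<xi>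
    proof -
      define G where "G i = partial_deriv i g \<xi>" for i
      define f where "f = \<phi> (z \<bullet> \<xi>)"
      define P where "P = (\<Sum>j\<in>UNIV. z $ j * G j)"
      define H where "H = (\<Sum>j\<in>UNIV. h $ j * G j)"
      have "?l = f * (\<Sum>i\<in>UNIV. inverse (z \<bullet> z) * ((z \<bullet> \<xi>) * (h $ i * G i) - (h \<bullet> \<xi>) * (z $ i * G i)))"
        by (simp add: f_def G_def power2_norm_eq_inner algebra_simps)
      also have "\<dots> = f * (inverse (z \<bullet> z) * ((z \<bullet> \<xi>) * H - (h \<bullet> \<xi>) * P))"
        by (simp add: H_def P_def sum_distrib_left sum_subtractf algebra_simps)
      finally have l: "?l = f * (inverse (z \<bullet> z) * ((z \<bullet> \<xi>) * H - (h \<bullet> \<xi>) * P))" .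
      have inn: "(\<Sum>j\<in>UNIV. z $ j * (f * (\<xi> $ j * G i) - f * (\<xi> $ i * G j))) = f * (G i * (z \<bullet> \<xi>) - \<xi> $ i * P)" for i
        by (simp add: P_def inner_vec_def sum_distrib_left sum_subtractf algebra_simps)
      have "?r = (\<Sum>i\<in>UNIV. h $ i * (inverse (z \<bullet> z) * (f * (G i * (z \<bullet> \<xi>) - \<xi> $ i * P))))"
        unfolding f_def[symmetric] G_def[symmetric] inn ..
      also have "\<dots> = (\<Sum>i\<in>UNIV. (f * inverse (z \<bullet> z) * (z \<bullet> \<xi>)) * (h $ i * G i) - (f * inverse (z \<bullet> z) * P) * (h $ i * \<xi> $ i))"
        by (intro sum.cong refl) (simp add: algebra_simps)
      also have "\<dots> = (f * inverse (z \<bullet> z) * (z \<bullet> \<xi>)) * H - (f * inverse (z \<bullet> z) * P) * (h \<bullet> \<xi>)"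
        by (simp add: H_def inner_vec_def sum_distrib_left[symmetric] sum_subtractf)
      finally show "?l = ?r" unfolding l by (simp add: algebra_simps)
    qed
    then show ?thesis using int by (simp add: transform_def)
  qed
  moreover have "h \<bullet> z = (\<Sum>i\<in>UNIV. h $ i * z $ i)" for h by (simp add: inner_vec_def)
  ultimately show ?thesis
    using der by (simp add: sum.distrib sum_distrib_left sum_distrib_right algebra_simps)
qed

text \<open>No derivative ever falls on the profile, so the transform inherits the full smoothness
  of g although \<phi> is merely locally integrable.\<close>

theorem Ck_off0_transform:
  fixes g :: "real^'n::finite \<Rightarrow> real"
  shows "Ck_off0 k g \<Longrightarrow> Ck_off0 k (transform g)"
proof (induction k arbitrary: g)
  case 0
  then show ?case using isCont_transform[OF 0] by (auto intro!: continuous_at_imp_continuous_on)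
next
  case (Suc k)
  have pd: "Ck_off0 k (partial_deriv i g)" for i by (rule Ck_off0_partial_deriv[OF Suc.prems])
  have g: "Ck_off0 k g" by (rule Ck_off0_Suc_imp[OF Suc.prems])
  show ?case
    by (rule Ck_off0_SucI[OF _ has_derivative_transform[OF Suc.prems]])
       (intro Ck_off0_add Ck_off0_mult Ck_off0_sum Ck_off0_diff Ck_off0_const Ck_off0_component Ck_off0_inverse Ck_off0_inner_self Suc.IH pd g; simp)
qed

end

section \<open>Integration by parts and duality\<close>

text \<open>Vanishing near the origin as well as near infinity makes products with functions that
  are singular at 0 globally smooth and integrable, so that integration by parts produces no
  boundary terms there.\<close>

definition annular_support :: "(real^'n::finite \<Rightarrow> real) \<Rightarrow> bool" where
  "annular_support \<psi> \<longleftrightarrow> (\<exists>r R. 0 < r \<and> (\<forall>z. norm z < r \<or> norm z > R \<longrightarrow> \<psi> z = 0))"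

lemma annular_support_mult: "annular_support \<psi> \<Longrightarrow> annular_support (\<lambda>z. u z * \<psi> z)"
  unfolding annular_support_def by (metis mult_zero_right)

lemma annular_support_add:
  assumes "annular_support u" "annular_support v"
  shows "annular_support (\<lambda>z. u z + v z)"
proof -
  obtain r R r' R' where "0 < r" "\<And>z. norm z < r \<or> norm z > R \<Longrightarrow> u z = 0"
    "0 < r'" "\<And>z. norm z < r' \<or> norm z > R' \<Longrightarrow> v z = 0"
    using assms unfolding annular_support_def by metis
  then show ?thesis unfolding annular_support_def
    by (intro exI[of _ "min r r'"] exI[of _ "max R R'"]) auto
qed

lemma annular_support_cmult: "annular_support u \<Longrightarrow> annular_support (\<lambda>z. c * u z)"
  by (rule annular_support_mult)

lemma annular_support_uminus: "annular_support u \<Longrightarrow> annular_support (\<lambda>z. - u z)"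
  using annular_support_cmult[of u "-1"] by simp

lemma annular_support_sum:
  "finite A \<Longrightarrow> (\<And>a. a \<in> A \<Longrightarrow> annular_support (u a)) \<Longrightarrow> annular_support (\<lambda>z. \<Sum>a\<in>A. u a z)"
proof (induction A rule: finite_induct)
  case empty
  show ?case unfolding annular_support_def by (intro exI[of _ 1]) auto
qed (simp add: annular_support_add)

lemma annular_support_partial_deriv:
  assumes "annular_support u"
  shows "annular_support (partial_deriv i u)"
proof -
  obtain r R where r: "0 < r" "\<And>z. norm z < r \<or> norm z > R \<Longrightarrow> u z = 0"
    using assms unfolding annular_support_def by metis
  have "partial_deriv i u z = 0" if "norm z < r \<or> norm z > R" for z
  proof -
    have op: "open {z::real^'a. norm z < r \<or> norm z > R}"
      by (intro open_Collect_disj open_Collect_less continuous_intros)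
    have "((\<lambda>_::real^'a. 0::real) has_derivative (\<lambda>_. 0)) (at z)" by simp
    then have "(u has_derivative (\<lambda>_. 0)) (at z)"
      by (rule has_derivative_transform_within_open[OF _ op]) (use that r in auto)
    from partial_deriv_eqI[OF this] show ?thesis .
  qed
  then show ?thesis unfolding annular_support_def using r(1) by blast
qed

lemma annular_support_laplacian: "annular_support u \<Longrightarrow> annular_support (laplacian u)"
  unfolding laplacian_def[abs_def]
  by (intro annular_support_sum annular_support_partial_deriv) auto

lemma annular_support_neg_laplacian_iter: "annular_support u \<Longrightarrow> annular_support (neg_laplacian_iter k u)"
  by (induction k arbitrary: u)
     (auto simp: neg_laplacian_iter_Suc' intro!: annular_support_uminus annular_support_laplacian)

lemma annular_support_bounded:
  assumes "Ck_off0 k u" "annular_support u"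
  shows "\<exists>M R. 0 \<le> M \<and> 0 \<le> R \<and> (\<forall>z. \<bar>u z\<bar> \<le> M * indicator (cball 0 R) z)"
proof -
  obtain r R where r: "0 < r" "\<And>z. norm z < r \<or> norm z > R \<Longrightarrow> u z = 0"
    using assms unfolding annular_support_def by metis
  let ?A = "cball 0 R - ball (0::real^'a) r"
  have "continuous_on ?A u"
    by (rule continuous_on_subset[OF Ck_off0_continuous_on[OF assms(1)]]) (use r in auto)
  moreover have "compact ?A" by (intro compact_diff) auto
  ultimately have "bounded (u ` ?A)" by (intro compact_imp_bounded compact_continuous_image)
  then obtain M where M: "M > 0" "\<forall>y\<in>u ` ?A. norm y \<le> M" using bounded_pos by metis
  have "\<bar>u z\<bar> \<le> M * indicator (cball 0 (max R 0)) z" for z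
  proof (cases "z \<in> ?A")
    case True
    then show ?thesis using M by (auto simp: indicator_def)
  next
    case False
    then have "u z = 0" using r(2)[of z] by auto
    then show ?thesis using M by (auto simp: indicator_def)
  qed
  then show ?thesis using M by (intro exI[of _ M] exI[of _ "max R 0"]) auto
qed

lemma integrable_weight_annular_support:
  assumes W: "\<And>R. integrable lborel (\<lambda>z. W z * indicator (cball 0 R) z)" and [measurable]: "W \<in> borel_measurable borel"
    and u: "Ck_off0 k u" "annular_support u"
  shows "integrable lborel (\<lambda>z. W z * u z)"
proof -
  obtain M R where M: "0 \<le> M" "\<And>z. \<bar>u z\<bar> \<le> M * indicator (cball 0 R) z"
    using annular_support_bounded[OF u] by blast
  note [measurable] = Ck_off0_borel_measurable[OF u(1)]
  show ?thesis
  proof (rule Bochner_Integration.integrable_bound)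
    show "integrable lborel (\<lambda>z. M * (W z * indicator (cball 0 R) z))" using W by simp
    show "AE z in lborel. norm (W z * u z) \<le> norm (M * (W z * indicator (cball 0 R) z))"
      using mult_left_mono[OF M(2), of "\<bar>W _\<bar>"] M(1) by (intro AE_I2) (auto simp: abs_mult mult_ac)
  qed measurable
qed

lemma integrable_indicator_cball: "integrable lborel (indicator (cball (0::'a::euclidean_space) R) :: _ \<Rightarrow> real)"
  using emeasure_bounded_finite[OF bounded_cball, of "0::'a" R]
  by (simp add: integrable_indicator_iff borel_closed)

lemma integrable_annular_support:
  assumes u: "Ck_off0 k u" "annular_support u"
  shows "integrable lborel u"
proof -
  have "integrable lborel (\<lambda>z::real^'a. 1 * indicator (cball 0 R) z :: real)" for R
    using integrable_indicator_cball by simp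
  from integrable_weight_annular_support[OF this _ u] show ?thesis by simp
qed

text \<open>At the origin the function vanishes in a neighbourhood, so the formula extends to z = 0
  with zero partial derivatives.\<close>

lemma Ck_off0_annular_support_has_derivative:
  assumes u: "Ck_off0 (Suc k) u" "annular_support u"
  shows "(u has_derivative (\<lambda>h. \<Sum>i\<in>UNIV. h $ i * partial_deriv i u z)) (at z)"
proof (cases "z = 0")
  case True
  obtain r R where r: "0 < r" "\<And>z. norm z < r \<or> norm z > R \<Longrightarrow> u z = 0"
    using assms unfolding annular_support_def by metis
  have "((\<lambda>_::real^'a. 0::real) has_derivative (\<lambda>_. 0)) (at 0)" by simp
  then have *: "(u has_derivative (\<lambda>_. 0)) (at 0)"
    by (rule has_derivative_transform_within_open[of _ _ _ _ "ball 0 r"]) (use r in auto)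
  from partial_deriv_eqI[OF this] have "partial_deriv i u 0 = 0" for i .
  then show ?thesis using * True by simp
qed (rule has_derivative_partial_deriv[OF u(1)])

lemma has_real_derivative_along_axis:
  assumes u: "\<And>z. (u has_derivative (\<lambda>h. \<Sum>i\<in>UNIV. h $ i * u' i z)) (at z)"
  shows "((\<lambda>t. u (z + t *\<^sub>R axis i 1)) has_real_derivative u' i (z + t *\<^sub>R axis i 1)) (at t)"
proof -
  let ?y = "z + t *\<^sub>R axis i 1"
  have "((\<lambda>t. u (z + t *\<^sub>R axis i 1)) has_derivative (\<lambda>s. \<Sum>j\<in>UNIV. (s *\<^sub>R axis i 1) $ j * u' j ?y)) (at t)"
    by (rule has_derivative_compose[of "\<lambda>t. z + t *\<^sub>R axis i 1" "\<lambda>t. t *\<^sub>R axis i 1"])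
       (auto intro!: derivative_eq_intros u)
  moreover have "(\<lambda>s. \<Sum>j\<in>UNIV. (s *\<^sub>R axis i 1) $ j * u' j ?y) = (*) (u' i ?y)"
    by (auto simp: axis_def fun_eq_iff if_distrib[where f="\<lambda>x. _ * x"] mult.assoc if_distrib[where f="\<lambda>x. x * _"] cong: if_cong)
  ultimately show ?thesis by (simp add: has_field_derivative_def)
qed

lemma lborel_integral_translate:
  fixes H :: "'a::euclidean_space \<Rightarrow> real"
  assumes [measurable]: "H \<in> borel_measurable borel"
  shows "(\<integral>z. H (z + c) \<partial>lborel) = (\<integral>z. H z \<partial>lborel)"
proof -
  have "(\<integral>z. H z \<partial>lborel) = (\<integral>z. H z \<partial>distr lborel borel ((+) c))" by (simp only: lborel_distr_plus)
  also have "\<dots> = (\<integral>z. H (c + z) \<partial>lborel)" by (subst integral_distr) auto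
  finally show ?thesis by (simp add: add.commute)
qed

text \<open>Integration by parts: the integral of \<open>W F\<close> does not change when \<open>F\<close> is translated in the
  direction \<open>i\<close>, so its derivative with respect to the translation vanishes.\<close>

lemma integral_weight_partial_deriv_eq_0:
  fixes F W :: "real^'n::finite \<Rightarrow> real"
  assumes W: "\<And>R. integrable lborel (\<lambda>z. W z * indicator (cball 0 R) z)" and Wm[measurable]: "W \<in> borel_measurable borel"
    and inv: "\<And>z t. W (z + t *\<^sub>R axis i 1) = W z"
    and F: "Ck_off0 (Suc k) F" "annular_support F"
  shows "(\<integral>z. W z * partial_deriv i F z \<partial>lborel) = 0"
proof -
  let ?e = "axis i 1 :: real^'n"
  obtain M0 R where R: "0 \<le> R" "\<And>z. \<bar>F z\<bar> \<le> M0 * indicator (cball 0 R) z"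
    using annular_support_bounded[OF F] by blast
  have F0: "F z = 0" if "norm z > R" for z using R(2)[of z] that by simp
  obtain M R' where M: "0 \<le> M" "\<And>z. \<bar>partial_deriv i F z\<bar> \<le> M * indicator (cball 0 R') z"
    using annular_support_bounded[OF Ck_off0_partial_deriv[OF F(1)] annular_support_partial_deriv[OF F(2)]] by blast
  have M': "\<bar>partial_deriv i F z\<bar> \<le> M" for z
    using order_trans[OF M(2)[of z], of M] M(1) by (auto simp: indicator_def)
  note [measurable] = Ck_off0_borel_measurable[OF F(1)]
  have intW: "integrable lborel (\<lambda>z. W z * F z)" by (rule integrable_weight_annular_support[OF W Wm F])
  have shift: "(\<integral>z. W z * F (z + t *\<^sub>R ?e) \<partial>lborel) = (\<integral>z. W z * F z \<partial>lborel)" for t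
    using lborel_integral_translate[of "\<lambda>z. W z * F z" "t *\<^sub>R ?e"] by (simp add: inv)
  have intW': "integrable lborel (\<lambda>z. W z * F (z + t *\<^sub>R ?e))" for t
  proof -
    have "integrable (distr lborel borel ((+) (t *\<^sub>R ?e))) (\<lambda>z. W z * F z)" using intW by (simp only: lborel_distr_plus)
    then have "integrable lborel (\<lambda>z. W (t *\<^sub>R ?e + z) * F (t *\<^sub>R ?e + z))"
      by (subst (asm) integrable_distr_eq) auto
    then show ?thesis by (simp add: add.commute inv)
  qed
  have der: "((\<lambda>t. F (z + t *\<^sub>R ?e)) has_real_derivative partial_deriv i F (z + t *\<^sub>R ?e)) (at t)" for z t
    by (rule has_real_derivative_along_axis[OF Ck_off0_annular_support_has_derivative[OF F]])
  \<comment> \<open>Steps of length at most 1: the difference quotients then vanish outside the ball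
    of radius R + 1, and inside it the mean value theorem bounds them by M.\<close>
  define s where "s l = inverse (real (Suc l))" for l
  have s: "0 < s l" "s l \<le> 1" for l by (auto simp: s_def inverse_le_1_iff)
  define Q where "Q l z = (F (z + s l *\<^sub>R ?e) - F z) / s l" for l z
  have "(\<lambda>l. \<integral>z. W z * Q l z \<partial>lborel) \<longlonglongrightarrow> (\<integral>z. W z * partial_deriv i F z \<partial>lborel)"
  proof (rule integral_dominated_convergence[where w="\<lambda>z. \<bar>W z * indicator (cball 0 (R + 1)) z\<bar> * M"])
    show "(\<lambda>z. W z * partial_deriv i F z) \<in> borel_measurable lborel"
      using Ck_off0_borel_measurable[OF Ck_off0_partial_deriv[OF F(1)]] by measurable
    show "(\<lambda>z. W z * Q l z) \<in> borel_measurable lborel" for l unfolding Q_def by measurable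
    show "integrable lborel (\<lambda>z. \<bar>W z * indicator (cball 0 (R + 1)) z\<bar> * M)"
      using integrable_abs[OF W[of "R + 1"]] by simp
    show "AE z in lborel. (\<lambda>l. W z * Q l z) \<longlonglongrightarrow> W z * partial_deriv i F z"
    proof (rule AE_I2)
      fix z
      have "((\<lambda>h. (F (z + h *\<^sub>R ?e) - F z) / h) \<longlongrightarrow> partial_deriv i F z) (at 0)"
        using der[of z 0] by (simp add: DERIV_def)
      moreover have "filterlim s (at 0) sequentially"
        unfolding filterlim_at using s LIMSEQ_inverse_real_of_nat by (auto simp: s_def[abs_def])
      ultimately have "(\<lambda>l. Q l z) \<longlonglongrightarrow> partial_deriv i F z"
        unfolding Q_def by (rule filterlim_compose)
      then show "(\<lambda>l. W z * Q l z) \<longlonglongrightarrow> W z * partial_deriv i F z" by (intro tendsto_mult tendsto_const)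
    qed
    show "AE z in lborel. norm (W z * Q l z) \<le> \<bar>W z * indicator (cball 0 (R + 1)) z\<bar> * M" for l
    proof (rule AE_I2)
      fix z
      have "\<bar>Q l z\<bar> \<le> indicator (cball 0 (R + 1)) z * M"
      proof (cases "norm z \<le> R + 1")
        case True
        obtain t where "F (z + s l *\<^sub>R ?e) - F (z + 0 *\<^sub>R ?e) = (s l - 0) * partial_deriv i F (z + t *\<^sub>R ?e)"
          using MVT2[OF s(1)[of l] der[of z]] by blast
        then have "Q l z = partial_deriv i F (z + t *\<^sub>R ?e)" using s(1)[of l] by (simp add: Q_def)
        then show ?thesis using M' True by simp
      next
        case False
        have "norm z \<le> norm (z + s l *\<^sub>R ?e) + norm (s l *\<^sub>R ?e)"
          using norm_triangle_ineq4[of "z + s l *\<^sub>R ?e" "s l *\<^sub>R ?e"] by simp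
        also have "norm (s l *\<^sub>R ?e) \<le> 1" using s[of l] by (simp add: norm_axis_1)
        finally have "norm (z + s l *\<^sub>R ?e) > R" using False by simp
        moreover have "norm z > R" using False by simp
        ultimately show ?thesis using False by (simp add: Q_def F0)
      qed
      then have "\<bar>W z\<bar> * \<bar>Q l z\<bar> \<le> \<bar>W z\<bar> * (indicator (cball 0 (R + 1)) z * M)" by (intro mult_left_mono) auto
      then show "norm (W z * Q l z) \<le> \<bar>W z * indicator (cball 0 (R + 1)) z\<bar> * M"
        by (simp add: abs_mult mult_ac)
    qed
  qed
  moreover have "(\<integral>z. W z * Q l z \<partial>lborel) = 0" for l
  proof -
    have "(\<integral>z. W z * Q l z \<partial>lborel) = (\<integral>z. (W z * F (z + s l *\<^sub>R ?e) - W z * F z) / s l \<partial>lborel)"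
      by (simp add: Q_def algebra_simps)
    also have "\<dots> = ((\<integral>z. W z * F (z + s l *\<^sub>R ?e) \<partial>lborel) - (\<integral>z. W z * F z \<partial>lborel)) / s l"
      using intW intW' by simp
    finally show ?thesis by (simp add: shift)
  qed
  ultimately show ?thesis by (simp add: LIMSEQ_const_iff)
qed

lemma integral_partial_deriv_eq_0:
  fixes F :: "real^'n::finite \<Rightarrow> real"
  assumes F: "Ck_off0 (Suc k) F" "annular_support F"
  shows "(\<integral>z. partial_deriv i F z \<partial>lborel) = 0"
proof -
  have "integrable lborel (\<lambda>z::real^'n. 1 * indicator (cball 0 R) z :: real)" for R
    using integrable_indicator_cball by simp
  from integral_weight_partial_deriv_eq_0[of "\<lambda>_. 1", OF this _ _ F] show ?thesis by simp
qed

text \<open>Green's identity, one direction at a time: the difference of the two integrands is the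
  i-th partial derivative of \<open>F i\<close>, which inherits the annular support of \<psi>. A
  singularity of u at the origin is therefore harmless.\<close>

lemma integral_laplacian_symmetric:
  fixes u \<psi> :: "real^'n::finite \<Rightarrow> real"
  assumes u: "Ck_off0 2 u" and \<psi>: "Ck_off0 2 \<psi>" "annular_support \<psi>"
  shows "(\<integral>z. laplacian u z * \<psi> z \<partial>lborel) = (\<integral>z. u z * laplacian \<psi> z \<partial>lborel)"
proof -
  have u2: "Ck_off0 (Suc (Suc 0)) u" "Ck_off0 (Suc (Suc 0)) \<psi>" using u \<psi> by (simp_all only: numeral_2_eq_2)
  have u1: "Ck_off0 (Suc 0) u" "Ck_off0 (Suc 0) \<psi>" using u2 Ck_off0_Suc_imp by blast+
  have u0: "Ck_off0 0 u" "Ck_off0 0 \<psi>" using u1 Ck_off0_Suc_imp by blast+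
  have d1: "Ck_off0 (Suc 0) (partial_deriv i u)" "Ck_off0 (Suc 0) (partial_deriv i \<psi>)" for i
    using u2 Ck_off0_partial_deriv by blast+
  have d2: "Ck_off0 0 (partial_deriv i (partial_deriv i u))" "Ck_off0 0 (partial_deriv i (partial_deriv i \<psi>))" for i
    using d1 Ck_off0_partial_deriv by blast+
  define F where "F i z = partial_deriv i u z * \<psi> z + (-1) * (u z * partial_deriv i \<psi> z)" for i z
  have s: "annular_support (partial_deriv i \<psi>)" "annular_support (partial_deriv i (partial_deriv i \<psi>))" for i
    using annular_support_partial_deriv \<psi>(2) by blast+
  have F: "Ck_off0 (Suc 0) (F i)" "annular_support (F i)" for i
    unfolding F_def by (intro Ck_off0_add Ck_off0_mult Ck_off0_const u1 d1 annular_support_add annular_support_mult s \<psi>(2))+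
  have dF: "partial_deriv i (F i) z = partial_deriv i (partial_deriv i u) z * \<psi> z - u z * partial_deriv i (partial_deriv i \<psi>) z"
    if "z \<noteq> 0" for i z
  proof -
    note a = Ck_off0_mult[OF d1(1)[of i] u1(2)] and b = Ck_off0_mult[OF u1(1) d1(2)[of i]]
    show ?thesis unfolding F_def
      using partial_deriv_add[OF a Ck_off0_cmult[OF b, of "-1"] that, of i]
        partial_deriv_mult[OF d1(1)[of i] u1(2) that, of i] partial_deriv_cmult[OF b that, of i "-1"]
        partial_deriv_mult[OF u1(1) d1(2)[of i] that, of i] by simp
  qed
  have i1: "integrable lborel (\<lambda>z. partial_deriv i (partial_deriv i u) z * \<psi> z)" for i
    by (rule integrable_annular_support[OF Ck_off0_mult[OF d2(1) u0(2)] annular_support_mult[OF \<psi>(2)]])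
  have i2: "integrable lborel (\<lambda>z. u z * partial_deriv i (partial_deriv i \<psi>) z)" for i
    by (rule integrable_annular_support[OF Ck_off0_mult[OF u0(1) d2(2)] annular_support_mult[OF s(2)]])
  have eq: "(\<integral>z. partial_deriv i (partial_deriv i u) z * \<psi> z \<partial>lborel) = (\<integral>z. u z * partial_deriv i (partial_deriv i \<psi>) z \<partial>lborel)" for i
  proof -
    have "AE z in lborel. partial_deriv i (F i) z = partial_deriv i (partial_deriv i u) z * \<psi> z - u z * partial_deriv i (partial_deriv i \<psi>) z"
      using AE_lborel_singleton[of 0] by eventually_elim (rule dF)
    then have "(\<integral>z. partial_deriv i (F i) z \<partial>lborel) = 
        (\<integral>z. partial_deriv i (partial_deriv i u) z * \<psi> z - u z * partial_deriv i (partial_deriv i \<psi>) z \<partial>lborel)"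
      by (intro integral_cong_AE borel_measurable_integrable[OF Bochner_Integration.integrable_diff[OF i1 i2]])
         (use Ck_off0_borel_measurable[OF Ck_off0_partial_deriv[OF F(1)]] in auto)
    then show ?thesis using integral_partial_deriv_eq_0[OF F, of i i] i1 i2 by simp
  qed
  show ?thesis
    unfolding laplacian_def sum_distrib_left sum_distrib_right using i1 i2 eq by simp
qed

lemma integral_neg_laplacian_iter_symmetric:
  fixes u \<psi> :: "real^'n::finite \<Rightarrow> real"
  assumes "Ck_off0 (2 * k) u" "Ck_off0 (2 * k) \<psi>" "annular_support \<psi>"
  shows "(\<integral>z. neg_laplacian_iter k u z * \<psi> z \<partial>lborel) = (\<integral>z. u z * neg_laplacian_iter k \<psi> z \<partial>lborel)"
  using assms
proof (induction k arbitrary: \<psi>)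
  case (Suc k)
  have N: "Ck_off0 2 (neg_laplacian_iter k u)" using Suc.prems by (intro Ck_off0_neg_laplacian_iter) simp
  have \<psi>2: "Ck_off0 2 \<psi>" by (rule Ck_off0_mono[OF Suc.prems(2)]) simp
  have "(\<integral>z. neg_laplacian_iter (Suc k) u z * \<psi> z \<partial>lborel) = (\<integral>z. neg_laplacian_iter k u z * - laplacian \<psi> z \<partial>lborel)"
    using integral_laplacian_symmetric[OF N \<psi>2 Suc.prems(3)] by (simp add: neg_laplacian_iter_Suc)
  also have "\<dots> = (\<integral>z. u z * neg_laplacian_iter k (\<lambda>z. - laplacian \<psi> z) z \<partial>lborel)"
  proof (rule Suc.IH)
    show "Ck_off0 (2 * k) u" by (rule Ck_off0_mono[OF Suc.prems(1)]) simp
    show "Ck_off0 (2 * k) (\<lambda>z. - laplacian \<psi> z)"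
      by (intro Ck_off0_uminus Ck_off0_laplacian) (use Suc.prems(2) in simp)
    show "annular_support (\<lambda>z. - laplacian \<psi> z)" by (intro annular_support_uminus annular_support_laplacian Suc.prems)
  qed
  finally show ?case by (simp add: neg_laplacian_iter_Suc')
qed simp

section \<open>Rotation invariance of Lebesgue measure\<close>

lemma nn_integral_lborel_translate:
  fixes H :: "'a::euclidean_space \<Rightarrow> ennreal"
  assumes [measurable]: "H \<in> borel_measurable borel"
  shows "(\<integral>\<^sup>+z. H (z + c) \<partial>lborel) = (\<integral>\<^sup>+z. H z \<partial>lborel)"
proof -
  have "(\<integral>\<^sup>+z. H z \<partial>lborel) = (\<integral>\<^sup>+z. H z \<partial>distr lborel borel ((+) c))" by (simp only: lborel_distr_plus)
  also have "\<dots> = (\<integral>\<^sup>+z. H (c + z) \<partial>lborel)" by (subst nn_integral_distr) auto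
  finally show ?thesis by (simp add: add.commute)
qed

text \<open>The library has this fact for well-ordered index types only. Translation invariance
  identifies both sides up to a constant, which is \<open>1\<close> because \<open>T\<close> preserves the unit ball \<open>B\<close>:
  compute \<open>\<integral>\<integral> 1\<^sub>A (T x) 1\<^sub>B (y - T x)\<close> in both orders.\<close>

lemma lborel_distr_orthogonal:
  fixes T :: "'a::euclidean_space \<Rightarrow> 'a"
  assumes T: "orthogonal_transformation T"
  shows "distr lborel borel T = lborel"
proof (rule measure_eqI)
  note [measurable] = borel_measurable_orthogonal[OF T]
  fix A assume "A \<in> sets (distr lborel borel T)"
  then have [measurable]: "A \<in> sets borel" by simp
  let ?B = "cball (0::'a) 1"
  have [measurable]: "?B \<in> sets borel" by (simp add: borel_closed)
  let ?b = "indicator ?B :: 'a \<Rightarrow> ennreal" and ?a = "indicator A :: 'a \<Rightarrow> ennreal"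
  have bT: "?b (T x) = ?b x" for x using orthogonal_transformation_norm[OF T] by (simp add: indicator_def)
  have bm: "?b (- x) = ?b x" for x by (simp add: indicator_def)
  have surj: "T (inv T y) = y" for y using orthogonal_transformation_surj[OF T] by (simp add: surj_f_inv_f)
  have Tadd: "T (x + y) = T x + T y" for x y using orthogonal_transformation_linear[OF T] by (rule linear_add)
  have B: "(\<integral>\<^sup>+y. ?b (y - c) \<partial>lborel) = emeasure lborel ?B" for c
    using nn_integral_lborel_translate[of ?b "- c"] by simp
  have A: "(\<integral>\<^sup>+y. ?a (y + c) \<partial>lborel) = emeasure lborel A" for c
    using nn_integral_lborel_translate[of ?a c] by simp
  have "(\<integral>\<^sup>+x. ?a (T x) \<partial>lborel) * emeasure lborel ?B = (\<integral>\<^sup>+x. (\<integral>\<^sup>+y. ?a (T x) * ?b (y - T x) \<partial>lborel) \<partial>lborel)"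
    by (simp add: nn_integral_cmult B nn_integral_multc)
  also have "\<dots> = (\<integral>\<^sup>+y. (\<integral>\<^sup>+x. ?a (T x) * ?b (y - T x) \<partial>lborel) \<partial>lborel)"
    by (rule lborel_pair.Fubini') measurable
  also have "\<dots> = (\<integral>\<^sup>+y. (\<integral>\<^sup>+x. ?a (T x + y) * ?b x \<partial>lborel) \<partial>lborel)"
  proof (rule nn_integral_cong)
    fix y
    have "?a (T (x + inv T y)) * ?b (y - T (x + inv T y)) = ?a (T x + y) * ?b x" for x
      using bT[of x] bm[of "T x"] by (simp add: Tadd surj)
    then show "(\<integral>\<^sup>+x. ?a (T x) * ?b (y - T x) \<partial>lborel) = (\<integral>\<^sup>+x. ?a (T x + y) * ?b x \<partial>lborel)"
      using nn_integral_lborel_translate[of "\<lambda>x. ?a (T x) * ?b (y - T x)" "inv T y"] by simp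
  qed
  also have "\<dots> = (\<integral>\<^sup>+x. (\<integral>\<^sup>+y. ?a (T x + y) * ?b x \<partial>lborel) \<partial>lborel)"
    by (rule lborel_pair.Fubini') measurable
  also have "\<dots> = emeasure lborel A * emeasure lborel ?B"
    by (simp add: nn_integral_cmult nn_integral_multc A add.commute[of "T _"])
  finally have "(\<integral>\<^sup>+x. ?a (T x) \<partial>lborel) * emeasure lborel ?B = emeasure lborel A * emeasure lborel ?B" .
  moreover have "emeasure lborel ?B \<noteq> 0" "emeasure lborel ?B \<noteq> \<infinity>"
    using unit_ball_vol_pos[of "real DIM('a)"] by (auto simp: emeasure_cball simp del: unit_ball_vol_pos)
  ultimately have "(\<integral>\<^sup>+x. ?a (T x) \<partial>lborel) = emeasure lborel A"
    by (metis ennreal_mult_divide_eq infinity_ennreal_def)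
  also have "(\<integral>\<^sup>+x. ?a (T x) \<partial>lborel) = (\<integral>\<^sup>+x. ?a x \<partial>distr lborel borel T)"
    by (rule nn_integral_distr[symmetric]) auto
  finally show "emeasure (distr lborel borel T) A = emeasure lborel A" by simp
qed simp

lemma integral_lborel_orthogonal:
  fixes T :: "real^'n::finite \<Rightarrow> real^'n" and H :: "real^'n \<Rightarrow> real"
  assumes T: "orthogonal_transformation T" and [measurable]: "H \<in> borel_measurable borel"
  shows "(\<integral>z. H (T z) \<partial>lborel) = (\<integral>z. H z \<partial>lborel)"
proof -
  note borel_measurable_orthogonal[OF T, measurable]
  have "(\<integral>z. H z \<partial>lborel) = (\<integral>z. H z \<partial>distr lborel borel T)"
    by (simp only: lborel_distr_orthogonal[OF T])
  also have "\<dots> = (\<integral>z. H (T z) \<partial>lborel)" by (subst integral_distr) auto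
  finally show ?thesis ..
qed

section \<open>The adjoint of the transform\<close>

context kernel_profile
begin

text \<open>The adjoint of \<open>transform\<close> between Lebesgue measure and the sphere. At
  \<omega> equal to the k-th power of the negative Laplacian of \<psi> it is the function D of the
  overview.\<close>

definition dual_transform :: "(real^'n::finite \<Rightarrow> real) \<Rightarrow> real^'n \<Rightarrow> real" where
  "dual_transform \<omega> \<xi> = (\<integral>z. \<phi> (z \<bullet> \<xi>) * \<omega> z \<partial>lborel)"

lemma nn_integral_profile_cball:
  fixes \<xi> :: "'a::euclidean_space"
  assumes "norm \<xi> = 1" "R \<ge> 0"
  shows "(\<integral>\<^sup>+z. ennreal \<bar>\<phi> (z \<bullet> \<xi>)\<bar> * indicator (cball 0 R) z \<partial>lborel)
    \<le> emeasure lborel (cball (0::'a) (R + 1)) * (\<integral>\<^sup>+s. ennreal \<bar>\<phi> s\<bar> * indicator {-(R + 2)..R + 2} s \<partial>lborel)"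
  by (rule nn_integral_ball_inner_le) (use assms in auto)

lemma profile_cball_finite:
  "emeasure lborel (cball (0::'a::euclidean_space) (R + 1)) * (\<integral>\<^sup>+s. ennreal \<bar>\<phi> s\<bar> * indicator {-(R + 2)..R + 2} s \<partial>lborel) < \<infinity>"
  using emeasure_bounded_finite[OF bounded_cball, of "0::'a" "R + 1"] profile_locally_integrable[of "R + 2"]
  by (simp add: ennreal_mult_less_top)

lemma integrable_profile_cball:
  fixes \<xi> :: "'a::euclidean_space"
  assumes "norm \<xi> = 1"
  shows "integrable lborel (\<lambda>z. \<phi> (z \<bullet> \<xi>) * indicator (cball 0 R) z)"
proof (cases "R \<ge> 0")
  case True
  have [measurable]: "cball (0::'a) R \<in> sets borel" by (simp add: borel_closed)
  show ?thesis
  proof (rule integrableI_bounded)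
    have "(\<integral>\<^sup>+z. ennreal (norm (\<phi> (z \<bullet> \<xi>) * indicator (cball 0 R) z)) \<partial>lborel)
       = (\<integral>\<^sup>+z. ennreal \<bar>\<phi> (z \<bullet> \<xi>)\<bar> * indicator (cball 0 R) z \<partial>lborel)"
      by (intro nn_integral_cong) (auto simp: indicator_def)
    also have "\<dots> < \<infinity>"
      by (rule le_less_trans[OF nn_integral_profile_cball[OF assms True] profile_cball_finite])
    finally show "(\<integral>\<^sup>+z. ennreal (norm (\<phi> (z \<bullet> \<xi>) * indicator (cball 0 R) z)) \<partial>lborel) < \<infinity>" .
  qed measurable
qed (simp add: not_le)

lemma dual_transform_uminus: "dual_transform \<omega> (- \<xi>) = dual_transform \<omega> \<xi>"
  by (simp add: dual_transform_def profile_even)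

text \<open>The slab estimate is uniform in the unit vector \<xi>. The resulting bound limits the
  loss on the part of the sphere away from the poles.\<close>

lemma dual_transform_bounded:
  fixes \<omega> :: "real^'n::finite \<Rightarrow> real"
  assumes \<omega>: "Ck_off0 k \<omega>" "annular_support \<omega>"
  shows "\<exists>C. \<forall>\<xi>. norm \<xi> = 1 \<longrightarrow> \<bar>dual_transform \<omega> \<xi>\<bar> \<le> C"
proof -
  obtain M R where M: "0 \<le> M" "0 \<le> R" "\<And>z. \<bar>\<omega> z\<bar> \<le> M * indicator (cball 0 R) z"
    using annular_support_bounded[OF \<omega>] by blast
  note [measurable] = Ck_off0_borel_measurable[OF \<omega>(1)]
  have [measurable]: "cball (0::real^'n) R \<in> sets borel" by (simp add: borel_closed)
  define K where "K = emeasure lborel (cball (0::real^'n) (R + 1)) * (\<integral>\<^sup>+s. ennreal \<bar>\<phi> s\<bar> * indicator {-(R + 2)..R + 2} s \<partial>lborel)"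
  have K: "K < \<infinity>" unfolding K_def by (rule profile_cball_finite)
  have "\<bar>dual_transform \<omega> \<xi>\<bar> \<le> M * enn2real K" if \<xi>: "norm \<xi> = 1" for \<xi>
  proof -
    have i: "integrable lborel (\<lambda>z. \<phi> (z \<bullet> \<xi>) * indicator (cball 0 R) z)" by (rule integrable_profile_cball[OF \<xi>])
    have "\<bar>dual_transform \<omega> \<xi>\<bar> \<le> (\<integral>z. \<bar>\<phi> (z \<bullet> \<xi>) * \<omega> z\<bar> \<partial>lborel)"
      unfolding dual_transform_def by (rule integral_abs_bound)
    also have "\<dots> \<le> (\<integral>z. M * \<bar>\<phi> (z \<bullet> \<xi>) * indicator (cball 0 R) z\<bar> \<partial>lborel)"
    proof (rule integral_mono_AE)
      show "integrable lborel (\<lambda>z. \<bar>\<phi> (z \<bullet> \<xi>) * \<omega> z\<bar>)"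
        by (intro integrable_abs integrable_weight_annular_support[OF _ _ \<omega>] integrable_profile_cball \<xi>) measurable
      show "integrable lborel (\<lambda>z. M * \<bar>\<phi> (z \<bullet> \<xi>) * indicator (cball 0 R) z\<bar>)"
        using integrable_abs[OF i] by simp
      show "AE z in lborel. \<bar>\<phi> (z \<bullet> \<xi>) * \<omega> z\<bar> \<le> M * \<bar>\<phi> (z \<bullet> \<xi>) * indicator (cball 0 R) z\<bar>"
        using mult_left_mono[OF M(3), of "\<bar>\<phi> (_ \<bullet> \<xi>)\<bar>"] by (intro AE_I2) (simp add: abs_mult mult_ac)
    qed
    also have "\<dots> = M * (\<integral>z. \<bar>\<phi> (z \<bullet> \<xi>) * indicator (cball 0 R) z\<bar> \<partial>lborel)" by simp
    also have "(\<integral>z. \<bar>\<phi> (z \<bullet> \<xi>) * indicator (cball 0 R) z\<bar> \<partial>lborel) = enn2real (\<integral>\<^sup>+z. ennreal \<bar>\<phi> (z \<bullet> \<xi>) * indicator (cball 0 R) z\<bar> \<partial>lborel)"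
      by (rule integral_eq_nn_integral) auto
    also have "(\<integral>\<^sup>+z. ennreal \<bar>\<phi> (z \<bullet> \<xi>) * indicator (cball 0 R) z\<bar> \<partial>lborel) = (\<integral>\<^sup>+z. ennreal \<bar>\<phi> (z \<bullet> \<xi>)\<bar> * indicator (cball 0 R) z \<partial>lborel)"
      by (intro nn_integral_cong) (auto simp: indicator_def)
    also have "M * enn2real \<dots> \<le> M * enn2real K"
      using nn_integral_profile_cball[OF \<xi> M(2)] K M(1) unfolding K_def
      by (intro mult_left_mono enn2real_mono) auto
    finally show ?thesis .
  qed
  then show ?thesis by blast
qed

lemma dual_transform_measurable [measurable]:
  assumes [measurable]: "\<omega> \<in> borel_measurable borel"
  shows "dual_transform \<omega> \<in> borel_measurable borel"
  unfolding dual_transform_def[abs_def] by measurable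

text \<open>Fubini, with absolute integrability from the slab estimate: K bounds the inner integral
  of the profile over the ball for every unit vector \<xi>.\<close>

lemma integral_transform_dual:
  fixes g \<omega> :: "real^'n::finite \<Rightarrow> real"
  assumes g: "Ck_off0 k g" and \<omega>: "Ck_off0 l \<omega>" "annular_support \<omega>"
  shows "(\<integral>z. transform g z * \<omega> z \<partial>lborel) = (\<integral>\<xi>. g \<xi> * dual_transform \<omega> \<xi> \<partial>sphere_measure)"
proof -
  interpret P: pair_sigma_finite "lborel :: (real^'n) measure" "sphere_measure :: (real^'n) measure" ..
  obtain M R where M: "0 \<le> M" "0 \<le> R" "\<And>z. \<bar>\<omega> z\<bar> \<le> M * indicator (cball 0 R) z"
    using annular_support_bounded[OF \<omega>] by blast
  obtain B where B: "B \<ge> 0" "\<And>\<xi>. norm \<xi> = 1 \<Longrightarrow> \<bar>g \<xi>\<bar> \<le> B" using Ck_off0_bounded_sphere[OF g] by metis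
  note [measurable] = Ck_off0_borel_measurable[OF \<omega>(1)] Ck_off0_borel_measurable[OF g]
  have [measurable]: "cball (0::real^'n) R \<in> sets borel" by (simp add: borel_closed)
  let ?f = "\<lambda>z \<xi>. \<phi> (z \<bullet> \<xi>) * g \<xi> * \<omega> z"
  define K where "K = emeasure lborel (cball (0::real^'n) (R + 1)) * (\<integral>\<^sup>+s. ennreal \<bar>\<phi> s\<bar> * indicator {-(R + 2)..R + 2} s \<partial>lborel)"
  have K: "K < \<infinity>" unfolding K_def by (rule profile_cball_finite)
  have int: "integrable (lborel \<Otimes>\<^sub>M sphere_measure) (case_prod ?f)"
  proof (rule integrableI_bounded)
    have "(\<integral>\<^sup>+x. ennreal (norm (case_prod ?f x)) \<partial>(lborel \<Otimes>\<^sub>M sphere_measure)) 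
        = (\<integral>\<^sup>+\<xi>. (\<integral>\<^sup>+z. ennreal \<bar>?f z \<xi>\<bar> \<partial>lborel) \<partial>sphere_measure)"
      by (subst P.nn_integral_snd[symmetric]) (auto simp: case_prod_beta)
    also have "\<dots> \<le> (\<integral>\<^sup>+\<xi>. ennreal (B * M) * K \<partial>(sphere_measure :: (real^'n) measure))"
    proof (rule nn_integral_mono_AE)
      show "AE \<xi> in sphere_measure. (\<integral>\<^sup>+z. ennreal \<bar>?f z \<xi>\<bar> \<partial>lborel) \<le> ennreal (B * M) * K"
        using AE_sphere_measure
      proof eventually_elim
        case (elim \<xi>)
        have "(\<integral>\<^sup>+z. ennreal \<bar>?f z \<xi>\<bar> \<partial>lborel) \<le> (\<integral>\<^sup>+z. ennreal (B * M) * (ennreal \<bar>\<phi> (z \<bullet> \<xi>)\<bar> * indicator (cball 0 R) z) \<partial>lborel)"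
        proof (rule nn_integral_mono)
          fix z
          have "\<bar>?f z \<xi>\<bar> \<le> \<bar>\<phi> (z \<bullet> \<xi>)\<bar> * (B * (M * indicator (cball 0 R) z))"
            using B(1) unfolding abs_mult mult.assoc by (intro mult_left_mono mult_mono B(2)[OF elim] M(3)) auto
          also have "\<dots> = (B * M) * (\<bar>\<phi> (z \<bullet> \<xi>)\<bar> * indicator (cball 0 R) z)" by (simp add: mult_ac)
          finally have "ennreal \<bar>?f z \<xi>\<bar> \<le> ennreal ((B * M) * (\<bar>\<phi> (z \<bullet> \<xi>)\<bar> * indicator (cball 0 R) z))" by (rule ennreal_leI)
          also have "\<dots> = ennreal (B * M) * (ennreal \<bar>\<phi> (z \<bullet> \<xi>)\<bar> * indicator (cball 0 R) z)"
            using B(1) M(1) by (auto simp: indicator_def ennreal_mult)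
          finally show "ennreal \<bar>?f z \<xi>\<bar> \<le> ennreal (B * M) * (ennreal \<bar>\<phi> (z \<bullet> \<xi>)\<bar> * indicator (cball 0 R) z)" .
        qed
        also have "\<dots> = ennreal (B * M) * (\<integral>\<^sup>+z. ennreal \<bar>\<phi> (z \<bullet> \<xi>)\<bar> * indicator (cball 0 R) z \<partial>lborel)"
          by (rule nn_integral_cmult) measurable
        also have "\<dots> \<le> ennreal (B * M) * K"
          unfolding K_def by (intro mult_left_mono nn_integral_profile_cball[OF elim M(2)]) auto
        finally show ?case .
      qed
    qed
    also have "\<dots> = (ennreal (B * M) * K) * emeasure sphere_measure (UNIV :: (real^'n) set)" by simp
    also have "\<dots> < \<infinity>"
    proof -
      have m: "a * b < \<infinity>" if "a < \<infinity>" "b < \<infinity>" for a b :: ennreal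
        using that by (auto simp: ennreal_mult_less_top)
      show ?thesis
        by (rule m[OF m[OF _ K]]) (simp_all add: less_top[symmetric])
    qed
    finally show "(\<integral>\<^sup>+x. ennreal (norm (case_prod ?f x)) \<partial>(lborel \<Otimes>\<^sub>M sphere_measure)) < \<infinity>" .
  qed measurable
  have "(\<integral>z. transform g z * \<omega> z \<partial>lborel) = (\<integral>z. (\<integral>\<xi>. ?f z \<xi> \<partial>sphere_measure) \<partial>lborel)"
    unfolding transform_def by (intro Bochner_Integration.integral_cong refl) simp
  also have "\<dots> = (\<integral>\<xi>. (\<integral>z. ?f z \<xi> \<partial>lborel) \<partial>sphere_measure)" by (rule P.Fubini_integral[OF int, symmetric])
  also have "\<dots> = (\<integral>\<xi>. g \<xi> * dual_transform \<omega> \<xi> \<partial>sphere_measure)"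
  proof (intro Bochner_Integration.integral_cong refl)
    fix \<xi>
    have "?f z \<xi> = g \<xi> * (\<phi> (z \<bullet> \<xi>) * \<omega> z)" for z by simp
    then show "(\<integral>z. ?f z \<xi> \<partial>lborel) = g \<xi> * dual_transform \<omega> \<xi>"
      unfolding dual_transform_def by (simp only: integral_mult_right_zero)
  qed
  finally show ?thesis .
qed

text \<open>The singular hyperplane of the profile moves with the unit vector. A change of variables
  by the rotation from e to that vector fixes the hyperplane and puts the variation into \<omega>,
  which is continuous off the origin.\<close>

lemma dual_transform_continuous:
  fixes \<omega> :: "real^'n::finite \<Rightarrow> real"
  assumes \<omega>: "Ck_off0 k \<omega>" "annular_support \<omega>" and e: "norm e = 1"
    and X: "\<And>i. norm (X i) = 1" "X \<longlonglongrightarrow> e"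
  shows "(\<lambda>i. dual_transform \<omega> (X i)) \<longlonglongrightarrow> dual_transform \<omega> e"
proof -
  obtain M R where M: "0 \<le> M" "0 \<le> R" "\<And>z. \<bar>\<omega> z\<bar> \<le> M * indicator (cball 0 R) z"
    using annular_support_bounded[OF \<omega>] by blast
  note [measurable] = Ck_off0_borel_measurable[OF \<omega>(1)]
  have "\<forall>\<^sub>F i in sequentially. X i \<in> ball e (norm e)"
    by (rule topological_tendstoD[OF X(2)]) (use e in auto)
  then obtain N where N: "\<And>i. i \<ge> N \<Longrightarrow> X i \<in> ball e (norm e)"
    unfolding eventually_sequentially by blast
  define Y where "Y i = X (i + N)" for i
  have pos: "e \<bullet> Y i > 0" for i using ball_inner_pos[OF N] by (simp add: Y_def)
  have Yl: "Y \<longlonglongrightarrow> e" unfolding Y_def by (rule LIMSEQ_ignore_initial_segment[OF X(2)])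
  have Y1: "norm (Y i) = 1" for i using X(1) by (simp add: Y_def)
  let ?R = "\<lambda>i. plane_rotation e (Y i)"
  have R: "orthogonal_transformation (?R i)" "?R i e = Y i" for i
    using orthogonal_plane_rotation[OF e Y1 pos] plane_rotation_maps[OF e Y1 pos] by auto
  note Rm[measurable] = borel_measurable_orthogonal[OF R(1)]
  have RY: "?R i w \<bullet> Y i = w \<bullet> e" for i w
    using R unfolding orthogonal_transformation_def by metis
  have eq: "dual_transform \<omega> (Y i) = (\<integral>w. \<phi> (w \<bullet> e) * \<omega> (?R i w) \<partial>lborel)" for i
  proof -
    have "dual_transform \<omega> (Y i) = (\<integral>w. \<phi> (?R i w \<bullet> Y i) * \<omega> (?R i w) \<partial>lborel)"
      unfolding dual_transform_def by (rule integral_lborel_orthogonal[OF R(1), symmetric]) measurable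
    also have "\<dots> = (\<integral>w. \<phi> (w \<bullet> e) * \<omega> (?R i w) \<partial>lborel)" by (simp only: RY)
    finally show ?thesis .
  qed
  have "(\<lambda>i. \<integral>w. \<phi> (w \<bullet> e) * \<omega> (?R i w) \<partial>lborel) \<longlonglongrightarrow> (\<integral>w. \<phi> (w \<bullet> e) * \<omega> w \<partial>lborel)"
  proof (rule integral_dominated_convergence[where w="\<lambda>w. \<bar>\<phi> (w \<bullet> e) * indicator (cball 0 R) w\<bar> * M"])
    show "integrable lborel (\<lambda>w. \<bar>\<phi> (w \<bullet> e) * indicator (cball 0 R) w\<bar> * M)"
      using integrable_abs[OF integrable_profile_cball[OF e]] by simp
    show "AE w in lborel. (\<lambda>i. \<phi> (w \<bullet> e) * \<omega> (?R i w)) \<longlonglongrightarrow> \<phi> (w \<bullet> e) * \<omega> w"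
      using AE_lborel_singleton[of 0]
    proof eventually_elim
      case (elim w)
      have "(\<lambda>i. ?R i w) \<longlonglongrightarrow> plane_rotation e e w"
        unfolding plane_rotation_def using e by (intro tendsto_intros Yl) (simp add: dot_square_norm)
      then have "(\<lambda>i. ?R i w) \<longlonglongrightarrow> w" by (simp add: plane_rotation_same[OF e])
      moreover have "isCont \<omega> w"
        using elim Ck_off0_continuous_on[OF \<omega>(1)] continuous_on_eq_continuous_at[of "- {0}" \<omega>] by auto
      ultimately have "(\<lambda>i. \<omega> (?R i w)) \<longlonglongrightarrow> \<omega> w" using isCont_tendsto_compose by blast
      then show ?case by (intro tendsto_mult tendsto_const)
    qed
    show "AE w in lborel. norm (\<phi> (w \<bullet> e) * \<omega> (?R i w)) \<le> \<bar>\<phi> (w \<bullet> e) * indicator (cball 0 R) w\<bar> * M" for i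
    proof (rule AE_I2)
      fix w
      have "\<bar>\<omega> (?R i w)\<bar> \<le> M * indicator (cball 0 R) (?R i w)" by (rule M(3))
      also have "indicator (cball 0 R) (?R i w) = (indicator (cball 0 R) w :: real)"
        using orthogonal_transformation_norm[OF R(1)] by (simp add: indicator_def)
      finally have "\<bar>\<phi> (w \<bullet> e)\<bar> * \<bar>\<omega> (?R i w)\<bar> \<le> \<bar>\<phi> (w \<bullet> e)\<bar> * (M * indicator (cball 0 R) w)" by (intro mult_left_mono) auto
      then show "norm (\<phi> (w \<bullet> e) * \<omega> (?R i w)) \<le> \<bar>\<phi> (w \<bullet> e) * indicator (cball 0 R) w\<bar> * M"
        by (simp add: abs_mult mult_ac)
    qed
  qed measurable
  then have "(\<lambda>i. dual_transform \<omega> (Y i)) \<longlonglongrightarrow> dual_transform \<omega> e"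
    by (simp only: eq dual_transform_def[of _ e])
  then show ?thesis unfolding Y_def by (rule LIMSEQ_offset)
qed

end

section \<open>Pairing the profile with derivatives of bumps\<close>

text \<open>The order k is tracked because the bumps are powers of positive parts, with finitely
  many continuous derivatives.\<close>

fun Ck_real :: "nat \<Rightarrow> (real \<Rightarrow> real) \<Rightarrow> bool" where
  "Ck_real 0 a \<longleftrightarrow> continuous_on UNIV a"
| "Ck_real (Suc k) a \<longleftrightarrow> (\<exists>a'. Ck_real k a' \<and> (\<forall>t. (a has_real_derivative a' t) (at t)))"

declare Ck_real.simps(2) [simp del]

lemma Ck_real_SucI: "Ck_real k a' \<Longrightarrow> (\<And>t. (a has_real_derivative a' t) (at t)) \<Longrightarrow> Ck_real (Suc k) a"
  by (auto simp: Ck_real.simps(2))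

lemma Ck_real_Suc_deriv:
  assumes "Ck_real (Suc k) a"
  shows "Ck_real k (deriv a)" "(a has_real_derivative deriv a t) (at t)"
proof -
  obtain a' where a': "Ck_real k a'" "\<And>t. (a has_real_derivative a' t) (at t)"
    using assms by (auto simp: Ck_real.simps(2))
  then have "deriv a = a'" by (intro ext DERIV_imp_deriv)
  then show "Ck_real k (deriv a)" "(a has_real_derivative deriv a t) (at t)" using a' by auto
qed

lemma Ck_real_Suc_imp: "Ck_real (Suc k) a \<Longrightarrow> Ck_real k a"
proof (induction k arbitrary: a)
  case 0
  then show ?case using Ck_real_Suc_deriv(2)[OF 0] by (auto intro!: continuous_at_imp_continuous_on DERIV_isCont)
next
  case (Suc k)
  then show ?case by (meson Ck_real.simps(2))
qed

lemma Ck_real_mono: "Ck_real l a \<Longrightarrow> k \<le> l \<Longrightarrow> Ck_real k a"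
  by (induction l) (auto simp: le_Suc_eq dest: Ck_real_Suc_imp)

lemma Ck_real_continuous: "Ck_real k a \<Longrightarrow> continuous_on UNIV a"
  using Ck_real_mono[of k a 0] by simp

lemma Ck_real_borel_measurable: "Ck_real k a \<Longrightarrow> a \<in> borel_measurable borel"
  by (intro borel_measurable_continuous_onI Ck_real_continuous)

lemma Ck_real_const: "Ck_real k (\<lambda>_. c)"
  by (induction k arbitrary: c) (auto intro: Ck_real_SucI[where a'="\<lambda>_. 0"])

lemma Ck_real_ident: "Ck_real k (\<lambda>t. t)"
  by (cases k) (auto intro!: Ck_real_SucI[where a'="\<lambda>_. 1"] Ck_real_const)

lemma Ck_real_add:
  assumes "Ck_real k a" "Ck_real k b" shows "Ck_real k (\<lambda>t. a t + b t)"
  using assms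
proof (induction k arbitrary: a b)
  case (Suc k)
  show ?case
    by (rule Ck_real_SucI[OF Suc.IH[OF Ck_real_Suc_deriv(1)[OF Suc.prems(1)] Ck_real_Suc_deriv(1)[OF Suc.prems(2)]]])
       (intro DERIV_add Ck_real_Suc_deriv(2)[OF Suc.prems(1)] Ck_real_Suc_deriv(2)[OF Suc.prems(2)])
qed (auto intro: continuous_on_add)

lemma Ck_real_mult:
  assumes "Ck_real k a" "Ck_real k b" shows "Ck_real k (\<lambda>t. a t * b t)"
  using assms
proof (induction k arbitrary: a b)
  case (Suc k)
  note d = Ck_real_Suc_deriv[OF Suc.prems(1)] Ck_real_Suc_deriv[OF Suc.prems(2)]
  note i = Ck_real_Suc_imp[OF Suc.prems(1)] Ck_real_Suc_imp[OF Suc.prems(2)]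
  show ?case
  proof (rule Ck_real_SucI[where a'="\<lambda>t. deriv a t * b t + a t * deriv b t"])
    show "Ck_real k (\<lambda>t. deriv a t * b t + a t * deriv b t)" by (intro Ck_real_add Suc.IH d i)
    show "((\<lambda>t. a t * b t) has_real_derivative deriv a t * b t + a t * deriv b t) (at t)" for t
      using DERIV_mult[OF d(2,4)] by (simp add: algebra_simps)
  qed
qed (auto intro: continuous_on_mult)

lemma Ck_real_cmult: "Ck_real k a \<Longrightarrow> Ck_real k (\<lambda>t. c * a t)"
  by (intro Ck_real_mult Ck_real_const)

lemma Ck_real_diff: "Ck_real k a \<Longrightarrow> Ck_real k b \<Longrightarrow> Ck_real k (\<lambda>t. a t - b t)"
  using Ck_real_add[of k a "\<lambda>t. - 1 * b t"] Ck_real_cmult[of k b "- 1"] by simp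

lemma Ck_real_affine:
  assumes "Ck_real k a" shows "Ck_real k (\<lambda>t. a (c * t + d))"
  using assms
proof (induction k arbitrary: a)
  case 0
  then show ?case by (auto intro!: continuous_on_compose2[of UNIV a] continuous_intros)
next
  case (Suc k)
  show ?case
  proof (rule Ck_real_SucI[where a'="\<lambda>t. c * deriv a (c * t + d)"])
    show "Ck_real k (\<lambda>t. c * deriv a (c * t + d))"
      by (intro Ck_real_cmult Suc.IH Ck_real_Suc_deriv(1)[OF Suc.prems])
    show "((\<lambda>t. a (c * t + d)) has_real_derivative c * deriv a (c * t + d)) (at t)" for t
    proof -
      have "((\<lambda>t. c * t + d) has_real_derivative c) (at t)" by (auto intro!: derivative_eq_intros)
      from DERIV_chain2[OF Ck_real_Suc_deriv(2)[OF Suc.prems] this] show ?thesis by (simp add: mult.commute)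
    qed
  qed
qed

lemma Ck_real_pos_part_power:
  assumes "Ck_real k P"
  shows "Ck_real k (\<lambda>t. max 0 (P t) ^ Suc k)"
  using assms
proof (induction k)
  case 0
  then show ?case by (auto intro!: continuous_intros)
next
  case (Suc k)
  note d = Ck_real_Suc_deriv[OF Suc.prems]
  show ?case
  proof (rule Ck_real_SucI[where a'="\<lambda>t. real (k + 2) * (max 0 (P t) ^ Suc k * deriv P t)"])
    show "Ck_real k (\<lambda>t. real (k + 2) * (max 0 (P t) ^ Suc k * deriv P t))"
      by (intro Ck_real_cmult Ck_real_mult d Suc.IH Ck_real_Suc_imp[OF Suc.prems])
    show "((\<lambda>t. max 0 (P t) ^ Suc (Suc k)) has_real_derivative real (k + 2) * (max 0 (P t) ^ Suc k * deriv P t)) (at t)" for t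
      using DERIV_chain2[OF has_real_derivative_pos_part_power[of k "P t"] d(2)[of t]] by (simp add: mult.assoc)
  qed
qed

lemma Ck_real_deriv_iter: "Ck_real (j + l) a \<Longrightarrow> Ck_real l ((deriv ^^ j) a)"
  by (induction j arbitrary: l) (auto dest!: Ck_real_Suc_deriv(1) simp flip: add_Suc_right)

lemma deriv_iter_add:
  assumes "Ck_real j a" "Ck_real j b"
  shows "(deriv ^^ j) (\<lambda>t. a t + b t) = (\<lambda>t. (deriv ^^ j) a t + (deriv ^^ j) b t)"
  using assms
proof (induction j)
  case (Suc j)
  have "Ck_real (Suc 0) ((deriv ^^ j) a)" "Ck_real (Suc 0) ((deriv ^^ j) b)"
    using Suc.prems by (auto intro!: Ck_real_deriv_iter)
  from Ck_real_Suc_deriv(2)[OF this(1)] Ck_real_Suc_deriv(2)[OF this(2)]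
  have "deriv (\<lambda>t. (deriv ^^ j) a t + (deriv ^^ j) b t) = (\<lambda>t. deriv ((deriv ^^ j) a) t + deriv ((deriv ^^ j) b) t)"
    by (intro ext DERIV_imp_deriv DERIV_add)
  then show ?case using Suc.IH[OF Suc.prems[THEN Ck_real_Suc_imp]] by simp
qed simp

lemma deriv_iter_cmult:
  assumes "Ck_real j a"
  shows "(deriv ^^ j) (\<lambda>t. c * a t) = (\<lambda>t. c * (deriv ^^ j) a t)"
  using assms
proof (induction j)
  case (Suc j)
  have "Ck_real (Suc 0) ((deriv ^^ j) a)" using Suc.prems by (auto intro!: Ck_real_deriv_iter)
  from Ck_real_Suc_deriv(2)[OF this]
  have "deriv (\<lambda>t. c * (deriv ^^ j) a t) = (\<lambda>t. c * deriv ((deriv ^^ j) a) t)"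
    by (intro ext DERIV_imp_deriv DERIV_cmult)
  then show ?case using Suc.IH[OF Ck_real_Suc_imp[OF Suc.prems]] by simp
qed simp

lemma deriv_iter_affine:
  assumes "Ck_real j a"
  shows "(deriv ^^ j) (\<lambda>t. a (c * t + d)) = (\<lambda>t. c ^ j * (deriv ^^ j) a (c * t + d))"
  using assms
proof (induction j)
  case (Suc j)
  have 1: "Ck_real (Suc 0) ((deriv ^^ j) a)" using Suc.prems by (auto intro!: Ck_real_deriv_iter)
  have "((\<lambda>t. c ^ j * (deriv ^^ j) a (c * t + d)) has_real_derivative c ^ Suc j * deriv ((deriv ^^ j) a) (c * t + d)) (at t)" for t
  proof -
    have "((\<lambda>t. c * t + d) has_real_derivative c) (at t)" by (auto intro!: derivative_eq_intros)
    from DERIV_cmult[OF DERIV_chain2[OF Ck_real_Suc_deriv(2)[OF 1] this], of "c ^ j"] show ?thesis by (simp add: mult_ac)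
  qed
  then have "deriv (\<lambda>t. c ^ j * (deriv ^^ j) a (c * t + d)) = (\<lambda>t. c ^ Suc j * deriv ((deriv ^^ j) a) (c * t + d))"
    by (intro ext DERIV_imp_deriv)
  then show ?case using Suc.IH[OF Ck_real_Suc_imp[OF Suc.prems]] by simp
qed simp

definition bounded_support :: "real \<Rightarrow> (real \<Rightarrow> real) \<Rightarrow> bool" where
  "bounded_support R a \<longleftrightarrow> (\<forall>t. \<bar>t\<bar> > R \<longrightarrow> a t = 0)"

lemma bounded_support_deriv:
  assumes "bounded_support R a" shows "bounded_support R (deriv a)"
  unfolding bounded_support_def
proof (intro allI impI)
  fix t assume t: "\<bar>t\<bar> > R"
  have op: "open {t::real. \<bar>t\<bar> > R}" by (intro open_Collect_less continuous_intros)
  have "((\<lambda>_. 0) has_real_derivative 0) (at t)" by simp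
  then have "(a has_real_derivative 0) (at t)"
    by (rule has_field_derivative_transform_within_open[OF _ op]) (use t assms in \<open>auto simp: bounded_support_def\<close>)
  then show "deriv a t = 0" by (rule DERIV_imp_deriv)
qed

lemma bounded_support_deriv_iter: "bounded_support R a \<Longrightarrow> bounded_support R ((deriv ^^ j) a)"
  by (induction j) (auto intro: bounded_support_deriv)

lemma bounded_support_bounded:
  assumes "Ck_real k a" "bounded_support R a"
  shows "\<exists>M\<ge>0. \<forall>t. \<bar>a t\<bar> \<le> M * indicator {-R..R} t"
proof -
  have "compact (a ` {-R..R})"
    by (intro compact_continuous_image continuous_on_subset[OF Ck_real_continuous[OF assms(1)]]) auto
  then obtain M where M: "M > 0" "\<forall>y\<in>a ` {-R..R}. norm y \<le> M" using compact_imp_bounded bounded_pos by metis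
  have "\<bar>a t\<bar> \<le> M * indicator {-R..R} t" for t
  proof (cases "t \<in> {-R..R}")
    case False
    then have "\<bar>t\<bar> > R" by auto
    then show ?thesis using assms(2) M by (simp add: bounded_support_def)
  qed (use M in auto)
  then show ?thesis using M by (intro exI[of _ M]) auto
qed

lemma integrable_weight_bounded_support:
  assumes w: "(\<integral>\<^sup>+s. ennreal \<bar>w s\<bar> * indicator {-R..R} s \<partial>lborel) < \<infinity>" and [measurable]: "w \<in> borel_measurable borel"
    and a: "Ck_real k a" "bounded_support R a"
  shows "integrable lborel (\<lambda>t. w t * a t)"
proof -
  obtain M where M: "0 \<le> M" "\<And>t. \<bar>a t\<bar> \<le> M * indicator {-R..R} t"
    using bounded_support_bounded[OF a] by blast
  note [measurable] = Ck_real_borel_measurable[OF a(1)]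
  show ?thesis
  proof (rule Bochner_Integration.integrable_bound)
    have "integrable lborel (\<lambda>t. w t * indicator {-R..R} t)"
    proof (rule integrableI_bounded)
      have "(\<integral>\<^sup>+t. ennreal (norm (w t * indicator {-R..R} t)) \<partial>lborel) = (\<integral>\<^sup>+s. ennreal \<bar>w s\<bar> * indicator {-R..R} s \<partial>lborel)"
        by (intro nn_integral_cong) (auto simp: indicator_def)
      then show "(\<integral>\<^sup>+t. ennreal (norm (w t * indicator {-R..R} t)) \<partial>lborel) < \<infinity>" using w by simp
    qed measurable
    then show "integrable lborel (\<lambda>t. M * (w t * indicator {-R..R} t))" by simp
    show "AE t in lborel. norm (w t * a t) \<le> norm (M * (w t * indicator {-R..R} t))"
      using mult_left_mono[OF M(2), of "\<bar>w _\<bar>"] M(1) by (intro AE_I2) (auto simp: abs_mult mult_ac)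
  qed measurable
qed

lemma integrable_bounded_support:
  assumes a: "Ck_real k a" "bounded_support R a"
  shows "integrable lborel a"
proof -
  have "(\<integral>\<^sup>+s. ennreal \<bar>1::real\<bar> * indicator {-R..R} s \<partial>lborel) < \<infinity>"
    by (simp add: emeasure_lborel_Icc_eq)
  from integrable_weight_bounded_support[OF this _ a] show ?thesis by simp
qed

lemma integral_deriv_eq_0:
  assumes a: "Ck_real (Suc k) a" "bounded_support R a"
  shows "(\<integral>t. deriv a t \<partial>lborel) = 0"
proof -
  define S where "S = max R 0 + 1"
  have S: "S > R" "-S \<le> S" "S > 0" by (auto simp: S_def)
  have "(\<integral>t. deriv a t * indicator {-S..S} t \<partial>lborel) = a S - a (-S)"
  proof (rule integral_FTC_Icc_real[OF S(2)])
    show "DERIV a x :> deriv a x" for x by (rule Ck_real_Suc_deriv(2)[OF a(1)])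
    show "isCont (deriv a) x" for x
      using Ck_real_continuous[OF Ck_real_Suc_deriv(1)[OF a(1)]] by (simp add: continuous_on_eq_continuous_at)
  qed
  moreover have "deriv a t * indicator {-S..S} t = deriv a t" for t
  proof (cases "t \<in> {-S..S}")
    case False
    then have "\<bar>t\<bar> > R" using S by auto
    then show ?thesis using bounded_support_deriv[OF a(2)] by (simp add: bounded_support_def)
  qed simp
  moreover have "a S = 0" "a (-S) = 0" using a(2) S by (auto simp: bounded_support_def)
  ultimately show ?thesis by simp
qed

lemma Ck_off0_Ck_real:
  fixes i :: "'n::finite"
  shows "Ck_real k a \<Longrightarrow> Ck_off0 k (\<lambda>z::real^'n. a (z $ i))"
proof (induction k arbitrary: a)
  case 0
  then show ?case by (auto intro!: continuous_on_compose2[of UNIV a] continuous_intros)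
next
  case (Suc k)
  show ?case
  proof (rule Ck_off0_SucI[where u'="\<lambda>j z. if j = i then deriv a (z $ i) else 0"])
    show "Ck_off0 k (\<lambda>z. if j = i then deriv a (z $ i) else 0)" for j
      using Suc.IH[OF Ck_real_Suc_deriv(1)[OF Suc.prems]] by (cases "j = i") (auto intro: Ck_off0_const)
    show "((\<lambda>z. a (z $ i)) has_derivative (\<lambda>h. \<Sum>j\<in>UNIV. h $ j * (if j = i then deriv a (z $ i) else 0))) (at z)" for z
    proof -
      have "((\<lambda>z. a (z $ i)) has_derivative (\<lambda>h. deriv a (z $ i) * (h $ i))) (at z)"
        by (rule has_derivative_compose[OF bounded_linear_imp_has_derivative[OF bounded_linear_vec_nth]])
           (use Ck_real_Suc_deriv(2)[OF Suc.prems] in \<open>simp add: has_field_derivative_def\<close>)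
      moreover have "(\<lambda>h::real^'n. deriv a (z $ i) * (h $ i)) = (\<lambda>h. \<Sum>j\<in>UNIV. h $ j * (if j = i then deriv a (z $ i) else 0))"
        by (simp add: fun_eq_iff if_distrib[where f="\<lambda>x. _ * x"] mult.commute cong: if_cong)
      ultimately show ?thesis by simp
    qed
  qed
qed

lemma partial_deriv_Ck_real:
  assumes "Ck_real (Suc k) a"
  shows "partial_deriv j (\<lambda>z. a (z $ i)) z = (if j = i then deriv a (z $ i) else 0)"
proof -
  have "((\<lambda>z. a (z $ i)) has_derivative (\<lambda>h. deriv a (z $ i) * (h $ i))) (at z)"
    by (rule has_derivative_compose[OF bounded_linear_imp_has_derivative[OF bounded_linear_vec_nth]])
       (use Ck_real_Suc_deriv(2)[OF assms] in \<open>simp add: has_field_derivative_def\<close>)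
  from partial_deriv_eqI[OF this] show ?thesis by (simp add: axis_def)
qed

section \<open>Scaling and signs of the one-dimensional pairing\<close>

context kernel_profile
begin

definition profile_pairing :: "nat \<Rightarrow> (real \<Rightarrow> real) \<Rightarrow> real" where
  "profile_pairing k a = (\<integral>t. \<phi> t * (deriv ^^ k) a t \<partial>lborel)"

lemma integrable_profile_pairing:
  assumes "Ck_real k a" "bounded_support R a"
  shows "integrable lborel (\<lambda>t. \<phi> t * (deriv ^^ k) a t)"
  by (rule integrable_weight_bounded_support[OF profile_locally_integrable[of R] profile_measurable Ck_real_deriv_iter[of k 0]])
     (use assms bounded_support_deriv_iter in auto)

text \<open>Substituting s = N t gives \<open>N ^ k\<close> from the derivatives, 1/N from the
  measure and \<open>N ^ (- p)\<close> from the profile. The logarithmic term is a constant times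
  the integral of the k-th derivative of b, which is zero.\<close>

lemma profile_pairing_scale:
  assumes k: "p + 1 \<le> k" and N: "N > 0" and b: "Ck_real k b" "bounded_support R b"
  shows "profile_pairing k (\<lambda>t. b (N * t)) = N ^ (k - 1 - p) * profile_pairing k b"
proof -
  let ?h = "(deriv ^^ k) b"
  obtain k' where k': "k = Suc k'" using k by (cases k) auto
  have h0: "(\<integral>t. ?h t \<partial>lborel) = 0"
    unfolding k' using b k'
    by (auto intro!: integral_deriv_eq_0[of 0] Ck_real_deriv_iter bounded_support_deriv_iter)
  have ih: "integrable lborel ?h"
    by (rule integrable_bounded_support[OF Ck_real_deriv_iter[of k 0] bounded_support_deriv_iter]) (use b in auto)
  have ip: "integrable lborel (\<lambda>t. \<phi> t * ?h t)" by (rule integrable_profile_pairing[OF b])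
  have hm[measurable]: "?h \<in> borel_measurable borel" using ih by simp
  have "profile_pairing k (\<lambda>t. b (N * t)) = (\<integral>t. \<phi> t * (N ^ k * ?h (N * t)) \<partial>lborel)"
    unfolding profile_pairing_def using deriv_iter_affine[OF b(1), of N 0] by simp
  also have "\<dots> = \<bar>inverse N\<bar> *\<^sub>R (\<integral>s. \<phi> (0 + inverse N * s) * (N ^ k * ?h (N * (0 + inverse N * s))) \<partial>lborel)"
    by (rule lborel_integral_real_affine) (use N in simp)
  also have "(\<integral>s. \<phi> (0 + inverse N * s) * (N ^ k * ?h (N * (0 + inverse N * s))) \<partial>lborel)
      = (\<integral>s. N ^ k * inverse N ^ p * (\<phi> s * ?h s) + N ^ k * (q * ln (inverse N)) * ?h s \<partial>lborel)"
  proof (rule integral_cong_AE)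
    show "AE s in lborel. \<phi> (0 + inverse N * s) * (N ^ k * ?h (N * (0 + inverse N * s)))
      = N ^ k * inverse N ^ p * (\<phi> s * ?h s) + N ^ k * (q * ln (inverse N)) * ?h s"
      using AE_lborel_singleton[of 0]
    proof eventually_elim
      case (elim s)
      have 1: "N * (0 + inverse N * s) = s" using N by simp
      have 2: "\<phi> (0 + inverse N * s) = inverse N ^ p * \<phi> s + q * ln (inverse N)"
        using profile_scale[of "inverse N" s] N elim by simp
      show ?case unfolding 1 2 by (simp add: algebra_simps)
    qed
  qed measurable
  also have "\<dots> = N ^ k * inverse N ^ p * profile_pairing k b"
    using ip ih h0 by (simp add: profile_pairing_def)
  also have "\<bar>inverse N\<bar> *\<^sub>R (N ^ k * inverse N ^ p * profile_pairing k b) = N ^ (k - 1 - p) * profile_pairing k b"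
  proof -
    obtain l where l: "k = Suc (p + l)" using k by (metis Suc_eq_plus1 add_Suc le_Suc_ex)
    show ?thesis using N by (simp add: l power_add field_simps)
  qed
  finally show ?thesis .
qed

text \<open>The pairing scales with a negative power of the width, so a narrow copy of \<open>b\<close>, subtracted
  from a fixed wide function dominating it, flips the sign.\<close>

lemma profile_pairing_both_signs:
  assumes k: "p + 2 \<le> k" and b: "Ck_real k b" "bounded_support R b" "\<And>t. b t \<ge> 0"
    and nz: "profile_pairing k b \<noteq> 0"
  shows "\<exists>a R. Ck_real k a \<and> bounded_support R a \<and> (\<forall>t. a t \<ge> 0) \<and> profile_pairing k a > 0"
    and "\<exists>a R. Ck_real k a \<and> bounded_support R a \<and> (\<forall>t. a t \<ge> 0) \<and> profile_pairing k a < 0"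
proof -
  obtain C where C: "0 \<le> C" "\<And>t. \<bar>b t\<bar> \<le> C * indicator {-R..R} t" using bounded_support_bounded[OF b(1,2)] by blast
  \<comment> \<open>With this S, \<open>S\<^sup>2 - t\<^sup>2\<close> is at least 1 for |t| \<le>
    \<open>max R 0\<close>, so w is at least C there and dominates every rescaled copy of b with N
    \<ge> 1.\<close>
  define S where "S = max R 0 + 1"
  define w where "w t = C * max 0 (S ^ 2 - t * t) ^ Suc k" for t
  have w: "Ck_real k w"
    unfolding w_def by (intro Ck_real_cmult Ck_real_pos_part_power Ck_real_diff Ck_real_mult Ck_real_const Ck_real_ident)
  have S: "S \<ge> 1" "S > R" by (auto simp: S_def)
  have ws: "bounded_support S w"
    unfolding bounded_support_def
  proof (intro allI impI)
    fix t assume "\<bar>t\<bar> > S"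
    then have "S ^ 2 \<le> \<bar>t\<bar> ^ 2" using S by (intro power_mono) auto
    then show "w t = 0" by (simp add: w_def power2_eq_square max_def)
  qed
  have wC: "w t \<ge> C" if "\<bar>t\<bar> \<le> max R 0" for t
  proof -
    have "\<bar>t\<bar> ^ 2 \<le> (max R 0) ^ 2" using that by (intro power_mono) auto
    then have "S ^ 2 - t * t \<ge> 1" by (simp add: S_def power2_eq_square algebra_simps)
    then have "1 \<le> max 0 (S ^ 2 - t * t)" by simp
    then have "1 \<le> max 0 (S ^ 2 - t * t) ^ Suc k" by (rule one_le_power)
    then show ?thesis using C(1) mult_left_mono[of 1 _ C] by (simp add: w_def)
  qed
  have w0: "w t \<ge> 0" for t using C(1) by (simp add: w_def)
  \<comment> \<open>N is larger than the ratio of the two pairings. As k - 1 - p \<ge> 1, the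
    scaling factor is at least N, so the narrow copy outweighs w in d.\<close>
  define N where "N = 1 + \<bar>profile_pairing k w\<bar> / \<bar>profile_pairing k b\<bar>"
  have N: "N \<ge> 1" by (simp add: N_def)
  define d where "d t = w t - b (N * t)" for t
  have bN: "Ck_real k (\<lambda>t. b (N * t))" using Ck_real_affine[OF b(1), of N 0] by simp
  have NR: "\<bar>N * t\<bar> > R" if "\<bar>t\<bar> > R" for t
  proof -
    have "1 * \<bar>t\<bar> \<le> N * \<bar>t\<bar>" using N by (intro mult_right_mono) auto
    then show ?thesis using that N by (simp add: abs_mult)
  qed
  have bNs: "bounded_support R (\<lambda>t. b (N * t))" using b(2) NR by (auto simp: bounded_support_def)
  have d: "Ck_real k d" unfolding d_def by (intro Ck_real_diff w bN)
  have ds: "bounded_support S d" using ws bNs S by (auto simp: bounded_support_def d_def)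
  have d0: "d t \<ge> 0" for t
  proof (cases "\<bar>t\<bar> \<le> R")
    case True
    have "b (N * t) \<le> C" using C(2)[of "N * t"] C(1) by (cases "N * t \<in> {-R..R}") auto
    also have "\<dots> \<le> w t" using True by (intro wC) auto
    finally show ?thesis by (simp add: d_def)
  next
    case False
    then have "b (N * t) = 0" using bNs by (simp add: bounded_support_def)
    then show ?thesis using w0 by (simp add: d_def)
  qed
  have "(deriv ^^ k) d = (\<lambda>t. (deriv ^^ k) w t + (- 1) * (deriv ^^ k) (\<lambda>t. b (N * t)) t)"
    using deriv_iter_add[OF w Ck_real_cmult[OF bN, of "-1"]] deriv_iter_cmult[OF bN, of "-1"] by (simp add: d_def[abs_def])
  then have "profile_pairing k d = (\<integral>t. \<phi> t * (deriv ^^ k) w t - \<phi> t * (deriv ^^ k) (\<lambda>t. b (N * t)) t \<partial>lborel)"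
    unfolding profile_pairing_def by (simp add: algebra_simps)
  also have "\<dots> = profile_pairing k w - profile_pairing k (\<lambda>t. b (N * t))"
    unfolding profile_pairing_def
    by (rule Bochner_Integration.integral_diff[OF integrable_profile_pairing[OF w ws] integrable_profile_pairing[OF bN bNs]])
  also have "profile_pairing k (\<lambda>t. b (N * t)) = N ^ (k - 1 - p) * profile_pairing k b"
    by (rule profile_pairing_scale) (use k N b in auto)
  finally have pd: "profile_pairing k d = profile_pairing k w - N ^ (k - 1 - p) * profile_pairing k b" .
  have "\<bar>profile_pairing k w\<bar> < N * \<bar>profile_pairing k b\<bar>"
  proof -
    have "N * \<bar>profile_pairing k b\<bar> = \<bar>profile_pairing k b\<bar> + \<bar>profile_pairing k w\<bar>"
      using nz by (simp add: N_def distrib_right)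
    then show ?thesis using nz by simp
  qed
  also have "N \<le> N ^ (k - 1 - p)" using N k self_le_power[of N "k - 1 - p"] by simp
  then have "N * \<bar>profile_pairing k b\<bar> \<le> N ^ (k - 1 - p) * \<bar>profile_pairing k b\<bar>" by (intro mult_right_mono) auto
  finally have lt: "\<bar>profile_pairing k w\<bar> < N ^ (k - 1 - p) * \<bar>profile_pairing k b\<bar>" .
  show "\<exists>a R. Ck_real k a \<and> bounded_support R a \<and> (\<forall>t. a t \<ge> 0) \<and> profile_pairing k a > 0"
  proof (cases "profile_pairing k b > 0")
    case False
    then have "profile_pairing k d > 0" using lt pd nz by (simp add: abs_if split: if_splits)
    then show ?thesis using d ds d0 by blast
  qed (use b in blast)
  show "\<exists>a R. Ck_real k a \<and> bounded_support R a \<and> (\<forall>t. a t \<ge> 0) \<and> profile_pairing k a < 0"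
  proof (cases "profile_pairing k b < 0")
    case False
    then have "profile_pairing k d < 0" using lt pd nz by (simp add: abs_if split: if_splits)
    then show ?thesis using d ds d0 by blast
  qed (use b in blast)
qed

end

declare Ck_off0.simps(2) [simp del]

section \<open>Test functions\<close>

lemma exists_other_index:
  fixes i :: "'n::finite"
  assumes "CARD('n) \<ge> 2"
  shows "\<exists>j. j \<noteq> i"
proof (rule ccontr)
  assume "\<not> ?thesis"
  then have "(UNIV :: 'n set) = {i}" by auto
  then have "CARD('n) = card {i}" by (rule arg_cong)
  then show False using assms by simp
qed

text \<open>The condition bounds the distance from the axis i0 from both sides. The positive inner
  radius makes the product with any function of the axis coordinate vanish near the origin; a
  bounded support of that function then gives annular support.\<close>

definition cylindrical_support :: "'n \<Rightarrow> (real^'n::finite \<Rightarrow> real) \<Rightarrow> bool" where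
  "cylindrical_support i0 B \<longleftrightarrow>
     (\<exists>r R. 0 < r \<and> (\<forall>z. norm (z - (z $ i0) *\<^sub>R axis i0 1) < r \<or> norm (z - (z $ i0) *\<^sub>R axis i0 1) > R \<longrightarrow> B z = 0))"

lemma cylindrical_support_partial_deriv:
  assumes "cylindrical_support i0 B"
  shows "cylindrical_support i0 (partial_deriv i B)"
proof -
  let ?n = "\<lambda>z::real^'a. norm (z - (z $ i0) *\<^sub>R axis i0 1)"
  obtain r R where r: "0 < r" "\<And>z. ?n z < r \<or> ?n z > R \<Longrightarrow> B z = 0"
    using assms unfolding cylindrical_support_def by metis
  have "partial_deriv i B z = 0" if "?n z < r \<or> ?n z > R" for z
  proof -
    have op: "open {z. ?n z < r \<or> ?n z > R}"
      by (intro open_Collect_disj open_Collect_less continuous_intros)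
    have "((\<lambda>_::real^'a. 0::real) has_derivative (\<lambda>_. 0)) (at z)" by simp
    then have "(B has_derivative (\<lambda>_. 0)) (at z)"
      by (rule has_derivative_transform_within_open[OF _ op]) (use that r in auto)
    from partial_deriv_eqI[OF this] show ?thesis .
  qed
  then show ?thesis unfolding cylindrical_support_def using r(1) by blast
qed

lemma cylindrical_support_sum:
  fixes u :: "'b \<Rightarrow> real^'n::finite \<Rightarrow> real"
  assumes "finite A" "\<And>a. a \<in> A \<Longrightarrow> cylindrical_support i0 (u a)"
  shows "cylindrical_support i0 (\<lambda>z. \<Sum>a\<in>A. u a z)"
  using assms
proof (induction A rule: finite_induct)
  case empty
  show ?case unfolding cylindrical_support_def by (intro exI[of _ 1]) auto
next
  case (insert a A)
  let ?n = "\<lambda>z. norm (z - (z $ i0) *\<^sub>R axis i0 1)"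
  obtain r R r' R' where "0 < r" "\<And>z. ?n z < r \<or> ?n z > R \<Longrightarrow> u a z = 0"
    "0 < r'" "\<And>z. ?n z < r' \<or> ?n z > R' \<Longrightarrow> (\<Sum>a\<in>A. u a z) = 0"
    using insert unfolding cylindrical_support_def by (metis insertI1 insertI2)
  then show ?case unfolding cylindrical_support_def
    using insert.hyps by (intro exI[of _ "min r r'"] exI[of _ "max R R'"]) auto
qed

lemma annular_support_cylindrical:
  fixes B :: "real^'n::finite \<Rightarrow> real"
  assumes a: "bounded_support S a" and B: "cylindrical_support i0 B"
  shows "annular_support (\<lambda>z. a (z $ i0) * B z)"
proof -
  let ?p = "\<lambda>z::real^'n. z - (z $ i0) *\<^sub>R axis i0 1"
  obtain r R where r: "0 < r" "\<And>z. norm (?p z) < r \<or> norm (?p z) > R \<Longrightarrow> B z = 0"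
    using B unfolding cylindrical_support_def by metis
  have le: "norm z \<le> norm (?p z) + \<bar>z $ i0\<bar>" for z
    using norm_triangle_ineq[of "?p z" "(z $ i0) *\<^sub>R axis i0 1"] by simp
  have "norm (?p z) ^ 2 \<le> norm z ^ 2" for z
    by (simp add: power2_norm_eq_inner inner_simps inner_axis inner_axis')
  then have le': "norm (?p z) \<le> norm z" for z using power2_le_imp_le norm_ge_zero by blast
  have "a (z $ i0) * B z = 0" if "norm z < r \<or> norm z > R + S" for z
  proof (cases "\<bar>z $ i0\<bar> > S")
    case False
    have "norm (?p z) < r \<or> norm (?p z) > R" using that le[of z] le'[of z] False by linarith
    then show ?thesis using r by simp
  qed (use a in \<open>simp add: bounded_support_def\<close>)
  then show ?thesis unfolding annular_support_def using r(1) by blast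
qed

lemma partial_deriv_invariant:
  assumes "\<And>z. B (z + c) = B z"
  shows "partial_deriv i B (z + c) = partial_deriv i B z"
proof -
  have "B (z + c + t *\<^sub>R axis i 1) = B (z + t *\<^sub>R axis i 1)" for t
    using assms[of "z + t *\<^sub>R axis i 1"] by (simp add: add_ac)
  then show ?thesis by (simp add: partial_deriv_def)
qed

lemma partial_deriv_cylinder_mult:
  fixes B :: "real^'n::finite \<Rightarrow> real"
  assumes a: "Ck_real (Suc k) a" and B: "Ck_off0 (Suc l) B" and inv: "\<And>z t. B (z + t *\<^sub>R axis i0 1) = B z" and z: "z \<noteq> 0"
  shows "partial_deriv i (\<lambda>z. a (z $ i0) * B z) z = (if i = i0 then deriv a (z $ i0) * B z else a (z $ i0) * partial_deriv i B z)"
proof -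
  have "partial_deriv i0 B z = 0" unfolding partial_deriv_def by (simp add: inv)
  then show ?thesis
    using partial_deriv_mult[OF Ck_off0_Ck_real[OF a] B z, of i i0] by (auto simp: partial_deriv_Ck_real[OF a])
qed

text \<open>The first factor varies only along the axis and B only across it, so no mixed terms
  arise.\<close>

lemma laplacian_cylinder_mult:
  fixes B :: "real^'n::finite \<Rightarrow> real"
  assumes a: "Ck_real (Suc (Suc k)) a" and B: "Ck_off0 (Suc (Suc k)) B" and inv: "\<And>z t. B (z + t *\<^sub>R axis i0 1) = B z" and z: "z \<noteq> 0"
  shows "laplacian (\<lambda>z. a (z $ i0) * B z) z = deriv (deriv a) (z $ i0) * B z + a (z $ i0) * laplacian B z"
proof -
  have pinv: "partial_deriv i B (z + t *\<^sub>R axis i0 1) = partial_deriv i B z" for i z t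
    by (rule partial_deriv_invariant) (rule inv)
  have B00: "partial_deriv i0 (partial_deriv i0 B) z = 0" for z
    unfolding partial_deriv_def[of _ "partial_deriv i0 B"] by (simp add: pinv)
  have *: "partial_deriv i (partial_deriv i (\<lambda>z. a (z $ i0) * B z)) z = 
     (if i = i0 then deriv (deriv a) (z $ i0) * B z else 0) + a (z $ i0) * partial_deriv i (partial_deriv i B) z" for i
  proof (cases "i = i0")
    case True
    have "partial_deriv i (partial_deriv i (\<lambda>z. a (z $ i0) * B z)) z = partial_deriv i (\<lambda>z. deriv a (z $ i0) * B z) z"
      by (rule partial_deriv_cong[OF _ z]) (use partial_deriv_cylinder_mult[OF a B inv] True in auto)
    then show ?thesis
      using partial_deriv_cylinder_mult[OF Ck_real_Suc_deriv(1)[OF a] B inv z, of i] True B00 by simp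
  next
    case False
    have "partial_deriv i (partial_deriv i (\<lambda>z. a (z $ i0) * B z)) z = partial_deriv i (\<lambda>z. a (z $ i0) * partial_deriv i B z) z"
      by (rule partial_deriv_cong[OF _ z]) (use partial_deriv_cylinder_mult[OF a B inv] False in auto)
    then show ?thesis
      using partial_deriv_cylinder_mult[OF a Ck_off0_partial_deriv[OF B] pinv z, of i i] False by simp
  qed
  show ?thesis unfolding laplacian_def * by (simp add: sum.distrib sum_distrib_left)
qed

text \<open>\<open>lborel\<close> is the image of a product measure under the coordinates, so the
  integral of a product of one-variable functions factors.\<close>

lemma integral_lborel_prod_coordinates:
  fixes f :: "'a::euclidean_space \<Rightarrow> real \<Rightarrow> real"
  assumes "\<And>b. b \<in> Basis \<Longrightarrow> integrable lborel (f b)"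
  shows "(\<integral>z. (\<Prod>b\<in>Basis. f b (z \<bullet> b)) \<partial>lborel) = (\<Prod>b\<in>Basis. \<integral>t. f b t \<partial>lborel)"
proof -
  interpret product_sigma_finite "\<lambda>_::'a. lborel :: real measure" ..
  have [measurable]: "f b \<in> borel_measurable borel" if "b \<in> Basis" for b using assms[OF that] by simp
  have "(\<integral>z. (\<Prod>b\<in>Basis. f b (z \<bullet> b)) \<partial>lborel) = 
     (\<integral>x. (\<Prod>b\<in>Basis. f b ((\<Sum>c\<in>Basis. x c *\<^sub>R c) \<bullet> b)) \<partial>(\<Pi>\<^sub>M b\<in>Basis. lborel))"
    unfolding lborel_eq[where 'a='a] by (rule integral_distr) measurable
  also have "\<dots> = (\<integral>x. (\<Prod>b\<in>Basis. f b (x b)) \<partial>(\<Pi>\<^sub>M b\<in>Basis. lborel))"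
    by (intro Bochner_Integration.integral_cong refl prod.cong) (simp add: inner_sum_left inner_Basis if_distrib cong: if_cong)
  also have "\<dots> = (\<Prod>b\<in>Basis. \<integral>t. f b t \<partial>lborel)"
    by (rule product_integral_prod) (use assms in auto)
  finally show ?thesis .
qed

context kernel_profile
begin

text \<open>Each negative Laplacian either differentiates a twice or falls on B. Whatever falls on B
  integrates to zero, because the weight depends on the axis coordinate alone. The induction
  generalises over a and B since one step yields the pairs a', B and a1,
  \<open>laplacian B\<close>.\<close>

lemma dual_transform_cylinder:
  fixes B :: "real^'n::finite \<Rightarrow> real" and i0 :: 'n
  assumes "Ck_real (2 * k) a" "bounded_support S a" "Ck_off0 (2 * k) B"
    and "\<And>z t. B (z + t *\<^sub>R axis i0 1) = B z" "cylindrical_support i0 B"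
  shows "(\<integral>z. \<phi> (z $ i0) * neg_laplacian_iter k (\<lambda>z. a (z $ i0) * B z) z \<partial>lborel)
    = (- 1) ^ k * (\<integral>z. \<phi> (z $ i0) * ((deriv ^^ (2 * k)) a (z $ i0) * B z) \<partial>lborel)"
  using assms
proof (induction k arbitrary: a B)
  case (Suc k)
  have a: "Ck_real (Suc (Suc (2 * k))) a" and B: "Ck_off0 (Suc (Suc (2 * k))) B" using Suc.prems(1,3) by simp_all
  note inv = Suc.prems(4)
  \<comment> \<open>Both a' and a1 absorb the minus sign of the negative Laplacian; the k + 1 signs
    of a' make up the factor in the claim.\<close>
  define a' where "a' t = - 1 * deriv (deriv a) t" for t
  define a1 where "a1 t = - 1 * a t" for t
  have w: "integrable lborel (\<lambda>z::real^'n. \<phi> (z $ i0) * indicator (cball 0 R) z)" for R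
    using integrable_profile_cball[of "axis i0 1 :: real^'n" R] by (simp add: inner_axis norm_axis_1)
  have wm: "(\<lambda>z::real^'n. \<phi> (z $ i0)) \<in> borel_measurable borel"
    by (rule measurable_compose[OF _ profile_measurable]) (auto intro!: borel_measurable_continuous_onI continuous_intros)
  have a': "Ck_real (2 * k) a'" "bounded_support S a'"
  proof -
    show "Ck_real (2 * k) a'" unfolding a'_def by (intro Ck_real_cmult Ck_real_Suc_deriv(1) a)
    have "bounded_support S (deriv (deriv a))" by (intro bounded_support_deriv Suc.prems(2))
    then show "bounded_support S a'" by (simp add: bounded_support_def a'_def)
  qed
  have a1: "Ck_real (Suc (Suc (2 * k))) a1" "bounded_support S a1"
    using Ck_real_cmult[OF a, of "-1"] Suc.prems(2) by (auto simp: bounded_support_def a1_def[abs_def])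
  have a1': "Ck_real (2 * k) a1" by (rule Ck_real_mono[OF a1(1)]) simp
  have B': "Ck_off0 (2 * k) B" by (rule Ck_off0_mono[OF B]) simp
  have LB: "Ck_off0 (2 * k) (laplacian B)" by (rule Ck_off0_laplacian[OF B])
  have pinv: "partial_deriv i B (z + t *\<^sub>R axis i0 1) = partial_deriv i B z" for i z t
    by (rule partial_deriv_invariant) (rule inv)
  have ppinv: "partial_deriv i (partial_deriv i B) (z + t *\<^sub>R axis i0 1) = partial_deriv i (partial_deriv i B) z" for i z t
    by (rule partial_deriv_invariant) (rule pinv)
  have Linv: "laplacian B (z + t *\<^sub>R axis i0 1) = laplacian B z" for z t unfolding laplacian_def by (simp add: ppinv)
  have LS: "cylindrical_support i0 (laplacian B)"
    unfolding laplacian_def[abs_def] by (intro cylindrical_support_sum cylindrical_support_partial_deriv Suc.prems(5)) simp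
  have B00: "partial_deriv i0 (partial_deriv i0 B) z = 0" for z
    unfolding partial_deriv_def[of _ "partial_deriv i0 B"] by (simp add: pinv)
  define c where "c = (deriv ^^ (2 * k)) a1"
  have c: "Ck_real 2 c" "bounded_support S c"
  proof -
    show "Ck_real 2 c" unfolding c_def by (rule Ck_real_deriv_iter) (use a1(1) in simp)
    show "bounded_support S c" unfolding c_def by (rule bounded_support_deriv_iter[OF a1(2)])
  qed
  have c1: "Ck_real (Suc 0) c" by (rule Ck_real_mono[OF c(1)]) simp
  have B1: "Ck_off0 (Suc (Suc 0)) B" by (rule Ck_off0_mono[OF B]) simp
  \<comment> \<open>For i \<noteq> i0 the integrand is the weight times an i-th partial derivative,
    and the weight is invariant in direction i. For i = i0 the second derivative of B vanishes
    identically.\<close>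
  have zero: "(\<integral>z. \<phi> (z $ i0) * (c (z $ i0) * partial_deriv i (partial_deriv i B) z) \<partial>lborel) = 0"
    and izero: "integrable lborel (\<lambda>z. \<phi> (z $ i0) * (c (z $ i0) * partial_deriv i (partial_deriv i B) z))" for i
  proof -
    note pB = Ck_off0_partial_deriv[OF B1, of i]
    show "integrable lborel (\<lambda>z. \<phi> (z $ i0) * (c (z $ i0) * partial_deriv i (partial_deriv i B) z))"
      by (rule integrable_weight_annular_support[OF w wm Ck_off0_mult[OF Ck_off0_Ck_real[OF Ck_real_mono[OF c1]] Ck_off0_partial_deriv[OF pB]]])
         (auto intro!: annular_support_cylindrical[OF c(2)] cylindrical_support_partial_deriv Suc.prems(5))
    show "(\<integral>z. \<phi> (z $ i0) * (c (z $ i0) * partial_deriv i (partial_deriv i B) z) \<partial>lborel) = 0"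
    proof (cases "i = i0")
      case False
      have F: "Ck_off0 (Suc 0) (\<lambda>z. c (z $ i0) * partial_deriv i B z)" by (intro Ck_off0_mult Ck_off0_Ck_real c1 pB)
      have Fs: "annular_support (\<lambda>z. c (z $ i0) * partial_deriv i B z)"
        by (intro annular_support_cylindrical[OF c(2)] cylindrical_support_partial_deriv Suc.prems(5))
      have ae: "AE z in lborel. partial_deriv i (\<lambda>z. c (z $ i0) * partial_deriv i B z) z = c (z $ i0) * partial_deriv i (partial_deriv i B) z"
        using AE_lborel_singleton[of 0] by eventually_elim (use partial_deriv_cylinder_mult[OF c1 pB pinv] False in auto)
      have m1: "partial_deriv i (\<lambda>z. c (z $ i0) * partial_deriv i B z) \<in> borel_measurable borel"
        by (rule Ck_off0_borel_measurable[OF Ck_off0_partial_deriv[OF F]])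
      have m2: "(\<lambda>z. c (z $ i0) * partial_deriv i (partial_deriv i B) z) \<in> borel_measurable borel"
        by (rule Ck_off0_borel_measurable[OF Ck_off0_mult[OF Ck_off0_Ck_real[OF Ck_real_mono[OF c1]] Ck_off0_partial_deriv[OF pB]]]) simp
      have "(\<integral>z. \<phi> (z $ i0) * partial_deriv i (\<lambda>z. c (z $ i0) * partial_deriv i B z) z \<partial>lborel) = 0"
        by (rule integral_weight_partial_deriv_eq_0[OF w wm _ F Fs]) (use False in \<open>simp add: axis_def\<close>)
      moreover have "(\<integral>z. \<phi> (z $ i0) * partial_deriv i (\<lambda>z. c (z $ i0) * partial_deriv i B z) z \<partial>lborel)
          = (\<integral>z. \<phi> (z $ i0) * (c (z $ i0) * partial_deriv i (partial_deriv i B) z) \<partial>lborel)"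
        by (rule integral_cong_AE) (use ae m1 m2 wm in \<open>auto elim!: eventually_mono\<close>)
      ultimately show ?thesis by simp
    qed (simp add: B00)
  qed
  have N: "neg_laplacian_iter (Suc k) (\<lambda>z. a (z $ i0) * B z) z
     = neg_laplacian_iter k (\<lambda>z. a' (z $ i0) * B z) z + neg_laplacian_iter k (\<lambda>z. a1 (z $ i0) * laplacian B z) z" if z: "z \<noteq> 0" for z
  proof -
    have "neg_laplacian_iter (Suc k) (\<lambda>z. a (z $ i0) * B z) z
        = neg_laplacian_iter k (\<lambda>z. a' (z $ i0) * B z + a1 (z $ i0) * laplacian B z) z"
      unfolding neg_laplacian_iter_Suc'
      by (rule neg_laplacian_iter_cong[OF _ z]) (simp add: laplacian_cylinder_mult[OF a B inv] a'_def a1_def)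
    also have "\<dots> = neg_laplacian_iter k (\<lambda>z. a' (z $ i0) * B z) z + neg_laplacian_iter k (\<lambda>z. a1 (z $ i0) * laplacian B z) z"
      by (intro neg_laplacian_iter_add Ck_off0_mult Ck_off0_Ck_real a' a1' B' LB z)
    finally show ?thesis .
  qed
  have i: "integrable lborel (\<lambda>z. \<phi> (z $ i0) * neg_laplacian_iter k u z)"
    if "Ck_off0 (2 * k) u" "annular_support u" for u :: "real^'n \<Rightarrow> real"
    by (rule integrable_weight_annular_support[OF w wm Ck_off0_neg_laplacian_iter[of k 0] annular_support_neg_laplacian_iter[OF that(2)]])
       (use that(1) in simp)
  note i1 = i[OF Ck_off0_mult[OF Ck_off0_Ck_real[OF a'(1)] B'] annular_support_cylindrical[OF a'(2) Suc.prems(5)]]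
  note i2 = i[OF Ck_off0_mult[OF Ck_off0_Ck_real[OF a1'] LB] annular_support_cylindrical[OF a1(2) LS]]
  have uc: "Ck_off0 (2 * Suc k) (\<lambda>z. a (z $ i0) * B z)" by (intro Ck_off0_mult Ck_off0_Ck_real Suc.prems)
  have um: "neg_laplacian_iter (Suc k) (\<lambda>z. a (z $ i0) * B z) \<in> borel_measurable borel"
    by (rule Ck_off0_borel_measurable[OF Ck_off0_neg_laplacian_iter[of "Suc k" 0]]) (use uc in simp)
  have "(\<integral>z. \<phi> (z $ i0) * neg_laplacian_iter (Suc k) (\<lambda>z. a (z $ i0) * B z) z \<partial>lborel)
     = (\<integral>z. \<phi> (z $ i0) * neg_laplacian_iter k (\<lambda>z. a' (z $ i0) * B z) z
          + \<phi> (z $ i0) * neg_laplacian_iter k (\<lambda>z. a1 (z $ i0) * laplacian B z) z \<partial>lborel)"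
  proof (rule integral_cong_AE)
    show "AE z in lborel. \<phi> (z $ i0) * neg_laplacian_iter (Suc k) (\<lambda>z. a (z $ i0) * B z) z
     = \<phi> (z $ i0) * neg_laplacian_iter k (\<lambda>z. a' (z $ i0) * B z) z
          + \<phi> (z $ i0) * neg_laplacian_iter k (\<lambda>z. a1 (z $ i0) * laplacian B z) z"
      using AE_lborel_singleton[of 0]
    proof eventually_elim
      case (elim z)
      show ?case unfolding N[OF elim] by (simp only: distrib_left)
    qed
  qed (use um wm i1 i2 in auto)
  also have "\<dots> = (\<integral>z. \<phi> (z $ i0) * neg_laplacian_iter k (\<lambda>z. a' (z $ i0) * B z) z \<partial>lborel)
          + (\<integral>z. \<phi> (z $ i0) * neg_laplacian_iter k (\<lambda>z. a1 (z $ i0) * laplacian B z) z \<partial>lborel)"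
    by (rule Bochner_Integration.integral_add[OF i1 i2])
  also have "(\<integral>z. \<phi> (z $ i0) * neg_laplacian_iter k (\<lambda>z. a1 (z $ i0) * laplacian B z) z \<partial>lborel)
      = (- 1) ^ k * (\<integral>z. \<phi> (z $ i0) * (c (z $ i0) * laplacian B z) \<partial>lborel)"
    unfolding c_def by (rule Suc.IH[OF a1' a1(2) LB Linv LS])
  also have "(\<integral>z. \<phi> (z $ i0) * (c (z $ i0) * laplacian B z) \<partial>lborel)
      = (\<integral>z. (\<Sum>i\<in>UNIV. \<phi> (z $ i0) * (c (z $ i0) * partial_deriv i (partial_deriv i B) z)) \<partial>lborel)"
    by (simp add: laplacian_def sum_distrib_left)
  also have "\<dots> = 0" using izero zero by simp
  also have "(\<integral>z. \<phi> (z $ i0) * neg_laplacian_iter k (\<lambda>z. a' (z $ i0) * B z) z \<partial>lborel)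
      = (- 1) ^ k * (\<integral>z. \<phi> (z $ i0) * ((deriv ^^ (2 * k)) a' (z $ i0) * B z) \<partial>lborel)"
    by (rule Suc.IH[OF a' B' inv Suc.prems(5)])
  also have "(deriv ^^ (2 * k)) a' = (\<lambda>t. - 1 * (deriv ^^ (2 * Suc k)) a t)"
  proof -
    have "Ck_real (2 * k) (deriv (deriv a))" by (intro Ck_real_Suc_deriv(1) a)
    from deriv_iter_cmult[OF this, of "-1"] show ?thesis
      by (simp add: a'_def[abs_def] funpow_swap1)
  qed
  finally show ?case by simp
qed simp

end

section \<open>Explicit bumps and their integrals\<close>

lemma integral_pos_if_ge_indicator:
  fixes \<beta> :: "real \<Rightarrow> real"
  assumes "integrable lborel \<beta>" "c > 0" "u < v" "\<And>t. c * indicator {u..v} t \<le> \<beta> t"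
  shows "(\<integral>t. \<beta> t \<partial>lborel) > 0"
proof -
  have i: "integrable lborel (\<lambda>t. c * indicator {u..v} t :: real)"
    using assms by (simp add: integrable_indicator_iff emeasure_lborel_Icc_eq)
  have "0 < c * (v - u)" using assms by simp
  also have "\<dots> = (\<integral>t. c * indicator {u..v} t \<partial>lborel)" using assms by simp
  also have "\<dots> \<le> (\<integral>t. \<beta> t \<partial>lborel)" by (rule integral_mono[OF i assms(1,4)])
  finally show ?thesis .
qed

text \<open>Supported in [1, 2]: products over the transverse coordinates keep away from the axis,
  and the logarithm and the powers of 1/t are smooth on the support.\<close>

definition unit_bump :: "nat \<Rightarrow> real \<Rightarrow> real" where
  "unit_bump k t = max 0 ((t - 1) * (2 - t)) ^ Suc k"

lemma Ck_real_unit_bump: "Ck_real k (unit_bump k)"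
  unfolding unit_bump_def[abs_def]
  by (intro Ck_real_pos_part_power Ck_real_mult Ck_real_diff Ck_real_ident Ck_real_const)

lemma unit_bump_nonneg: "unit_bump k t \<ge> 0"
  by (simp add: unit_bump_def)

lemma unit_bump_eq_0: "t \<notin> {1..2} \<Longrightarrow> unit_bump k t = 0"
proof -
  assume t: "t \<notin> {1..2}"
  have "(t - 1) * (2 - t) \<le> 0"
  proof (cases "t < 1")
    case True
    then show ?thesis by (intro mult_nonpos_nonneg) auto
  next
    case False
    then show ?thesis using t by (intro mult_nonneg_nonpos) auto
  qed
  then show ?thesis by (simp add: unit_bump_def max_def)
qed

lemma bounded_support_unit_bump: "bounded_support 2 (unit_bump k)"
  unfolding bounded_support_def by (auto intro!: unit_bump_eq_0)

lemma unit_bump_ge: "(3/16) ^ Suc k * indicator {5/4..7/4} t \<le> unit_bump k t"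
proof (cases "t \<in> {5/4..7/4}")
  case True
  then have "(1/4 :: real) * (3/4) \<le> (t - 1) * (2 - t)"
  proof -
    \<comment> \<open>This product is \<open>(t - 1) (2 - t)\<close> minus 3/16, the value of the
      latter at both end points 5/4 and 7/4.\<close>
    have "(t - 5/4) * (7/4 - t) \<ge> 0" using True by simp
    then show ?thesis by (simp add: algebra_simps)
  qed
  then have "3/16 \<le> max 0 ((t - 1) * (2 - t))" by simp
  then have "(3/16) ^ Suc k \<le> unit_bump k t" unfolding unit_bump_def by (intro power_mono) auto
  then show ?thesis using True by simp
qed (simp add: unit_bump_nonneg)

lemma integrable_unit_bump: "integrable lborel (unit_bump k)"
  by (rule integrable_bounded_support[OF Ck_real_unit_bump bounded_support_unit_bump])

lemma integral_unit_bump_pos: "(\<integral>t. unit_bump k t \<partial>lborel) > 0"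
  by (rule integral_pos_if_ge_indicator[OF integrable_unit_bump _ _ unit_bump_ge]) auto

definition cylinder_bump :: "nat \<Rightarrow> 'n \<Rightarrow> real^'n::finite \<Rightarrow> real" where
  "cylinder_bump k i0 z = (\<Prod>b\<in>Basis - {axis i0 1}. unit_bump k (z \<bullet> b))"

lemma cylinder_bump_nonneg: "cylinder_bump k i0 z \<ge> 0"
  unfolding cylinder_bump_def by (intro prod_nonneg) (simp add: unit_bump_nonneg)

lemma Ck_off0_cylinder_bump: "Ck_off0 k (cylinder_bump k i0)"
  unfolding cylinder_bump_def[abs_def]
proof (rule Ck_off0_prod)
  fix b :: "real^'a" assume "b \<in> Basis - {axis i0 1}"
  then obtain i where "b = axis i 1" by (auto simp: Basis_vec_def)
  then show "Ck_off0 k (\<lambda>z. unit_bump k (z \<bullet> b))"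
    using Ck_off0_Ck_real[OF Ck_real_unit_bump] by (simp add: inner_axis)
qed

lemma cylinder_bump_invariant: "cylinder_bump k i0 (z + t *\<^sub>R axis i0 1) = cylinder_bump k i0 z"
  unfolding cylinder_bump_def
proof (intro prod.cong refl)
  have e: "axis i0 1 \<in> (Basis :: (real^'a) set)" by (simp add: axis_in_Basis_iff)
  fix b :: "real^'a" assume "b \<in> Basis - {axis i0 1}"
  then have "axis i0 1 \<bullet> b = 0" using inner_Basis[OF e, of b] by auto
  then show "unit_bump k ((z + t *\<^sub>R axis i0 1) \<bullet> b) = unit_bump k (z \<bullet> b)" by (simp add: inner_add_left)
qed

text \<open>In dimension at least two some coordinate differs from i0, and it is at least 1 on the
  support, which gives the inner radius 1. The outer radius is the bound by the sum of the absolute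
  coordinates, each at most 2.\<close>

lemma cylindrical_support_cylinder_bump:
  assumes "CARD('n::finite) \<ge> 2"
  shows "cylindrical_support i0 (cylinder_bump k i0 :: real^'n \<Rightarrow> real)"
proof -
  have "\<exists>j::'n. j \<noteq> i0" by (rule exists_other_index[OF assms])
  then obtain j where j: "j \<noteq> i0" by blast
  let ?p = "\<lambda>z::real^'n. z - (z $ i0) *\<^sub>R axis i0 1"
  have main: "cylinder_bump k i0 z = 0" if z: "norm (?p z) < 1 \<or> norm (?p z) > 2 * CARD('n)" for z
  proof (rule ccontr)
    assume "cylinder_bump k i0 z \<noteq> 0"
    then have nz: "unit_bump k (z \<bullet> b) \<noteq> 0" if "b \<in> Basis - {axis i0 1}" for b
      using that unfolding cylinder_bump_def by (auto simp: prod_zero_iff)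
    have ran: "z $ i \<in> {1..2}" if "i \<noteq> i0" for i
      using nz[of "axis i 1"] unit_bump_eq_0[of "z $ i" k] that
      by (auto simp: inner_axis axis_in_Basis_iff axis_eq_axis)
    have pz: "?p z $ i = (if i = i0 then 0 else z $ i)" for i by (simp add: axis_def)
    have "\<bar>?p z $ j\<bar> \<le> norm (?p z)" by (rule component_le_norm_cart)
    moreover have "?p z $ j = z $ j" using pz[of j] j by simp
    ultimately have "norm (?p z) \<ge> 1" using ran[OF j] by auto
    moreover have "norm (?p z) \<le> (\<Sum>i\<in>UNIV. \<bar>?p z $ i\<bar>)" by (rule norm_le_l1_cart)
    moreover have "(\<Sum>i\<in>UNIV. \<bar>?p z $ i\<bar>) \<le> (\<Sum>i\<in>(UNIV::'n set). 2)"
    proof (rule sum_mono)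
      fix i show "\<bar>?p z $ i\<bar> \<le> 2" unfolding pz using ran[of i] by auto
    qed
    ultimately show False using z by simp
  qed
  show ?thesis unfolding cylindrical_support_def
    by (rule exI[of _ 1], rule exI[of _ "real (2 * CARD('n))"]) (use main in auto)
qed

lemma integral_cylinder_bump:
  fixes i0 :: "'n::finite"
  assumes H: "integrable lborel H"
  shows "(\<integral>z. H (z $ i0) * cylinder_bump k i0 z \<partial>lborel)
    = (\<integral>t. H t \<partial>lborel) * (\<integral>t. unit_bump k t \<partial>lborel) ^ (CARD('n) - 1)"
proof -
  let ?e = "axis i0 1 :: real^'n"
  let ?f = "\<lambda>b. if b = ?e then H else unit_bump k"
  have e: "?e \<in> Basis" by (simp add: axis_in_Basis_iff)
  have "(\<integral>z. H (z $ i0) * cylinder_bump k i0 z \<partial>lborel) = (\<integral>z. (\<Prod>b\<in>Basis. ?f b (z \<bullet> b)) \<partial>lborel)"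
  proof (intro Bochner_Integration.integral_cong refl)
    fix z :: "real^'n"
    have "(\<Prod>b\<in>Basis. ?f b (z \<bullet> b)) = H (z \<bullet> ?e) * (\<Prod>b\<in>Basis - {?e}. ?f b (z \<bullet> b))"
      by (subst prod.remove[OF _ e]) auto
    also have "(\<Prod>b\<in>Basis - {?e}. ?f b (z \<bullet> b)) = cylinder_bump k i0 z"
      unfolding cylinder_bump_def by (intro prod.cong) auto
    finally show "H (z $ i0) * cylinder_bump k i0 z = (\<Prod>b\<in>Basis. ?f b (z \<bullet> b))" by (simp add: inner_axis)
  qed
  also have "\<dots> = (\<Prod>b\<in>Basis. \<integral>t. ?f b t \<partial>lborel)"
    by (rule integral_lborel_prod_coordinates) (use H integrable_unit_bump in auto)
  also have "\<dots> = (\<integral>t. H t \<partial>lborel) * (\<Prod>b\<in>Basis - {?e}. \<integral>t. ?f b t \<partial>lborel)"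
    by (subst prod.remove[OF _ e]) auto
  also have "(\<Prod>b\<in>Basis - {?e}. \<integral>t. ?f b t \<partial>lborel) = (\<Prod>b\<in>Basis - {?e}. \<integral>t. unit_bump k t \<partial>lborel)"
    by (intro prod.cong) auto
  also have "\<dots> = (\<integral>t. unit_bump k t \<partial>lborel) ^ (CARD('n) - 1)" using e by simp
  finally show ?thesis .
qed

lemma (in kernel_profile) exists_test_functions:
  fixes i0 :: "'n::finite"
  assumes n: "CARD('n) \<ge> 2" and k: "p + 2 \<le> 2 * k"
    and b: "Ck_real (2 * k) b" "bounded_support R b" "\<And>t. b t \<ge> 0" "profile_pairing (2 * k) b \<noteq> 0"
    and s: "s = 1 \<or> s = (- 1 :: real)"
  shows "\<exists>\<psi> :: real^'n \<Rightarrow> real. Ck_off0 (2 * k) \<psi> \<and> annular_support \<psi> \<and> (\<forall>z. \<psi> z \<ge> 0) \<and>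
      s * dual_transform (neg_laplacian_iter k \<psi>) (axis i0 1) > 0"
proof -
  \<comment> \<open>\<open>dual_transform_cylinder\<close> contributes \<open>(-1) ^ k\<close>, so
    the sign demanded of the pairing is s times this factor.\<close>
  have "\<exists>a S. Ck_real (2 * k) a \<and> bounded_support S a \<and> (\<forall>t. a t \<ge> 0) \<and> (s * (- 1) ^ k) * profile_pairing (2 * k) a > 0"
  proof (cases "s * (- 1) ^ k = 1")
    case True
    then show ?thesis using profile_pairing_both_signs(1)[OF k b] by simp
  next
    case False
    then have "s * (- 1) ^ k = - 1" using s by (cases "even k") auto
    then show ?thesis using profile_pairing_both_signs(2)[OF k b] by simp
  qed
  then obtain a S where a: "Ck_real (2 * k) a" "bounded_support S a" "\<And>t. a t \<ge> 0" "(s * (- 1) ^ k) * profile_pairing (2 * k) a > 0"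
    by blast
  define \<psi> :: "real^'n \<Rightarrow> real" where "\<psi> z = a (z $ i0) * cylinder_bump (2 * k) i0 z" for z
  have "dual_transform (neg_laplacian_iter k \<psi>) (axis i0 1)
     = (- 1) ^ k * (\<integral>z. \<phi> (z $ i0) * ((deriv ^^ (2 * k)) a (z $ i0) * cylinder_bump (2 * k) i0 z) \<partial>lborel)"
    unfolding dual_transform_def \<psi>_def[abs_def]
    using dual_transform_cylinder[OF a(1,2) Ck_off0_cylinder_bump cylinder_bump_invariant cylindrical_support_cylinder_bump[OF n]]
    by (simp add: inner_axis)
  also have "(\<integral>z. \<phi> (z $ i0) * ((deriv ^^ (2 * k)) a (z $ i0) * cylinder_bump (2 * k) i0 z) \<partial>lborel)
     = profile_pairing (2 * k) a * (\<integral>t. unit_bump (2 * k) t \<partial>lborel) ^ (CARD('n) - 1)"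
    unfolding profile_pairing_def
    using integral_cylinder_bump[OF integrable_profile_pairing[OF a(1,2)], of i0 "2 * k"] by (simp add: mult.assoc)
  finally have "s * dual_transform (neg_laplacian_iter k \<psi>) (axis i0 1)
     = (s * (- 1) ^ k * profile_pairing (2 * k) a) * (\<integral>t. unit_bump (2 * k) t \<partial>lborel) ^ (CARD('n) - 1)" by simp
  also have "\<dots> > 0" by (rule mult_pos_pos[OF a(4) zero_less_power[OF integral_unit_bump_pos]])
  finally have "s * dual_transform (neg_laplacian_iter k \<psi>) (axis i0 1) > 0" .
  moreover have "Ck_off0 (2 * k) \<psi>" unfolding \<psi>_def by (intro Ck_off0_mult Ck_off0_Ck_real a Ck_off0_cylinder_bump)
  moreover have "annular_support \<psi>" unfolding \<psi>_def by (rule annular_support_cylindrical[OF a(2) cylindrical_support_cylinder_bump[OF n]])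
  moreover have "\<psi> z \<ge> 0" for z unfolding \<psi>_def by (intro mult_nonneg_nonneg a cylinder_bump_nonneg)
  ultimately show ?thesis by blast
qed

section \<open>Absolute value and logarithm as profiles\<close>

text \<open>Write -ln s as the integral of 1/u over [s, 1] and exchange the order: the inner
  integral becomes u times 1/u.\<close>

lemma nn_integral_neg_ln_unit: "(\<integral>\<^sup>+s. ennreal (- ln s) * indicator {0<..1::real} s \<partial>lborel) = 1"
proof -
  have "(\<integral>\<^sup>+s. ennreal (- ln s) * indicator {0<..1::real} s \<partial>lborel)
     = (\<integral>\<^sup>+s. (\<integral>\<^sup>+u. ennreal (1 / u) * indicator {s..1} u * indicator {0<..1} s \<partial>lborel) \<partial>lborel)"
  proof (rule nn_integral_cong)
    fix s :: real
    show "ennreal (- ln s) * indicator {0<..1::real} s = (\<integral>\<^sup>+u. ennreal (1 / u) * indicator {s..1} u * indicator {0<..1} s \<partial>lborel)"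
    proof (cases "s \<in> {0<..1}")
      case True
      have "(\<integral>\<^sup>+u. ennreal (1 / u) * indicator {s..1} u \<partial>lborel) = ln 1 - ln s"
        by (rule nn_integral_FTC_Icc) (use True in \<open>auto intro!: derivative_eq_intros\<close>)
      then show ?thesis using True by simp
    qed simp
  qed
  also have "\<dots> = (\<integral>\<^sup>+u. (\<integral>\<^sup>+s. ennreal (1 / u) * indicator {s..1} u * indicator {0<..1} s \<partial>lborel) \<partial>lborel)"
  proof (rule lborel_pair.Fubini')
    let ?f = "\<lambda>x::real \<times> real. if 0 < snd x \<and> snd x \<le> 1 \<and> snd x \<le> fst x \<and> fst x \<le> 1 then ennreal (1 / fst x) else 0"
    have "?f \<in> borel_measurable (lborel \<Otimes>\<^sub>M lborel)" by measurable
    moreover have "(\<lambda>(u, s). ennreal (1 / u) * indicator {s..1} u * indicator {0<..1} s) = ?f"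
      by (auto simp: fun_eq_iff indicator_def)
    ultimately show "(\<lambda>(u, s). ennreal (1 / u) * indicator {s..1} u * indicator {0<..1} s) \<in> borel_measurable (lborel \<Otimes>\<^sub>M lborel :: (real \<times> real) measure)"
      by simp
  qed
  also have "\<dots> = (\<integral>\<^sup>+u. indicator {0<..1::real} u \<partial>lborel)"
  proof (rule nn_integral_cong)
    fix u :: real
    show "(\<integral>\<^sup>+s. ennreal (1 / u) * indicator {s..1} u * indicator {0<..1} s \<partial>lborel) = indicator {0<..1} u"
    proof (cases "u \<in> {0<..1}")
      case True
      have "(\<integral>\<^sup>+s. ennreal (1 / u) * indicator {s..1} u * indicator {0<..1} s \<partial>lborel)
          = (\<integral>\<^sup>+s. ennreal (1 / u) * indicator {0<..u} s \<partial>lborel)"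
        using True by (intro nn_integral_cong) (auto simp: indicator_def)
      also have "\<dots> = ennreal (1 / u) * ennreal u" using True by (subst nn_integral_cmult_indicator) auto
      also have "\<dots> = 1" using True by (simp add: ennreal_mult[symmetric])
      finally show ?thesis using True by simp
    next
      case False
      then have z: "ennreal (1 / u) * indicator {s..1} u * indicator {0<..1} s = 0" for s
        by (auto simp: indicator_def)
      show ?thesis unfolding z using False by simp
    qed
  qed
  also have "\<dots> = 1" by simp
  finally show ?thesis .
qed

lemma nn_integral_abs_ln_finite:
  "(\<integral>\<^sup>+s. ennreal \<bar>ln \<bar>s\<bar>\<bar> * indicator {-R..R} s \<partial>lborel) < \<infinity>"
proof -
  let ?f = "\<lambda>s::real. ennreal (- ln s) * indicator {0<..1::real} s"
  have neg: "(\<integral>\<^sup>+s. ?f (- s) \<partial>lborel) = 1"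
    using nn_integral_real_affine[of ?f "-1" 0] nn_integral_neg_ln_unit by simp
  have "(\<integral>\<^sup>+s. ennreal \<bar>ln \<bar>s\<bar>\<bar> * indicator {-R..R} s \<partial>lborel)
      \<le> (\<integral>\<^sup>+s. (?f s + ?f (- s)) + ennreal \<bar>R\<bar> * indicator {-R..R} s \<partial>lborel)"
  proof (rule nn_integral_mono)
    fix s :: real
    show "ennreal \<bar>ln \<bar>s\<bar>\<bar> * indicator {-R..R} s \<le> (?f s + ?f (- s)) + ennreal \<bar>R\<bar> * indicator {-R..R} s"
    proof (cases "\<bar>s\<bar> \<le> 1")
      case True
      consider "s = 0" | "s > 0" | "s < 0" by linarith
      then have "ennreal \<bar>ln \<bar>s\<bar>\<bar> \<le> ?f s + ?f (- s)"
      proof cases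
        case 2
        then have "ln s \<le> 0" using True by simp
        then show ?thesis using 2 True by (simp add: abs_if indicator_def)
      next
        case 3
        then have "ln (- s) \<le> 0" using True by simp
        then show ?thesis using 3 True by (simp add: abs_if indicator_def)
      qed simp
      then show ?thesis by (auto simp: indicator_def intro: order_trans add_increasing2)
    next
      case False
      have "ln \<bar>s\<bar> \<le> \<bar>s\<bar>" "0 \<le> ln \<bar>s\<bar>" using False ln_bound[of "\<bar>s\<bar>"] by auto
      then have "ennreal \<bar>ln \<bar>s\<bar>\<bar> * indicator {-R..R} s \<le> ennreal \<bar>R\<bar> * indicator {-R..R} s"
        by (auto simp: indicator_def intro!: ennreal_leI)
      then show ?thesis by (rule order_trans) simp
    qed
  qed
  also have "\<dots> = (1 + 1) + ennreal \<bar>R\<bar> * emeasure lborel {-R..R}"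
    using neg nn_integral_neg_ln_unit
    by (subst nn_integral_add, simp, simp, subst nn_integral_add, simp, simp, subst nn_integral_cmult_indicator) auto
  also have "\<dots> < \<infinity>" by (simp add: ennreal_mult_less_top emeasure_lborel_Icc_eq)
  finally show ?thesis .
qed

interpretation abs_profile: kernel_profile "\<lambda>s. \<bar>s\<bar>" 1 0
proof
  fix R :: real
  have "(\<integral>\<^sup>+s. ennreal \<bar>\<bar>s\<bar>\<bar> * indicator {-R..R} s \<partial>lborel) \<le> (\<integral>\<^sup>+s. ennreal \<bar>R\<bar> * indicator {-R..R} s \<partial>lborel)"
    by (intro nn_integral_mono) (auto simp: indicator_def intro!: ennreal_leI)
  also have "\<dots> < \<infinity>" by (subst nn_integral_cmult_indicator) (auto simp: ennreal_mult_less_top emeasure_lborel_Icc_eq)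
  finally show "(\<integral>\<^sup>+s. ennreal \<bar>\<bar>s\<bar>\<bar> * indicator {-R..R} s \<partial>lborel) < \<infinity>" .
qed (auto simp: abs_mult)

interpretation ln_profile: kernel_profile "\<lambda>s. ln \<bar>s\<bar>" 0 1
  by standard (auto simp: abs_mult ln_mult nn_integral_abs_ln_finite[simplified])

section \<open>Non-vanishing pairings for the two profiles\<close>

lemma deriv_eq_0_off_closed:
  assumes "closed S" "\<And>t::real. t \<notin> S \<Longrightarrow> a t = (0::real)" "t \<notin> S"
  shows "deriv a t = 0"
proof (rule DERIV_imp_deriv)
  have "((\<lambda>_. 0) has_real_derivative 0) (at t)" by simp
  then show "(a has_real_derivative 0) (at t)"
    by (rule has_field_derivative_transform_within_open[of _ _ _ "- S"]) (use assms in auto)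
qed

text \<open>If a derivative vanished identically, the previous one would be constant, hence zero
  because it vanishes outside the support; descending, u would be zero.\<close>

lemma deriv_iter_neq_0:
  assumes "Ck_real j u" "bounded_support R u" "u t0 \<noteq> 0"
  shows "\<exists>s. (deriv ^^ j) u s \<noteq> 0"
  using assms(1)
proof (induction j)
  case 0
  then show ?case using assms(3) by auto
next
  case (Suc j)
  show ?case
  proof (rule ccontr)
    assume "\<not> ?thesis"
    then have z: "deriv ((deriv ^^ j) u) t = 0" for t by auto
    have "Ck_real (Suc 0) ((deriv ^^ j) u)" by (rule Ck_real_deriv_iter) (use Suc.prems in simp)
    from Ck_real_Suc_deriv(2)[OF this] have "DERIV ((deriv ^^ j) u) t :> 0" for t by (simp only: z)
    then have "(deriv ^^ j) u t = (deriv ^^ j) u (\<bar>R\<bar> + 1)" for t using DERIV_isconst_all by blast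
    moreover have "(deriv ^^ j) u (\<bar>R\<bar> + 1) = 0"
      using bounded_support_deriv_iter[OF assms(2), of j] by (auto simp: bounded_support_def)
    ultimately show False using Suc.IH[OF Ck_real_Suc_imp[OF Suc.prems]] by simp
  qed
qed

text \<open>The second derivative of |t| is twice the Dirac mass at 0. On each half-line
  \<open>t c' - c\<close> is an antiderivative of \<open>t c''\<close>.\<close>

lemma integral_abs_deriv2:
  assumes c: "Ck_real 2 c" "bounded_support R c"
  shows "(\<integral>t. \<bar>t\<bar> * deriv (deriv c) t \<partial>lborel) = 2 * c 0"
proof -
  have c2: "Ck_real (Suc (Suc 0)) c" using c(1) by (simp add: numeral_2_eq_2)
  note d1 = Ck_real_Suc_deriv[OF c2] and d2 = Ck_real_Suc_deriv[OF Ck_real_Suc_deriv(1)[OF c2]]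
  define S where "S = \<bar>R\<bar> + 1"
  define F where "F t = t * deriv c t - c t" for t
  have F: "DERIV F t :> t * deriv (deriv c) t" for t
    unfolding F_def using d1(2) d2(2) by (auto intro!: derivative_eq_intros)
  have cont: "isCont (\<lambda>t. t * deriv (deriv c) t) t" for t
    using Ck_real_continuous[OF d2(1)] by (auto intro!: continuous_intros simp: continuous_on_eq_continuous_at)
  have vanish: "c t = 0" "deriv c t = 0" "deriv (deriv c) t = 0" if "\<bar>t\<bar> > \<bar>R\<bar>" for t
    using c(2) bounded_support_deriv[OF c(2)] bounded_support_deriv[OF bounded_support_deriv[OF c(2)]] that
    by (auto simp: bounded_support_def)
  have FS: "F S = 0" "F (-S) = 0" "F 0 = - c 0" using vanish[of S] vanish[of "-S"] by (auto simp: F_def S_def)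
  have h1: "has_bochner_integral lborel (\<lambda>t. t * deriv (deriv c) t * indicator {0..S} t) (F S - F 0)"
    by (rule has_bochner_integral_FTC_Icc_real) (use F cont in \<open>auto simp: S_def\<close>)
  have h2: "has_bochner_integral lborel (\<lambda>t. t * deriv (deriv c) t * indicator {-S..0} t) (F 0 - F (-S))"
    by (rule has_bochner_integral_FTC_Icc_real) (use F cont in \<open>auto simp: S_def\<close>)
  have "has_bochner_integral lborel (\<lambda>t. t * deriv (deriv c) t * indicator {0..S} t - t * deriv (deriv c) t * indicator {-S..0} t) ((F S - F 0) - (F 0 - F (-S)))"
    by (rule has_bochner_integral_diff[OF h1 h2])
  moreover have "t * deriv (deriv c) t * indicator {0..S} t - t * deriv (deriv c) t * indicator {-S..0} t = \<bar>t\<bar> * deriv (deriv c) t" for t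
  proof (cases "\<bar>t\<bar> > \<bar>R\<bar>")
    case False
    then show ?thesis by (auto simp: indicator_def S_def abs_if)
  qed (simp add: vanish)
  ultimately show ?thesis using FS by (simp add: has_bochner_integral_iff)
qed

text \<open>The pairing equals twice the derivative of order 2k - 2 at 0. That derivative of the
  unit bump is non-zero at some s, and b is the bump translated so that s comes to lie at the
  origin.\<close>

lemma abs_profile_nondegenerate:
  assumes "k \<ge> 1"
  shows "\<exists>b R. Ck_real (2 * k) b \<and> bounded_support R b \<and> (\<forall>t. b t \<ge> 0) \<and> abs_profile.profile_pairing (2 * k) b \<noteq> 0"
proof -
  let ?u = "unit_bump (2 * k)" and ?j = "2 * k - 2"
  have j: "2 * k = ?j + 2" "2 * k = Suc (Suc ?j)" using assms by auto
  have "Ck_real ?j ?u" by (rule Ck_real_mono[OF Ck_real_unit_bump]) simp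
  moreover have "?u (3/2) \<noteq> 0" by (simp add: unit_bump_def)
  ultimately obtain s where s: "(deriv ^^ ?j) ?u s \<noteq> 0"
    using deriv_iter_neq_0[OF _ bounded_support_unit_bump] by blast
  define b where "b t = ?u (1 * t + s)" for t
  have b: "Ck_real (2 * k) b" unfolding b_def[abs_def] by (rule Ck_real_affine[OF Ck_real_unit_bump])
  have bs: "bounded_support (2 + \<bar>s\<bar>) b"
    unfolding bounded_support_def b_def by (auto intro!: unit_bump_eq_0)
  have b0: "(deriv ^^ ?j) b 0 \<noteq> 0"
    using deriv_iter_affine[OF \<open>Ck_real ?j ?u\<close>, of 1 s] s by (simp add: b_def[abs_def])
  have "Ck_real 2 ((deriv ^^ ?j) b)" by (rule Ck_real_deriv_iter) (use b j in simp)
  from integral_abs_deriv2[OF this bounded_support_deriv_iter[OF bs]]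
  have "abs_profile.profile_pairing (2 * k) b = 2 * (deriv ^^ ?j) b 0"
    unfolding abs_profile.profile_pairing_def by (subst j(2)) simp
  then show ?thesis using b bs b0 unit_bump_nonneg by (intro exI[of _ b] exI[of _ "2 + \<bar>s\<bar>"]) (auto simp: b_def)
qed

text \<open>As v lives on [1, 2], conditions on w for t > 0 suffice, which admits the logarithm and
  the powers of 1/t.\<close>

lemma integral_by_parts_bump:
  fixes v w w' :: "real \<Rightarrow> real"
  assumes v: "Ck_real (Suc 0) v" "\<And>t. t \<notin> {1..2} \<Longrightarrow> v t = 0"
    and w: "\<And>t. t > 0 \<Longrightarrow> (w has_real_derivative w' t) (at t)" "\<And>t. t > 0 \<Longrightarrow> isCont w' t"
  shows "(\<integral>t. w t * deriv v t \<partial>lborel) = - (\<integral>t. w' t * v t \<partial>lborel)"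
proof -
  note d = Ck_real_Suc_deriv[OF v(1)]
  have cd: "isCont (deriv v) t" for t using Ck_real_continuous[OF d(1)] by (simp add: continuous_on_eq_continuous_at)
  have cv: "isCont v t" for t using d(2) by (rule DERIV_isCont)
  have cw: "isCont w t" if "t > 0" for t using w(1)[OF that] by (rule DERIV_isCont)
  have dv: "deriv v t = 0" if "t \<notin> {1..2}" for t by (rule deriv_eq_0_off_closed[of "{1..2}"]) (use v that in auto)
  \<comment> \<open>[1/2, 3] has [1, 2] in its interior and stays away from 0, so v vanishes at its
    end points and w is smooth on it.\<close>
  have ind: "w t * deriv v t = w t * deriv v t * indicator {1/2..3} t" "w' t * v t = w' t * v t * indicator {1/2..3} t" for t
    using dv[of t] v(2)[of t] by (cases "t \<in> {1..2}"; simp)+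
  have i1: "integrable lborel (\<lambda>t. w t * deriv v t)"
    by (subst ind(1)) (intro borel_integrable_atLeastAtMost continuous_intros cw cd; simp)
  have i2: "integrable lborel (\<lambda>t. w' t * v t)"
    by (subst ind(2)) (intro borel_integrable_atLeastAtMost continuous_intros w(2) cv; simp)
  have "(\<integral>t. w t * deriv v t + w' t * v t \<partial>lborel) = (\<integral>t. (w t * deriv v t + w' t * v t) * indicator {1/2..3} t \<partial>lborel)"
    by (intro Bochner_Integration.integral_cong refl) (metis ind distrib_right)
  also have "\<dots> = w 3 * v 3 - w (1/2) * v (1/2)"
  proof (rule integral_FTC_Icc_real)
    show "DERIV (\<lambda>t. w t * v t) t :> w t * deriv v t + w' t * v t" if "1/2 \<le> t" "t \<le> 3" for t
      using DERIV_mult[OF w(1) d(2), of t] that by (simp add: algebra_simps)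
    show "isCont (\<lambda>t. w t * deriv v t + w' t * v t) t" if "1/2 \<le> t" "t \<le> 3" for t
      using that by (intro continuous_intros cw cd cv w(2)) auto
  qed simp
  also have "\<dots> = 0" using v(2)[of 3] v(2)[of "1/2"] by simp
  finally show ?thesis using i1 i2 by simp
qed

text \<open>Each integration by parts removes one derivative from the bump. Its minus sign cancels
  against that of the derivative of a negative power, so positivity persists down to j = 0, where
  the integrand is non-negative.\<close>

lemma integral_inverse_power_bump_pos:
  "j \<le> m \<Longrightarrow> (\<integral>t. inverse t ^ Suc l * (deriv ^^ j) (unit_bump m) t \<partial>lborel) > 0"
proof (induction j arbitrary: l)
  case 0
  have v: "unit_bump m t = 0" if "t \<notin> {1..2}" for t by (rule unit_bump_eq_0[OF that])
  have cv: "isCont (unit_bump m) t" for t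
    using Ck_real_continuous[OF Ck_real_unit_bump] by (simp add: continuous_on_eq_continuous_at)
  have ind: "inverse t ^ Suc l * unit_bump m t = inverse t ^ Suc l * unit_bump m t * indicator {1/2..3} t" for t
    using v[of t] by (cases "t \<in> {1..2}") auto
  have i: "integrable lborel (\<lambda>t. inverse t ^ Suc l * unit_bump m t)"
    by (subst ind) (intro borel_integrable_atLeastAtMost continuous_intros cv; simp)
  have "(1/2) ^ Suc l * (3/16) ^ Suc m * indicator {5/4..7/4} t \<le> inverse t ^ Suc l * unit_bump m t" for t
  proof (cases "t \<in> {5/4..7/4}")
    case True
    then have "1/2 \<le> inverse t" by (simp add: field_simps)
    then have "(1/2) ^ Suc l \<le> inverse t ^ Suc l" by (intro power_mono) auto
    moreover have "(3/16) ^ Suc m \<le> unit_bump m t" using unit_bump_ge[of m t] True by simp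
    ultimately have "(1/2) ^ Suc l * (3/16) ^ Suc m \<le> inverse t ^ Suc l * unit_bump m t"
      using True by (intro mult_mono) auto
    then show ?thesis using True by simp
  next
    case False
    have "0 \<le> inverse t ^ Suc l * unit_bump m t"
      using v[of t] unit_bump_nonneg[of m t] by (cases "t \<in> {1..2}") auto
    then show ?thesis using False by simp
  qed
  then show ?case using integral_pos_if_ge_indicator[OF i, of "(1/2) ^ Suc l * (3/16) ^ Suc m" "5/4" "7/4"] by simp
next
  case (Suc j)
  have v: "(deriv ^^ i) (unit_bump m) t = 0" if "t \<notin> {1..2}" for t i
    using that
  proof (induction i arbitrary: t)
    case (Suc i)
    then show ?case by (auto intro: deriv_eq_0_off_closed[of "{1..2}"])
  qed (simp add: unit_bump_eq_0)
  have c: "Ck_real (Suc 0) ((deriv ^^ j) (unit_bump m))"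
    by (rule Ck_real_deriv_iter) (use Ck_real_mono[OF Ck_real_unit_bump, of "Suc j" m] Suc.prems in simp)
  have "(\<integral>t. inverse t ^ Suc l * deriv ((deriv ^^ j) (unit_bump m)) t \<partial>lborel)
     = - (\<integral>t. (- (real (Suc l) * inverse t ^ Suc (Suc l))) * (deriv ^^ j) (unit_bump m) t \<partial>lborel)"
  proof (rule integral_by_parts_bump[OF c v])
    fix t :: real assume t: "t > 0"
    show "((\<lambda>t. inverse t ^ Suc l) has_real_derivative - (real (Suc l) * inverse t ^ Suc (Suc l))) (at t)"
      using DERIV_power[OF DERIV_inverse[of t UNIV], of "Suc l"] t by (simp add: mult_ac)
    show "isCont (\<lambda>t. - (real (Suc l) * inverse t ^ Suc (Suc l))) t"
      using t by (intro continuous_intros) auto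
  qed
  also have "\<dots> = real (Suc l) * (\<integral>t. inverse t ^ Suc (Suc l) * (deriv ^^ j) (unit_bump m) t \<partial>lborel)"
    by (simp add: mult.assoc del: power_Suc of_nat_Suc)
  also have "\<dots> > 0" using Suc.IH[of "Suc l"] Suc.prems by (intro mult_pos_pos) auto
  finally show ?case by (simp del: power_Suc)
qed

text \<open>One integration by parts replaces the logarithm by 1/t with a minus sign; the positivity
  of the integrals with inverse powers then makes the pairing of the unit bump itself
  negative.\<close>

lemma ln_profile_nondegenerate:
  assumes "k \<ge> 1"
  shows "\<exists>b R. Ck_real (2 * k) b \<and> bounded_support R b \<and> (\<forall>t. b t \<ge> 0) \<and> ln_profile.profile_pairing (2 * k) b \<noteq> 0"
proof -
  let ?u = "unit_bump (2 * k)" and ?j = "2 * k - 1"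
  have j: "2 * k = Suc ?j" using assms by auto
  have v: "(deriv ^^ i) ?u t = 0" if "t \<notin> {1..2}" for t i
    using that
  proof (induction i arbitrary: t)
    case (Suc i)
    then show ?case by (auto intro: deriv_eq_0_off_closed[of "{1..2}"])
  qed (simp add: unit_bump_eq_0)
  have c: "Ck_real (Suc 0) ((deriv ^^ ?j) ?u)"
    by (rule Ck_real_deriv_iter) (use Ck_real_unit_bump[of "2 * k"] j in simp)
  have "(\<integral>t. ln \<bar>t\<bar> * deriv ((deriv ^^ ?j) ?u) t \<partial>lborel) = - (\<integral>t. inverse t * (deriv ^^ ?j) ?u t \<partial>lborel)"
  proof (rule integral_by_parts_bump[OF c v])
    fix t :: real assume t: "t > 0"
    have "(ln has_real_derivative inverse t) (at t)" using t by (rule DERIV_ln)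
    then show "((\<lambda>t. ln \<bar>t\<bar>) has_real_derivative inverse t) (at t)"
      by (rule has_field_derivative_transform_within_open[of _ _ _ "{0<..}"]) (use t in auto)
    show "isCont inverse t" using t by (intro continuous_intros) auto
  qed
  also have "(\<integral>t. inverse t * (deriv ^^ ?j) ?u t \<partial>lborel) > 0"
    using integral_inverse_power_bump_pos[of ?j "2 * k" 0] by simp
  then have "- (\<integral>t. inverse t * (deriv ^^ ?j) ?u t \<partial>lborel) < 0" by simp
  finally have "ln_profile.profile_pairing (2 * k) ?u < 0"
    unfolding ln_profile.profile_pairing_def by (subst j) simp
  then show ?thesis using Ck_real_unit_bump bounded_support_unit_bump unit_bump_nonneg
    by (intro exI[of _ ?u] exI[of _ 2]) auto
qed

section \<open>Symbols whose reciprocal concentrates\<close>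

definition is_homogeneous_poly :: "nat \<Rightarrow> (real^'n::finite \<Rightarrow> real) \<Rightarrow> bool" where
  "is_homogeneous_poly d f \<longleftrightarrow> (\<exists>A. f = homogeneous_poly d A)"

text \<open>Coefficients are indexed by ordered lists, so a list of length d + e splits uniquely
  into its first d and its last e entries, and concatenation matches the terms of the product one to
  one.\<close>

lemma is_homogeneous_poly_mult:
  fixes f g :: "real^'n::finite \<Rightarrow> real"
  assumes "is_homogeneous_poly d f" "is_homogeneous_poly e g"
  shows "is_homogeneous_poly (d + e) (\<lambda>x. f x * g x)"
proof -
  obtain A B where A: "f = homogeneous_poly d A" "g = homogeneous_poly e B"
    using assms unfolding is_homogeneous_poly_def by blast
  have "f x * g x = homogeneous_poly (d + e) (\<lambda>ks. A (take d ks) * B (drop d ks)) x" for x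
  proof -
    have "f x * g x = (\<Sum>(is, js)\<in>{is. length is = d} \<times> {js. length js = e}.
       (A is * (\<Prod>i\<leftarrow>is. x $ i)) * (B js * (\<Prod>i\<leftarrow>js. x $ i)))"
      by (simp add: A homogeneous_poly_def sum_product sum.cartesian_product)
    also have "\<dots> = (\<Sum>ks | length ks = d + e. (A (take d ks) * B (drop d ks)) * (\<Prod>i\<leftarrow>ks. x $ i))"
    proof (rule sum.reindex_bij_witness[where i="\<lambda>ks. (take d ks, drop d ks)" and j="\<lambda>(is, js). is @ js"])
      fix p :: "'n list \<times> 'n list" assume "p \<in> {is. length is = d} \<times> {js. length js = e}"
      then show "(A (take d (case p of (is, js) \<Rightarrow> is @ js)) * B (drop d (case p of (is, js) \<Rightarrow> is @ js))) * (\<Prod>i\<leftarrow>(case p of (is, js) \<Rightarrow> is @ js). x $ i)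
        = (case p of (is, js) \<Rightarrow> (A is * (\<Prod>i\<leftarrow>is. x $ i)) * (B js * (\<Prod>i\<leftarrow>js. x $ i)))"
        by (auto simp: mult_ac)
    qed auto
    finally show ?thesis by (simp add: homogeneous_poly_def)
  qed
  then show ?thesis unfolding is_homogeneous_poly_def by blast
qed

lemma is_homogeneous_poly_add:
  assumes "is_homogeneous_poly d f" "is_homogeneous_poly d g"
  shows "is_homogeneous_poly d (\<lambda>x. f x + g x)"
proof -
  obtain A B where "f = homogeneous_poly d A" "g = homogeneous_poly d B"
    using assms unfolding is_homogeneous_poly_def by blast
  then have "(\<lambda>x. f x + g x) = homogeneous_poly d (\<lambda>is. A is + B is)"
    by (simp add: homogeneous_poly_def fun_eq_iff sum.distrib distrib_right)
  then show ?thesis unfolding is_homogeneous_poly_def by blast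
qed

lemma is_homogeneous_poly_const: "is_homogeneous_poly 0 (\<lambda>_. c)"
  unfolding is_homogeneous_poly_def by (rule exI[of _ "\<lambda>_. c"]) (simp add: homogeneous_poly_def fun_eq_iff)

lemma is_homogeneous_poly_cmult: "is_homogeneous_poly d f \<Longrightarrow> is_homogeneous_poly d (\<lambda>x. c * f x)"
  using is_homogeneous_poly_mult[OF is_homogeneous_poly_const[of c], of d f] by simp

lemma is_homogeneous_poly_zero: "is_homogeneous_poly d (\<lambda>_. 0)"
  unfolding is_homogeneous_poly_def by (rule exI[of _ "\<lambda>_. 0"]) (simp add: homogeneous_poly_def fun_eq_iff)

lemma is_homogeneous_poly_component: "is_homogeneous_poly 1 (\<lambda>x. x $ i)"
proof -
  have "(\<lambda>x. x $ i) = homogeneous_poly 1 (\<lambda>is. if is = [i] then 1 else 0)"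
  proof
    fix x :: "real^'a"
    have "{is::'a list. length is = 1} = (\<lambda>j. [j]) ` UNIV" by (auto simp: length_Suc_conv)
    then have "homogeneous_poly 1 (\<lambda>is. if is = [i] then 1 else 0) x = (\<Sum>j\<in>UNIV. (if [j] = [i] then 1 else 0) * (\<Prod>i\<leftarrow>[j]. x $ i))"
      unfolding homogeneous_poly_def by (subst sum.reindex[symmetric, unfolded o_def]) (auto simp: inj_on_def)
    then show "x $ i = homogeneous_poly 1 (\<lambda>is. if is = [i] then 1 else 0) x"
      by (simp add: if_distrib[where f="\<lambda>x. x * _"] cong: if_cong)
  qed
  then show ?thesis unfolding is_homogeneous_poly_def by blast
qed

lemma is_homogeneous_poly_sum: "(\<And>a. a \<in> S \<Longrightarrow> is_homogeneous_poly d (f a)) \<Longrightarrow> is_homogeneous_poly d (\<lambda>x. \<Sum>a\<in>S. f a x)"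
  by (induction S rule: infinite_finite_induct) (auto intro: is_homogeneous_poly_zero is_homogeneous_poly_add)

lemma is_homogeneous_poly_power: "is_homogeneous_poly d f \<Longrightarrow> is_homogeneous_poly (d * l) (\<lambda>x. f x ^ l)"
  by (induction l) (auto intro: is_homogeneous_poly_const is_homogeneous_poly_mult)

lemma is_homogeneous_poly_inner_self: "is_homogeneous_poly 2 (\<lambda>x. x \<bullet> x)"
  unfolding inner_vec_def
  using is_homogeneous_poly_mult[OF is_homogeneous_poly_component is_homogeneous_poly_component]
  by (intro is_homogeneous_poly_sum) (simp add: numeral_2_eq_2)

text \<open>For small \<open>\<epsilon>\<close> the reciprocal concentrates near the cone \<open>\<xi>\<^sub>i\<^sup>2 = \<alpha> \<bar>\<xi>\<bar>\<^sup>2\<close>, which for \<open>\<alpha>\<close> close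
  to \<open>1\<close> lies close to the axis; this needs degree at least four.\<close>

definition cone_symbol :: "nat \<Rightarrow> 'n \<Rightarrow> real \<Rightarrow> real \<Rightarrow> real^'n::finite \<Rightarrow> real" where
  "cone_symbol m i \<alpha> \<epsilon> \<xi> = ((\<xi> $ i)\<^sup>2 - \<alpha> * (\<xi> \<bullet> \<xi>))\<^sup>2 * (\<xi> \<bullet> \<xi>) ^ (m - 2) + \<epsilon> * (\<xi> \<bullet> \<xi>) ^ m"

lemma cone_symbol_ge: "\<epsilon> * norm \<xi> ^ (2 * m) \<le> cone_symbol m i \<alpha> \<epsilon> \<xi>"
  by (simp add: cone_symbol_def power2_norm_eq_inner[symmetric] power_mult)

lemma elliptic_cone_symbol:
  assumes "m \<ge> 2" "\<epsilon> > 0"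
  shows "elliptic_symbol m (cone_symbol m i \<alpha> \<epsilon>)"
proof -
  have q: "is_homogeneous_poly 2 (\<lambda>\<xi>. (\<xi> $ i)\<^sup>2 + (- \<alpha>) * (\<xi> \<bullet> \<xi>))"
    using is_homogeneous_poly_power[OF is_homogeneous_poly_component[of i], of 2]
    by (intro is_homogeneous_poly_add is_homogeneous_poly_cmult is_homogeneous_poly_inner_self) simp
  have "is_homogeneous_poly (2 * 2 + 2 * (m - 2)) (\<lambda>\<xi>. ((\<xi> $ i)\<^sup>2 + (- \<alpha>) * (\<xi> \<bullet> \<xi>))\<^sup>2 * (\<xi> \<bullet> \<xi>) ^ (m - 2))"
    by (intro is_homogeneous_poly_mult is_homogeneous_poly_power q is_homogeneous_poly_inner_self)
  \<comment> \<open>Subtraction on naturals is truncated: m \<ge> 2 gives the correct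
    degree.\<close>
  moreover have "2 * 2 + 2 * (m - 2) = 2 * m" using assms by simp
  ultimately have "is_homogeneous_poly (2 * m) (\<lambda>\<xi>. ((\<xi> $ i)\<^sup>2 + (- \<alpha>) * (\<xi> \<bullet> \<xi>))\<^sup>2 * (\<xi> \<bullet> \<xi>) ^ (m - 2) + \<epsilon> * (\<xi> \<bullet> \<xi>) ^ m)"
    by (intro is_homogeneous_poly_add is_homogeneous_poly_cmult is_homogeneous_poly_power is_homogeneous_poly_inner_self) simp
  then have "is_homogeneous_poly (2 * m) (cone_symbol m i \<alpha> \<epsilon>)" by (simp add: cone_symbol_def[abs_def])
  then show ?thesis
    unfolding elliptic_symbol_def is_homogeneous_poly_def
    using assms(2) cone_symbol_ge by blast
qed

lemma Ck_off0_inverse_cone_symbol: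
  assumes "\<epsilon> > 0"
  shows "Ck_off0 k (\<lambda>\<xi>. inverse (cone_symbol m i \<alpha> \<epsilon> \<xi>))"
proof (rule Ck_off0_inverse)
  show "Ck_off0 k (cone_symbol m i \<alpha> \<epsilon>)"
    unfolding cone_symbol_def[abs_def]
    by (intro Ck_off0_add Ck_off0_mult Ck_off0_power Ck_off0_diff Ck_off0_const Ck_off0_component Ck_off0_inner_self)
  fix z :: "real^'a" assume "z \<noteq> 0"
  then have "0 < \<epsilon> * norm z ^ (2 * m)" using assms by simp
  then show "cone_symbol m i \<alpha> \<epsilon> z \<noteq> 0" using cone_symbol_ge[of \<epsilon> z m i \<alpha>] by linarith
qed

lemma cone_symbol_sphere: "norm \<xi> = 1 \<Longrightarrow> cone_symbol m i \<alpha> \<epsilon> \<xi> = ((\<xi> $ i)\<^sup>2 - \<alpha>)\<^sup>2 + \<epsilon>"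
  by (simp add: cone_symbol_def dot_square_norm)

text \<open>A square of the i-th coordinate near 1 means closeness to one of the two poles, and
  evenness treats them alike. Continuity is required along sequences of unit vectors, the form in
  which \<open>dual_transform_continuous\<close> provides it.\<close>

lemma pole_neighbourhood:
  fixes \<Phi> :: "real^'n::finite \<Rightarrow> real"
  assumes even: "\<And>\<xi>. \<Phi> (- \<xi>) = \<Phi> \<xi>" and pos: "\<Phi> (axis i 1) > 0"
    and cont: "\<And>X. (\<And>j. norm (X j) = 1) \<Longrightarrow> X \<longlonglongrightarrow> axis i 1 \<Longrightarrow> (\<lambda>j. \<Phi> (X j)) \<longlonglongrightarrow> \<Phi> (axis i 1)"
  shows "\<exists>\<delta>. 0 < \<delta> \<and> \<delta> < 1 \<and> (\<forall>\<xi>. norm \<xi> = 1 \<longrightarrow> (\<xi> $ i)\<^sup>2 > 1 - \<delta> \<longrightarrow> \<Phi> \<xi> \<ge> \<Phi> (axis i 1) / 2)"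
proof -
  have "\<exists>\<delta>>0. \<forall>\<xi>. norm \<xi> = 1 \<longrightarrow> \<xi> $ i > 1 - \<delta> \<longrightarrow> \<Phi> \<xi> \<ge> \<Phi> (axis i 1) / 2"
  proof (rule ccontr)
    assume no: "\<not> ?thesis"
    have "\<exists>\<xi>. norm \<xi> = 1 \<and> \<xi> $ i > 1 - inverse (real (Suc j)) \<and> \<Phi> \<xi> < \<Phi> (axis i 1) / 2" for j
      using no by (meson not_le inverse_positive_iff_positive of_nat_0_less_iff zero_less_Suc)
    then obtain X where X: "\<And>j. norm (X j) = 1" "\<And>j. X j $ i > 1 - inverse (real (Suc j))" "\<And>j. \<Phi> (X j) < \<Phi> (axis i 1) / 2"
      by metis
    \<comment> \<open>For unit vectors the squared distance from the pole is 2 minus twice the i-th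
      coordinate.\<close>
    have le: "(norm (X j - axis i 1))\<^sup>2 \<le> 2 * inverse (real (Suc j))" for j
    proof -
      have "(norm (X j - axis i 1))\<^sup>2 = X j \<bullet> X j - 2 * (X j $ i) + 1"
        by (simp add: power2_norm_eq_inner inner_diff_left inner_diff_right inner_axis inner_axis' inner_axis_axis)
      also have "X j \<bullet> X j = 1" using X(1) by (simp add: dot_square_norm)
      finally show ?thesis using X(2)[of j] by simp
    qed
    have "(\<lambda>j. (norm (X j - axis i 1))\<^sup>2) \<longlonglongrightarrow> 0"
    proof (rule Lim_null_comparison)
      show "\<forall>\<^sub>F j in sequentially. norm ((norm (X j - axis i 1))\<^sup>2) \<le> 2 * inverse (real (Suc j))"
        using le by (intro always_eventually) simp
      show "(\<lambda>j. 2 * inverse (real (Suc j))) \<longlonglongrightarrow> 0"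
        by (rule tendsto_mult_right_zero[OF LIMSEQ_inverse_real_of_nat])
    qed
    then have "(\<lambda>j. sqrt ((norm (X j - axis i 1))\<^sup>2)) \<longlonglongrightarrow> sqrt 0" by (rule tendsto_real_sqrt)
    then have "(\<lambda>j. norm (X j - axis i 1)) \<longlonglongrightarrow> 0" by simp
    then have "(\<lambda>j. X j - axis i 1) \<longlonglongrightarrow> 0" by (rule tendsto_norm_zero_cancel)
    then have "X \<longlonglongrightarrow> axis i 1" by (rule LIM_zero_cancel)
    then have "(\<lambda>j. \<Phi> (X j)) \<longlonglongrightarrow> \<Phi> (axis i 1)" by (rule cont[OF X(1)])
    then have "\<Phi> (axis i 1) \<le> \<Phi> (axis i 1) / 2"
      by (rule LIMSEQ_le_const2) (use X(3) in \<open>auto intro: less_imp_le\<close>)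
    then show False using pos by simp
  qed
  then obtain \<delta> where \<delta>: "\<delta> > 0" "\<And>\<xi>. norm \<xi> = 1 \<Longrightarrow> \<xi> $ i > 1 - \<delta> \<Longrightarrow> \<Phi> \<xi> \<ge> \<Phi> (axis i 1) / 2" by blast
  have "\<Phi> \<xi> \<ge> \<Phi> (axis i 1) / 2" if \<xi>: "norm \<xi> = 1" "(\<xi> $ i)\<^sup>2 > 1 - min \<delta> (1/2)" for \<xi>
  proof -
    have le: "\<bar>\<xi> $ i\<bar> \<le> 1" using component_le_norm_cart[of \<xi> i] \<xi> by simp
    have "(\<xi> $ i)\<^sup>2 = \<bar>\<xi> $ i\<bar> * \<bar>\<xi> $ i\<bar>" by (simp add: power2_eq_square)
    also have "\<dots> \<le> \<bar>\<xi> $ i\<bar> * 1" using le by (intro mult_left_mono) auto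
    finally have gt: "\<bar>\<xi> $ i\<bar> > 1 - \<delta>" using \<xi>(2) by simp
    show ?thesis
    proof (cases "\<xi> $ i \<ge> 0")
      case True
      then show ?thesis using \<delta>(2)[of \<xi>] \<xi> gt by simp
    next
      case False
      then show ?thesis using \<delta>(2)[of "- \<xi>"] \<xi> gt even[of \<xi>] by simp
    qed
  qed
  then show ?thesis using \<delta>(1) by (intro exI[of _ "min \<delta> (1/2)"]) auto
qed

lemma zone_measure_pos:
  fixes i :: "'n::finite"
  assumes n: "CARD('n) \<ge> 2" and \<alpha>: "0 < \<alpha>1" "\<alpha>1 < \<alpha>2" "\<alpha>2 < 1"
  shows "measure sphere_measure {\<xi> :: real^'n. \<alpha>1 < (\<xi> $ i)\<^sup>2 \<and> (\<xi> $ i)\<^sup>2 < \<alpha>2} > 0"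
proof -
  have "\<exists>j::'n. j \<noteq> i" by (rule exists_other_index[OF n])
  then obtain j where j: "j \<noteq> i" by blast
  define t where "t = (\<alpha>1 + \<alpha>2) / 2"
  have t: "\<alpha>1 < t" "t < \<alpha>2" "0 < t" "t < 1" using \<alpha> by (auto simp: t_def)
  \<comment> \<open>A unit vector in the zone: its i-th coordinate has square t, and a second
    coordinate carries the remaining 1 - t.\<close>
  define x :: "real^'n" where "x = sqrt t *\<^sub>R axis i 1 + sqrt (1 - t) *\<^sub>R axis j 1"
  have xi: "x $ i = sqrt t" using j by (simp add: x_def axis_def)
  have "x \<bullet> x = 1" using t j by (simp add: x_def inner_simps inner_axis_axis)
  then have nx: "norm x = 1" by (simp add: norm_eq_sqrt_inner)
  let ?Z = "{\<xi> :: real^'n. \<alpha>1 < (\<xi> $ i)\<^sup>2 \<and> (\<xi> $ i)\<^sup>2 < \<alpha>2}"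
  have "open ?Z" by (intro open_Collect_conj open_Collect_less continuous_intros)
  moreover have "x \<in> ?Z" using t by (simp add: xi)
  ultimately have "emeasure sphere_measure ?Z > 0"
    using nx n by (intro sphere_measure_open_pos[of ?Z x]) auto
  then show ?thesis by (simp add: sphere_measure.emeasure_eq_measure)
qed

text \<open>A zone around the poles of positive measure is cut into J strips around cones. By
  pigeonhole one strip has at least the J-th part of the measure, however that measure is
  distributed. On the strip 1/Q is at least of order \<open>1/\<eta>\<^sup>2\<close>, that is
  \<open>J\<^sup>2\<close>, so its contribution grows with J, while 1/Q stays bounded where the two
  functions may be negative. The same strip serves both functions.\<close>

lemma cone_symbol_concentrates:
  fixes \<Phi>1 \<Phi>2 :: "real^'n::finite \<Rightarrow> real" and i :: 'n
  assumes n: "CARD('n) \<ge> 2"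
    and meas[measurable]: "\<Phi>1 \<in> borel_measurable borel" "\<Phi>2 \<in> borel_measurable borel"
    and \<delta>: "0 < \<delta>" "\<delta> < 1" and c: "c > 0"
    and near: "\<And>\<xi>. norm \<xi> = 1 \<Longrightarrow> (\<xi> $ i)\<^sup>2 > 1 - \<delta> \<Longrightarrow> \<Phi>1 \<xi> \<ge> c \<and> \<Phi>2 \<xi> \<ge> c"
    and C: "\<And>\<xi>. norm \<xi> = 1 \<Longrightarrow> \<bar>\<Phi>1 \<xi>\<bar> \<le> C \<and> \<bar>\<Phi>2 \<xi>\<bar> \<le> C"
  shows "\<exists>\<alpha> \<epsilon>. \<epsilon> > 0 \<and> (\<integral>\<xi>. inverse (cone_symbol m i \<alpha> \<epsilon> \<xi>) * \<Phi>1 \<xi> \<partial>sphere_measure) > 0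
      \<and> (\<integral>\<xi>. inverse (cone_symbol m i \<alpha> \<epsilon> \<xi>) * \<Phi>2 \<xi> \<partial>sphere_measure) > 0"
proof -
  let ?\<sigma> = "sphere_measure :: (real^'n) measure"
  \<comment> \<open>The zone lies between the levels \<open>1 - \<delta>/2\<close> and
    \<open>1 - \<delta>/4\<close>. It is thus inside the region of the lower bound c and keeps the
    margin \<open>\<delta>/2\<close> to the rest of the sphere.\<close>
  define a where "a = 1 - \<delta> / 2"
  define Z where "Z = {\<xi> :: real^'n. a < (\<xi> $ i)\<^sup>2 \<and> (\<xi> $ i)\<^sup>2 < 1 - \<delta> / 4}"
  define m0 where "m0 = measure ?\<sigma> Z"
  have m0: "m0 > 0" unfolding m0_def Z_def a_def by (rule zone_measure_pos[OF n]) (use \<delta> in auto)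
  have "\<bar>\<Phi>1 (axis i 1)\<bar> \<le> C" using C by (simp add: norm_axis_1)
  then have C0: "C \<ge> 0" by linarith
  \<comment> \<open>With \<epsilon> = \<open>\<eta>\<^sup>2\<close> the gain is at least
    \<open>c/(2 \<eta>\<^sup>2)\<close> times m0/J, which is
    \<open>32 c m0 J / \<delta>\<^sup>2\<close>. The loss is at most
    \<open>4 C / \<delta>\<^sup>2\<close> times the total measure. This J lets the gain win.\<close>
  obtain J :: nat where J: "real J > C * measure ?\<sigma> UNIV / (8 * c * m0)" using reals_Archimedean2 by blast
  have "0 \<le> C * measure ?\<sigma> UNIV / (8 * c * m0)" using C0 c m0 by (intro divide_nonneg_nonneg mult_nonneg_nonneg) auto
  then have J0: "real J > 0" using J by linarith
  \<comment> \<open>J strips of width \<open>2 \<eta>\<close> fill the zone of width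
    \<open>\<delta>/4\<close> exactly; \<open>\<alpha> l\<close> is the centre of the l-th
    strip.\<close>
  define \<eta> where "\<eta> = \<delta> / (8 * real J)"
  have \<eta>: "\<eta> > 0" using \<delta> J0 by (simp add: \<eta>_def)
  define \<alpha> where "\<alpha> l = a + (2 * real l + 1) * \<eta>" for l :: nat
  define S where "S l = {\<xi> \<in> Z. \<bar>(\<xi> $ i)\<^sup>2 - \<alpha> l\<bar> \<le> \<eta>}" for l
  have comp[measurable]: "(\<lambda>\<xi>::real^'n. \<xi> $ i) \<in> borel_measurable borel"
    by (intro borel_measurable_continuous_onI continuous_intros)
  have Zm[measurable]: "Z \<in> sets borel" unfolding Z_def by measurable
  have Sm[measurable]: "S l \<in> sets borel" for l unfolding S_def by measurable
  have cover: "Z \<subseteq> (\<Union>l<J. S l)"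
  proof
    fix \<xi> assume \<xi>: "\<xi> \<in> Z"
    define t where "t = ((\<xi> $ i)\<^sup>2 - a) / (2 * \<eta>)"
    have t: "0 \<le> t" using \<xi> \<eta> by (simp add: t_def Z_def)
    have tJ: "t < real J"
    proof -
      have "(\<xi> $ i)\<^sup>2 - a < \<delta> / 4" using \<xi> by (simp add: Z_def a_def)
      also have "\<delta> / 4 = real J * (2 * \<eta>)" using J0 by (simp add: \<eta>_def)
      finally show ?thesis using \<eta> by (simp add: t_def pos_divide_less_eq)
    qed
    define l where "l = nat \<lfloor>t\<rfloor>"
    have l: "real l \<le> t" "t < real l + 1" using t by (auto simp: l_def)
    have lJ: "l < J" using l(1) tJ by (metis of_nat_less_iff le_less_trans)
    have "(\<xi> $ i)\<^sup>2 = a + 2 * \<eta> * t" using \<eta> by (simp add: t_def)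
    then have "(\<xi> $ i)\<^sup>2 - \<alpha> l = (2 * (t - real l) - 1) * \<eta>" by (simp add: \<alpha>_def algebra_simps)
    then have "\<bar>(\<xi> $ i)\<^sup>2 - \<alpha> l\<bar> = \<bar>2 * (t - real l) - 1\<bar> * \<eta>" using \<eta> by (simp add: abs_mult)
    also have "\<dots> \<le> 1 * \<eta>" using l \<eta> by (intro mult_right_mono) auto
    finally have "\<bar>(\<xi> $ i)\<^sup>2 - \<alpha> l\<bar> \<le> \<eta>" by simp
    then have "\<xi> \<in> S l" using \<xi> by (simp add: S_def)
    then show "\<xi> \<in> (\<Union>l<J. S l)" using lJ by blast
  qed
  have "\<exists>l<J. measure ?\<sigma> (S l) \<ge> m0 / real J"
  proof (rule ccontr)
    assume "\<not> ?thesis"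
    then have lt: "measure ?\<sigma> (S l) < m0 / real J" if "l < J" for l using that by (meson not_le)
    have "m0 \<le> measure ?\<sigma> (\<Union>l<J. S l)"
      unfolding m0_def by (rule sphere_measure.finite_measure_mono[OF cover]) simp
    also have "\<dots> \<le> (\<Sum>l<J. measure ?\<sigma> (S l))"
      by (rule measure_UNION_le) auto
    also have "\<dots> < (\<Sum>l<J. m0 / real J)"
      by (rule sum_strict_mono) (use lt J0 in auto)
    also have "\<dots> = m0" using J0 by simp
    finally show False by simp
  qed
  then obtain l where l: "l < J" "measure ?\<sigma> (S l) \<ge> m0 / real J" by blast
  let ?Q = "cone_symbol m i (\<alpha> l) (\<eta>\<^sup>2)"
  let ?g = "\<lambda>\<xi>. inverse (?Q \<xi>)"
  have eta2: "\<eta>\<^sup>2 > 0" using \<eta> by simp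
  note gm[measurable] = Ck_off0_borel_measurable[OF Ck_off0_inverse_cone_symbol[OF eta2, of 0 m i "\<alpha> l"]]
  have \<alpha>ge: "\<alpha> l \<ge> a" using \<eta> by (simp add: \<alpha>_def)
  have gpos: "?g \<xi> \<ge> 0" "?g \<xi> \<le> 1 / \<eta>\<^sup>2" if "norm \<xi> = 1" for \<xi>
  proof -
    have "?Q \<xi> \<ge> \<eta>\<^sup>2" using that by (simp add: cone_symbol_sphere)
    moreover from this have "?Q \<xi> > 0" using eta2 by linarith
    ultimately show "?g \<xi> \<ge> 0" "?g \<xi> \<le> 1 / \<eta>\<^sup>2"
      using le_imp_inverse_le[OF _ eta2, of "?Q \<xi>"] by (simp_all add: less_imp_le inverse_eq_divide)
  qed
  have gS: "?g \<xi> \<ge> 1 / (2 * \<eta>\<^sup>2)" if "norm \<xi> = 1" "\<xi> \<in> S l" for \<xi>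
  proof -
    have "\<bar>(\<xi> $ i)\<^sup>2 - \<alpha> l\<bar> \<le> \<eta>" using that by (simp add: S_def)
    then have "((\<xi> $ i)\<^sup>2 - \<alpha> l)\<^sup>2 \<le> \<eta>\<^sup>2" using \<eta> by (simp add: abs_le_square_iff[symmetric])
    then have "?Q \<xi> \<le> 2 * \<eta>\<^sup>2" using that by (simp add: cone_symbol_sphere)
    moreover have "?Q \<xi> > 0" using that eta2 by (simp add: cone_symbol_sphere add_nonneg_pos)
    ultimately show ?thesis
      using le_imp_inverse_le[of "?Q \<xi>" "2 * \<eta>\<^sup>2"] by (simp only: inverse_eq_divide)
  qed
  \<comment> \<open>All centres are at least a, so outside the region of the lower bound the squared
    term of Q is at least the square of \<open>\<delta>/2\<close>.\<close>
  have gfar: "?g \<xi> \<le> 4 / \<delta>\<^sup>2" if "norm \<xi> = 1" "(\<xi> $ i)\<^sup>2 \<le> 1 - \<delta>" for \<xi>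
  proof -
    have "\<delta> / 2 \<le> \<alpha> l - (\<xi> $ i)\<^sup>2" using that(2) \<alpha>ge by (simp add: a_def)
    then have "(\<delta> / 2)\<^sup>2 \<le> (\<alpha> l - (\<xi> $ i)\<^sup>2)\<^sup>2" using \<delta> by (intro power_mono) auto
    also have "\<dots> \<le> ?Q \<xi>" using that(1)
      by (simp add: cone_symbol_sphere power2_commute[of "\<alpha> l"])
    finally have "\<delta>\<^sup>2 / 4 \<le> ?Q \<xi>" by (simp add: power_divide)
    moreover have "\<delta>\<^sup>2 / 4 > 0" using \<delta> by simp
    ultimately have "?g \<xi> \<le> inverse (\<delta>\<^sup>2 / 4)" by (rule le_imp_inverse_le)
    then show ?thesis by (simp only: inverse_divide)
  qed
  have main: "(\<integral>\<xi>. ?g \<xi> * \<Phi> \<xi> \<partial>?\<sigma>) > 0"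
    if [measurable]: "\<Phi> \<in> borel_measurable borel"
      and near: "\<And>\<xi>. norm \<xi> = 1 \<Longrightarrow> (\<xi> $ i)\<^sup>2 > 1 - \<delta> \<Longrightarrow> \<Phi> \<xi> \<ge> c" and C: "\<And>\<xi>. norm \<xi> = 1 \<Longrightarrow> \<bar>\<Phi> \<xi>\<bar> \<le> C" for \<Phi>
  proof -
    have bd: "\<bar>?g \<xi> * \<Phi> \<xi>\<bar> \<le> 1 / \<eta>\<^sup>2 * C" if "norm \<xi> = 1" for \<xi>
      unfolding abs_mult using gpos[OF that] C[OF that] eta2 by (intro mult_mono) auto
    have i1: "integrable ?\<sigma> (\<lambda>\<xi>. ?g \<xi> * \<Phi> \<xi>)"
      using integrable_mult_bounded_sphere[of "\<lambda>_. 1" "\<lambda>\<xi>. ?g \<xi> * \<Phi> \<xi>" "1 / \<eta>\<^sup>2 * C"] bd by simp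
    \<comment> \<open>A lower bound for the integrand: the gain is counted on the strip only, the
      loss everywhere. Near the poles the integrand is non-negative, and the strip does not meet the
      remaining part.\<close>
    let ?L = "\<lambda>\<xi>. c / (2 * \<eta>\<^sup>2) * indicator (S l) \<xi> - 4 * C / \<delta>\<^sup>2"
    have ind: "integrable ?\<sigma> (indicator (S l) :: _ \<Rightarrow> real)"
      by (simp add: integrable_indicator_iff sphere_measure.emeasure_finite less_top[symmetric])
    have i2: "integrable ?\<sigma> ?L" using ind by (intro Bochner_Integration.integrable_diff integrable_mult_right) auto
    have "0 < 4 / \<delta>\<^sup>2 * (8 * c * m0 * real J - C * measure ?\<sigma> UNIV)"
      using J c m0 \<delta> by (intro mult_pos_pos) (auto simp: pos_divide_less_eq mult_ac)
    also have "\<dots> = c / (2 * \<eta>\<^sup>2) * (m0 / real J) - 4 * C / \<delta>\<^sup>2 * measure ?\<sigma> UNIV"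
    proof -
      have "c / (2 * \<eta>\<^sup>2) * (m0 / real J) = 4 / \<delta>\<^sup>2 * (8 * c * m0 * real J)"
        using J0 \<delta> by (simp add: \<eta>_def power_divide power_mult_distrib divide_simps) (simp add: power2_eq_square)
      then show ?thesis by (simp add: right_diff_distrib)
    qed
    also have "\<dots> \<le> c / (2 * \<eta>\<^sup>2) * measure ?\<sigma> (S l) - 4 * C / \<delta>\<^sup>2 * measure ?\<sigma> UNIV"
      using l(2) c eta2 by (intro diff_right_mono mult_left_mono) auto
    also have "\<dots> = (\<integral>\<xi>. ?L \<xi> \<partial>?\<sigma>)" using ind by (simp add: mult.commute)
    also have "\<dots> \<le> (\<integral>\<xi>. ?g \<xi> * \<Phi> \<xi> \<partial>?\<sigma>)"
    proof (rule integral_mono_AE[OF i2 i1])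
      show "AE \<xi> in ?\<sigma>. ?L \<xi> \<le> ?g \<xi> * \<Phi> \<xi>"
        using AE_sphere_measure
      proof eventually_elim
        case (elim \<xi>)
        show ?case
        proof (cases "(\<xi> $ i)\<^sup>2 > 1 - \<delta>")
          case True
          have "c / (2 * \<eta>\<^sup>2) * indicator (S l) \<xi> \<le> ?g \<xi> * c"
            using gS[OF elim] gpos(1)[OF elim] c mult_left_mono[of "1 / (2 * \<eta>\<^sup>2)" "?g \<xi>" c]
            by (cases "\<xi> \<in> S l") (auto simp: mult.commute)
          also have "\<dots> \<le> ?g \<xi> * \<Phi> \<xi>" by (rule mult_left_mono[OF near[OF elim True] gpos(1)[OF elim]])
          finally have "c / (2 * \<eta>\<^sup>2) * indicator (S l) \<xi> \<le> ?g \<xi> * \<Phi> \<xi>" .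
          moreover have "0 \<le> 4 * C / \<delta>\<^sup>2" using C0 by simp
          ultimately show ?thesis by linarith
        next
          case False
          then have nS: "\<xi> \<notin> S l" using \<delta> by (auto simp: S_def Z_def a_def)
          have "\<bar>?g \<xi> * \<Phi> \<xi>\<bar> \<le> 4 / \<delta>\<^sup>2 * C"
            unfolding abs_mult using gpos[OF elim] gfar[OF elim] False C[OF elim] by (intro mult_mono) auto
          then show ?thesis using nS by (simp add: abs_le_iff)
        qed
      qed
    qed
    finally show ?thesis .
  qed
  show ?thesis
    by (intro exI[of _ "\<alpha> l"] exI[of _ "\<eta>\<^sup>2"] conjI eta2 main meas) (use near C in auto)
qed

section \<open>Sign change near the diagonal\<close>

lemma partial_deriv_scale:
  fixes u :: "real^'n::finite \<Rightarrow> real"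
  assumes u: "Ck_off0 (Suc k) u" and t: "t > 0"
    and eq: "\<And>z. z \<noteq> 0 \<Longrightarrow> u (t *\<^sub>R z) = c * u z + d" and z: "z \<noteq> 0"
  shows "partial_deriv i u (t *\<^sub>R z) = (c / t) * partial_deriv i u z"
proof -
  have tz: "t *\<^sub>R z \<noteq> 0" using t z by simp
  note Du = has_derivative_partial_deriv[OF u tz]
  have "((\<lambda>z. u (t *\<^sub>R z)) has_derivative (\<lambda>h. \<Sum>j\<in>UNIV. (t *\<^sub>R h) $ j * partial_deriv j u (t *\<^sub>R z))) (at z)"
    by (rule has_derivative_compose[of "\<lambda>z. t *\<^sub>R z" "\<lambda>h. t *\<^sub>R h"])
       (auto intro!: derivative_eq_intros Du)
  from partial_deriv_eqI[OF this, of i] have 1: "partial_deriv i (\<lambda>z. u (t *\<^sub>R z)) z = t * partial_deriv i u (t *\<^sub>R z)"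
    by (simp add: axis_def if_distrib[where f="\<lambda>x. _ * x"] if_distrib[where f="\<lambda>x. x * _"] mult.assoc cong: if_cong)
  have "((\<lambda>z. c * u z + d) has_derivative (\<lambda>h. c * (\<Sum>j\<in>UNIV. h $ j * partial_deriv j u z) + 0)) (at z)"
    by (intro has_derivative_add has_derivative_mult_right has_derivative_partial_deriv[OF u z] has_derivative_const)
  from partial_deriv_eqI[OF this, of i] have 2: "partial_deriv i (\<lambda>z. c * u z + d) z = c * partial_deriv i u z"
    by (simp add: axis_def if_distrib[where f="\<lambda>x. x * _"] cong: if_cong)
  have "partial_deriv i (\<lambda>z. u (t *\<^sub>R z)) z = partial_deriv i (\<lambda>z. c * u z + d) z"
    by (rule partial_deriv_cong[OF eq z])
  then show ?thesis unfolding 1 2 using t by (simp add: field_simps)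
qed

lemma laplacian_scale:
  fixes u :: "real^'n::finite \<Rightarrow> real"
  assumes u: "Ck_off0 (Suc (Suc k)) u" and t: "t > 0"
    and eq: "\<And>z. z \<noteq> 0 \<Longrightarrow> u (t *\<^sub>R z) = c * u z + d" and z: "z \<noteq> 0"
  shows "laplacian u (t *\<^sub>R z) = (c / t\<^sup>2) * laplacian u z"
proof -
  have "partial_deriv i (partial_deriv i u) (t *\<^sub>R z) = (c / t\<^sup>2) * partial_deriv i (partial_deriv i u) z" for i
    using partial_deriv_scale[OF Ck_off0_partial_deriv[OF u] t, of i "c / t" 0 z i] partial_deriv_scale[OF u t eq] z
    by (simp add: power2_eq_square)
  then show ?thesis by (simp add: laplacian_def sum_distrib_left)
qed

text \<open>The additive constant d comes from the logarithm and is killed by the first derivative,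
  so for k > 0 the result is genuinely homogeneous.\<close>

lemma neg_laplacian_iter_scale:
  fixes u :: "real^'n::finite \<Rightarrow> real"
  assumes "Ck_off0 (2 * k) u" and t: "t > 0"
    and eq: "\<And>z. z \<noteq> 0 \<Longrightarrow> u (t *\<^sub>R z) = c * u z + d" and "z \<noteq> 0"
  shows "neg_laplacian_iter k u (t *\<^sub>R z) = (c / t ^ (2 * k)) * neg_laplacian_iter k u z + (if k = 0 then d else 0)"
  using assms(1,4)
proof (induction k arbitrary: z)
  case (Suc k)
  have u: "Ck_off0 (2 * k) u" by (rule Ck_off0_mono[OF Suc.prems(1)]) simp
  have N: "Ck_off0 (Suc (Suc 0)) (neg_laplacian_iter k u)"
    by (rule Ck_off0_neg_laplacian_iter) (use Suc.prems(1) in simp)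
  have "laplacian (neg_laplacian_iter k u) (t *\<^sub>R z) = (c / t ^ (2 * k)) / t\<^sup>2 * laplacian (neg_laplacian_iter k u) z"
    by (rule laplacian_scale[OF N t Suc.IH[OF u] Suc.prems(2)])
  then show ?case by (simp add: neg_laplacian_iter_Suc power2_eq_square mult_ac)
qed (simp add: eq)

context kernel_profile
begin

text \<open>The case of \<open>transform_rotate\<close> in which y is a positive multiple of z, so
  that the rotation is the identity.\<close>

lemma transform_scale:
  fixes g :: "real^'n::finite \<Rightarrow> real"
  assumes g: "Ck_off0 k g" and t: "t > 0" and z: "z \<noteq> 0"
  shows "transform g (t *\<^sub>R z) = t ^ p * transform g z + q * ln t * (\<integral>\<xi>. g \<xi> \<partial>sphere_measure)"
proof -
  have n: "norm (t *\<^sub>R z) / norm z = t" "(t *\<^sub>R z) /\<^sub>R norm (t *\<^sub>R z) = z /\<^sub>R norm z" using t z by auto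
  have nz: "norm (z /\<^sub>R norm z) = 1" using z by simp
  have "z \<bullet> (t *\<^sub>R z) > 0" using t z by simp
  from transform_rotate[OF g this] show ?thesis
    unfolding n plane_rotation_same[OF nz] transform_def[symmetric] .
qed

text \<open>If the kernel had the wrong sign off the origin, its integral against the non-negative
  \<psi> would have it too. By symmetry of the Laplacian and duality that integral is the one over
  the sphere.\<close>

lemma exists_sign_of_test_integral:
  fixes g :: "real^'n::finite \<Rightarrow> real"
  assumes g: "Ck_off0 (2 * k) g" and \<psi>: "Ck_off0 (2 * k) \<psi>" "annular_support \<psi>" "\<And>z. \<psi> z \<ge> 0"
    and pos: "s * (\<integral>\<xi>. g \<xi> * dual_transform (neg_laplacian_iter k \<psi>) \<xi> \<partial>sphere_measure) > 0"
  shows "\<exists>z\<noteq>0. s * neg_laplacian_iter k (transform g) z > 0"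
proof (rule ccontr)
  assume no: "\<not> ?thesis"
  have f: "Ck_off0 (2 * k) (transform g)" by (rule Ck_off0_transform[OF g])
  have N: "Ck_off0 0 (neg_laplacian_iter k \<psi>)" by (rule Ck_off0_neg_laplacian_iter) (use \<psi> in simp)
  have "(\<integral>z. neg_laplacian_iter k (transform g) z * \<psi> z \<partial>lborel)
      = (\<integral>\<xi>. g \<xi> * dual_transform (neg_laplacian_iter k \<psi>) \<xi> \<partial>sphere_measure)"
    unfolding integral_neg_laplacian_iter_symmetric[OF f \<psi>(1,2)]
    by (rule integral_transform_dual[OF g N annular_support_neg_laplacian_iter[OF \<psi>(2)]])
  then have "0 < s * (\<integral>z. neg_laplacian_iter k (transform g) z * \<psi> z \<partial>lborel)" using pos by simp
  also have "\<dots> = - (\<integral>z. - (s * neg_laplacian_iter k (transform g) z * \<psi> z) \<partial>lborel)"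
    by (simp add: mult.assoc)
  also have "\<dots> \<le> 0"
  proof -
    have "AE z in lborel. 0 \<le> - (s * neg_laplacian_iter k (transform g) z * \<psi> z)"
      using AE_lborel_singleton[of 0]
    proof eventually_elim
      case (elim z)
      then have "s * neg_laplacian_iter k (transform g) z \<le> 0" using no by (meson not_le)
      then show ?case using \<psi>(3)[of z] by (simp add: mult_nonpos_nonneg)
    qed
    then show ?thesis by (simp add: integral_nonneg_AE del: Bochner_Integration.integral_minus)
  qed
  finally show False by simp
qed

text \<open>Two test functions, one for each sign, have dual transforms of opposite signs at the
  pole. A single cone symbol makes both integrals over the sphere take the sign prescribed at the
  pole, and homogeneity of degree p - 2k moves the points found into any ball.\<close>

lemma exists_sign_changing_symbol:
  assumes n: "CARD('n::finite) \<ge> 2" and m: "m \<ge> 2" and k: "p + 2 \<le> 2 * k"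
    and b: "\<exists>b R. Ck_real (2 * k) b \<and> bounded_support R b \<and> (\<forall>t. b t \<ge> 0) \<and> profile_pairing (2 * k) b \<noteq> 0"
  shows "\<exists>Q :: real^'n \<Rightarrow> real. elliptic_symbol m Q \<and> Ck_off0 (2 * k) (\<lambda>\<xi>. inverse (Q \<xi>)) \<and>
     (\<forall>s r. (s = 1 \<or> s = (-1::real)) \<longrightarrow> r > 0 \<longrightarrow>
        (\<exists>y. y \<noteq> 0 \<and> norm y < r \<and> s * neg_laplacian_iter k (transform (\<lambda>\<xi>. inverse (Q \<xi>))) y > 0))"
proof -
  obtain b R where b: "Ck_real (2 * k) b" "bounded_support R b" "\<And>t. b t \<ge> 0" "profile_pairing (2 * k) b \<noteq> 0"
    using assms(4) by blast
  \<comment> \<open>Any coordinate may serve as the axis.\<close>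
  define i0 :: 'n where "i0 = undefined"
  let ?e = "axis i0 1 :: real^'n"
  let ?D = "\<lambda>\<psi>. dual_transform (neg_laplacian_iter k \<psi>)"
  define P where "P s \<psi> \<longleftrightarrow> Ck_off0 (2 * k) \<psi> \<and> annular_support \<psi> \<and> (\<forall>z. \<psi> z \<ge> 0) \<and> s * ?D \<psi> ?e > 0" for s and \<psi> :: "real^'n \<Rightarrow> real"
  obtain \<psi>1 \<psi>2 where \<psi>: "P 1 \<psi>1" "P (-1) \<psi>2"
    using exists_test_functions[OF n k b, of 1 i0] exists_test_functions[OF n k b, of "-1" i0] unfolding P_def by auto
  have N: "Ck_off0 0 (neg_laplacian_iter k \<psi>)" "annular_support (neg_laplacian_iter k \<psi>)" if "P s \<psi>" for s \<psi>
    using that Ck_off0_neg_laplacian_iter[of k 0 \<psi>] annular_support_neg_laplacian_iter[of \<psi> k]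
    unfolding P_def by (simp_all del: Ck_off0.simps)
  have near: "\<exists>\<delta>. 0 < \<delta> \<and> \<delta> < 1 \<and> (\<forall>\<xi>. norm \<xi> = 1 \<longrightarrow> (\<xi> $ i0)\<^sup>2 > 1 - \<delta> \<longrightarrow> s * ?D \<psi> \<xi> \<ge> s * ?D \<psi> ?e / 2)"
    if "P s \<psi>" for s \<psi>
  proof (rule pole_neighbourhood[where \<Phi>="\<lambda>\<xi>. s * ?D \<psi> \<xi>"])
    show "s * ?D \<psi> (- \<xi>) = s * ?D \<psi> \<xi>" for \<xi> by (simp add: dual_transform_uminus)
    show "s * ?D \<psi> ?e > 0" using that by (simp add: P_def)
    show "(\<lambda>j. s * ?D \<psi> (X j)) \<longlonglongrightarrow> s * ?D \<psi> ?e" if "\<And>j. norm (X j) = 1" "X \<longlonglongrightarrow> ?e" for X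
      by (intro tendsto_mult tendsto_const dual_transform_continuous[OF N[OF \<open>P s \<psi>\<close>]] that) (simp add: norm_axis_1)
  qed
  obtain \<delta>1 where \<delta>1: "0 < \<delta>1" "\<delta>1 < 1" "\<And>\<xi>. norm \<xi> = 1 \<Longrightarrow> (\<xi> $ i0)\<^sup>2 > 1 - \<delta>1 \<Longrightarrow> 1 * ?D \<psi>1 \<xi> \<ge> 1 * ?D \<psi>1 ?e / 2"
    using near[OF \<psi>(1)] by blast
  obtain \<delta>2 where \<delta>2: "0 < \<delta>2" "\<delta>2 < 1" "\<And>\<xi>. norm \<xi> = 1 \<Longrightarrow> (\<xi> $ i0)\<^sup>2 > 1 - \<delta>2 \<Longrightarrow> -1 * ?D \<psi>2 \<xi> \<ge> -1 * ?D \<psi>2 ?e / 2"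
    using near[OF \<psi>(2)] by blast
  obtain C1 where C1: "\<And>\<xi>. norm \<xi> = 1 \<Longrightarrow> \<bar>?D \<psi>1 \<xi>\<bar> \<le> C1" using dual_transform_bounded[OF N[OF \<psi>(1)]] by blast
  obtain C2 where C2: "\<And>\<xi>. norm \<xi> = 1 \<Longrightarrow> \<bar>?D \<psi>2 \<xi>\<bar> \<le> C2" using dual_transform_bounded[OF N[OF \<psi>(2)]] by blast
  have Dm: "?D \<psi> \<in> borel_measurable borel" if "P s \<psi>" for s \<psi>
    by (rule dual_transform_measurable[OF Ck_off0_borel_measurable[OF N(1)[OF that]]])
  define c where "c = min (1 * ?D \<psi>1 ?e / 2) (-1 * ?D \<psi>2 ?e / 2)"
  have c: "c > 0" using \<psi> by (simp add: c_def P_def)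
  obtain \<alpha> \<epsilon> where Q: "\<epsilon> > 0"
    "(\<integral>\<xi>. inverse (cone_symbol m i0 \<alpha> \<epsilon> \<xi>) * (1 * ?D \<psi>1 \<xi>) \<partial>sphere_measure) > 0"
    "(\<integral>\<xi>. inverse (cone_symbol m i0 \<alpha> \<epsilon> \<xi>) * (-1 * ?D \<psi>2 \<xi>) \<partial>sphere_measure) > 0"
  proof -
    have "\<exists>\<alpha> \<epsilon>. \<epsilon> > 0 \<and> (\<integral>\<xi>. inverse (cone_symbol m i0 \<alpha> \<epsilon> \<xi>) * (1 * ?D \<psi>1 \<xi>) \<partial>sphere_measure) > 0
      \<and> (\<integral>\<xi>. inverse (cone_symbol m i0 \<alpha> \<epsilon> \<xi>) * (-1 * ?D \<psi>2 \<xi>) \<partial>sphere_measure) > 0"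
    proof (rule cone_symbol_concentrates[OF n _ _ _ _ c, where \<delta>="min \<delta>1 \<delta>2" and C="max C1 C2"])
      show "(\<lambda>\<xi>. 1 * ?D \<psi>1 \<xi>) \<in> borel_measurable borel" using Dm[OF \<psi>(1)] by simp
      show "(\<lambda>\<xi>. -1 * ?D \<psi>2 \<xi>) \<in> borel_measurable borel" using Dm[OF \<psi>(2)] by simp
      fix \<xi> :: "real^'n" assume \<xi>: "norm \<xi> = 1"
      show "\<bar>1 * ?D \<psi>1 \<xi>\<bar> \<le> max C1 C2 \<and> \<bar>-1 * ?D \<psi>2 \<xi>\<bar> \<le> max C1 C2"
        using C1[OF \<xi>] C2[OF \<xi>] by auto
      assume gt: "(\<xi> $ i0)\<^sup>2 > 1 - min \<delta>1 \<delta>2"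
      show "1 * ?D \<psi>1 \<xi> \<ge> c \<and> -1 * ?D \<psi>2 \<xi> \<ge> c"
        using \<delta>1(3)[OF \<xi>] \<delta>2(3)[OF \<xi>] gt unfolding c_def by (simp add: min_def split: if_splits)
    qed (use \<delta>1 \<delta>2 in auto)
    then show ?thesis using that by blast
  qed
  define g where "g \<xi> = inverse (cone_symbol m i0 \<alpha> \<epsilon> \<xi>)" for \<xi>
  have g: "Ck_off0 (2 * k) g" unfolding g_def by (rule Ck_off0_inverse_cone_symbol[OF Q(1)])
  have far: "\<exists>z\<noteq>0. s * neg_laplacian_iter k (transform g) z > 0" if s: "s = 1 \<or> s = (-1::real)" for s
  proof -
    have "s * (\<integral>\<xi>. g \<xi> * ?D (if s = 1 then \<psi>1 else \<psi>2) \<xi> \<partial>sphere_measure) > 0"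
      using Q(2,3) s by (auto simp: g_def)
    moreover have "P s (if s = 1 then \<psi>1 else \<psi>2)" using \<psi> s by auto
    ultimately show ?thesis unfolding P_def by (intro exists_sign_of_test_integral[OF g]) auto
  qed
  have "\<exists>y. y \<noteq> 0 \<and> norm y < r \<and> s * neg_laplacian_iter k (transform g) y > 0" if s: "s = 1 \<or> s = (-1::real)" and r: "r > 0" for s r
  proof -
    obtain z where z: "z \<noteq> 0" "s * neg_laplacian_iter k (transform g) z > 0" using far[OF s] by blast
    \<comment> \<open>The rescaled point has norm r/2. The scaling factor
      \<open>t ^ p / t ^ (2 * k)\<close> is positive, so the sign is kept; k \<noteq> 0 removes the
      logarithmic term.\<close>
    define t where "t = r / (2 * norm z)"
    have t: "t > 0" using r z by (simp add: t_def)
    have k0: "k \<noteq> 0" using k by auto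
    have "neg_laplacian_iter k (transform g) (t *\<^sub>R z) = (t ^ p / t ^ (2 * k)) * neg_laplacian_iter k (transform g) z"
      using neg_laplacian_iter_scale[OF Ck_off0_transform[OF g] t transform_scale[OF g t] z(1)] k0 by simp
    then have "s * neg_laplacian_iter k (transform g) (t *\<^sub>R z) = (t ^ p / t ^ (2 * k)) * (s * neg_laplacian_iter k (transform g) z)"
      by simp
    also have "\<dots> > 0" using t by (intro mult_pos_pos[OF _ z(2)]) simp
    finally have "s * neg_laplacian_iter k (transform g) (t *\<^sub>R z) > 0" .
    moreover have "t *\<^sub>R z \<noteq> 0" "norm (t *\<^sub>R z) < r" using z(1) r t by (auto simp: t_def)
    ultimately show ?thesis by blast
  qed
  then show ?thesis
    using elliptic_cone_symbol[OF m Q(1)] g unfolding g_def by (intro exI[of _ "cone_symbol m i0 \<alpha> \<epsilon>"]) blast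
qed

end

section \<open>From the transforms back to John's kernel\<close>

lemma set_integral_sphere_measure:
  fixes F :: "real^'n::finite \<Rightarrow> real"
  assumes [measurable]: "F \<in> borel_measurable borel"
  shows "(LINT \<xi>:sphere 0 1|hausdorff_measure (CARD('n) - 1). F \<xi>) = (\<integral>\<xi>. F \<xi> \<partial>sphere_measure)"
proof -
  have "(\<integral>\<xi>. F \<xi> \<partial>sphere_measure) = (\<integral>\<xi>. F \<xi> \<partial>density (hausdorff_measure (CARD('n) - 1)) (\<lambda>\<xi>. ennreal (indicator (sphere 0 1) \<xi>)))"
    by (simp add: sphere_measure_def ennreal_indicator[abs_def])
  also have "\<dots> = (\<integral>\<xi>. indicator (sphere 0 1) \<xi> *\<^sub>R F \<xi> \<partial>hausdorff_measure (CARD('n) - 1))"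
    by (rule integral_density) auto
  finally show ?thesis by (simp add: set_lebesgue_integral_def)
qed

text \<open>The sign change is exhibited at x = 0. There \<open>0 - z\<close> differs from z by a
  sign that the absolute value absorbs.\<close>

lemma john_kernel_odd:
  fixes Q :: "real^'n::finite \<Rightarrow> real"
  assumes "odd CARD('n)" and Q: "Ck_off0 k (\<lambda>\<xi>. inverse (Q \<xi>))"
  shows "john_kernel m Q 0 y = - 1 / (4 * (2 * pi) ^ (CARD('n) - 1)) *
     neg_laplacian_iter ((CARD('n) + 1 - 2 * m) div 2) (abs_profile.transform (\<lambda>\<xi>. inverse (Q \<xi>))) y"
proof -
  note [measurable] = Ck_off0_borel_measurable[OF Q]
  have "(LINT \<xi>:sphere 0 1|hausdorff_measure (CARD('n) - 1). \<bar>(0 - z) \<bullet> \<xi>\<bar> / Q \<xi>)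
      = abs_profile.transform (\<lambda>\<xi>. inverse (Q \<xi>)) z" for z
  proof -
    have "(\<lambda>\<xi>. \<bar>z \<bullet> \<xi>\<bar> * inverse (Q \<xi>)) \<in> borel_measurable borel" by measurable
    from set_integral_sphere_measure[OF this] show ?thesis
      unfolding abs_profile.transform_def by (simp add: divide_inverse)
  qed
  then show ?thesis using assms(1) by (simp add: john_kernel_def Let_def neg_laplacian_iter_def)
qed

lemma john_kernel_even:
  fixes Q :: "real^'n::finite \<Rightarrow> real"
  assumes "even CARD('n)" and Q: "Ck_off0 k (\<lambda>\<xi>. inverse (Q \<xi>))"
  shows "john_kernel m Q 0 y = - 1 / (2 * pi) ^ CARD('n) *
     neg_laplacian_iter ((CARD('n) - 2 * m) div 2) (ln_profile.transform (\<lambda>\<xi>. inverse (Q \<xi>))) y"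
proof -
  note [measurable] = Ck_off0_borel_measurable[OF Q]
  have "(LINT \<xi>:sphere 0 1|hausdorff_measure (CARD('n) - 1). ln \<bar>(0 - z) \<bullet> \<xi>\<bar> / Q \<xi>)
      = ln_profile.transform (\<lambda>\<xi>. inverse (Q \<xi>)) z" for z
  proof -
    have "(\<lambda>\<xi>. ln \<bar>z \<bullet> \<xi>\<bar> * inverse (Q \<xi>)) \<in> borel_measurable borel" by measurable
    from set_integral_sphere_measure[OF this] show ?thesis
      unfolding ln_profile.transform_def by (simp add: divide_inverse)
  qed
  then show ?thesis using assms(1) by (simp add: john_kernel_def Let_def neg_laplacian_iter_def)
qed

lemma sign_changing_near_diagonalI:
  fixes K :: "real^'n::finite \<Rightarrow> real^'n \<Rightarrow> real"
  assumes C: "C > 0" and K: "\<And>y. K 0 y = - C * f y"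
    and f: "\<forall>s r. (s = 1 \<or> s = (-1::real)) \<longrightarrow> r > 0 \<longrightarrow> (\<exists>y. y \<noteq> 0 \<and> norm y < r \<and> s * f y > 0)"
  shows "sign_changing_near_diagonal K"
  unfolding sign_changing_near_diagonal_def
proof (intro allI impI)
  fix r :: real assume r: "r > 0"
  obtain y1 where y1: "y1 \<noteq> 0" "norm y1 < r" "f y1 > 0" using f r by (metis mult_1)
  obtain y2 where y2: "y2 \<noteq> 0" "norm y2 < r" "- 1 * f y2 > 0" using f r by metis
  have "K 0 y1 < 0" using C y1(3) by (simp add: K)
  moreover have "K 0 y2 > 0" using C y2(3) by (simp add: K mult_pos_neg)
  ultimately show "(\<exists>x y. 0 < dist x y \<and> dist x y < r \<and> K x y > 0) \<and> (\<exists>x y. 0 < dist x y \<and> dist x y < r \<and> K x y < 0)"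
    using y1 y2 by (intro conjI exI[of _ 0] exI[of _ y1] exI[of _ y2]; simp)
qed

theorem corollary1p6:
  fixes m :: nat
  assumes "m \<ge> 2" and "CARD('n::finite) \<ge> 2 * m + 2"
  shows "\<exists>Q :: real^'n \<Rightarrow> real.
           elliptic_symbol m Q \<and> sign_changing_near_diagonal (john_kernel m Q)"
proof (cases "odd CARD('n)")
  case True
  let ?k = "(CARD('n) + 1 - 2 * m) div 2"
  \<comment> \<open>An odd n with n \<ge> 2m + 2 is at least 2m + 3, so 2k = n + 1 - 2m \<ge> 4,
    which exceeds the required p + 2 = 3.\<close>
  have k: "1 + 2 \<le> 2 * ?k" "?k \<ge> 1" using assms True by presburger+
  have "CARD('n) \<ge> 2" using assms by simp
  from abs_profile.exists_sign_changing_symbol[OF this assms(1) k(1) abs_profile_nondegenerate[OF k(2)]]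
  obtain Q :: "real^'n \<Rightarrow> real" where Q: "elliptic_symbol m Q" "Ck_off0 (2 * ?k) (\<lambda>\<xi>. inverse (Q \<xi>))"
    "\<forall>s r. (s = 1 \<or> s = (-1::real)) \<longrightarrow> r > 0 \<longrightarrow>
        (\<exists>y. y \<noteq> 0 \<and> norm y < r \<and> s * neg_laplacian_iter ?k (abs_profile.transform (\<lambda>\<xi>. inverse (Q \<xi>))) y > 0)"
    by blast
  have "sign_changing_near_diagonal (john_kernel m Q)"
    by (rule sign_changing_near_diagonalI[OF _ _ Q(3), of "1 / (4 * (2 * pi) ^ (CARD('n) - 1))"])
       (simp_all add: john_kernel_odd[OF True Q(2)])
  then show ?thesis using Q(1) by blast
next
  case False
  let ?k = "(CARD('n) - 2 * m) div 2"
  \<comment> \<open>Here 2k = n - 2m \<ge> 2 = p + 2, with equality in the borderline dimension n =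
    2m + 2.\<close>
  have k: "0 + 2 \<le> 2 * ?k" "?k \<ge> 1" using assms by presburger+
  have "CARD('n) \<ge> 2" using assms by simp
  from ln_profile.exists_sign_changing_symbol[OF this assms(1) k(1) ln_profile_nondegenerate[OF k(2)]]
  obtain Q :: "real^'n \<Rightarrow> real" where Q: "elliptic_symbol m Q" "Ck_off0 (2 * ?k) (\<lambda>\<xi>. inverse (Q \<xi>))"
    "\<forall>s r. (s = 1 \<or> s = (-1::real)) \<longrightarrow> r > 0 \<longrightarrow>
        (\<exists>y. y \<noteq> 0 \<and> norm y < r \<and> s * neg_laplacian_iter ?k (ln_profile.transform (\<lambda>\<xi>. inverse (Q \<xi>))) y > 0)"
    by blast
  have "even CARD('n)" using False by simp
  have "sign_changing_near_diagonal (john_kernel m Q)"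
    by (rule sign_changing_near_diagonalI[OF _ _ Q(3), of "1 / (2 * pi) ^ CARD('n)"])
       (simp_all add: john_kernel_even[OF \<open>even CARD('n)\<close> Q(2)])
  then show ?thesis using Q(1) by blast
qed

end
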